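(* For every $N>0$ there is a constant $C(N)$, depending only on $N$, such that the following holds. Let $\mathcal{L}$ be a Lorenz link represented by a Lorenz braid with defining vector $\vec d_L=\langle d_1,\dots,d_p\rangle=\langle r_1^{s_1},\dots,r_k^{s_k}\rangle$ such that either $p\le N$ or $d_p\le N$; equivalently, $\mathcal{L}=T((r_1,s_1),\dots,(r_k,s_k))$ is a T-link whose T-braid has either $r_k\le N$ or $s_1+\dots+s_k\le N$. Then the Mahler measure of the Jones polynomial of $\mathcal{L}$ is at most $C(N)$.
   Context: For integers $p\ge 2$ and $2\le d_1\le d_2\le\dots\le d_{p-1}=d_p$, the Lorenz braid with defining vector $\langle d_1,\dots,d_p\rangle$ is the positive braid on $p+d_p$ strands in which, for $1\le i\le p$, the strand beginning at position $i$ (an overcrossing strand) ends at position $i+d_i$; the $d_p$ strands beginning at positions $p+1,\dots,p+d_p$ (undercrossing strands) fill the remaining end positions in order-preserving fashion; any two strands cross at most once, and every crossing is an overcrossing strand passing over an undercrossing strand, all crossings being positive. Writing the vector as $\langle r_1^{s_1},\dots,r_k^{s_k}\rangle$ with $r_1<\dots<r_k$ means $r_i$ is repeated $s_i\ge1$ times; thus $p=s_1+\dots+s_k$ and $d_p=r_k$. A Lorenz link is a link which is the closure of a Lorenz braid (every nontrivial Lorenz link has a vector of this form). For integers $2\le r_1\le\dots\le r_k$ and $s_i>0$, the T-link $T((r_1,s_1),\dots,(r_k,s_k))$ is the closure of the $r_k$-strand T-braid $(\sigma_1\cdots\sigma_{r_1-1})^{s_1}\cdots(\sigma_1\cdots\sigma_{r_k-1})^{s_k}$.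 The closure of the Lorenz braid with vector $\langle r_1^{s_1},\dots,r_k^{s_k}\rangle$ is the T-link $T((r_1,s_1),\dots,(r_k,s_k))$. The Mahler measure of a nonzero Laurent polynomial $f(t)$ is $M(f)=\exp\int_0^1\log|f(e^{2\pi i\theta})|\,d\theta$; it is unchanged by multiplication of $f$ by a power of $t$, and for a Jones polynomial $V_{\mathcal{L}}(t)\in t^{1/2}\mathbb{Z}[t^{\pm1}]$ one first multiplies by $t^{1/2}$. *)

theory Defs
  imports
    "HOL-Analysis.Analysis"
    "HOL-Library.Poly_Mapping"
    "HOL-Combinatorics.Transposition"
begin

section \<open>Integral Laurent polynomials and Mahler measure\<close>

text \<open>
  Finitely supported maps from the additive group of integers, with the convolution product,
  are the ring of Laurent polynomials: the value at \<open>k\<close> is the coefficient of the \<open>k\<close>-th power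
  of the variable.
\<close>

type_synonym laurent = "int \<Rightarrow>\<^sub>0 int"

abbreviation var_pow :: "int \<Rightarrow> laurent" where
  "var_pow k \<equiv> Poly_Mapping.single k 1"

definition laurent_eval :: "laurent \<Rightarrow> complex \<Rightarrow> complex" where
  "laurent_eval f z = (\<Sum>k\<in>Poly_Mapping.keys f. of_int (Poly_Mapping.lookup f k) * z powi k)"

definition mahler_measure :: "laurent \<Rightarrow> real" where
  "mahler_measure f =
     exp (integral {0..1} (\<lambda>\<theta>. ln (cmod (laurent_eval f (cis (2 * pi * \<theta>))))))"


section \<open>Braid words\<close>

text \<open>
  Strand positions and generators are numbered from 1.  Braids are read upwards, so that the
  first letter is at the bottom.  In \<open>Pos i\<close> (the generator \<open>\<sigma>\<^sub>i\<close>, a positive crossing) the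
  strand at position \<open>i\<close> moves to position \<open>i + 1\<close>, passing over the strand moving from
  \<open>i + 1\<close> to \<open>i\<close>.  In \<open>Neg i\<close> (its inverse) it passes under that strand.
\<close>

datatype braid_gen = Pos (gen_index: nat) | Neg (gen_index: nat)

type_synonym braid_word = "braid_gen list"

definition braid_on :: "nat \<Rightarrow> braid_word \<Rightarrow> bool" where
  "braid_on n w \<longleftrightarrow> (\<forall>g\<in>set w. 1 \<le> gen_index g \<and> gen_index g < n)"

fun is_positive_gen :: "braid_gen \<Rightarrow> bool" where
  "is_positive_gen (Pos i) = True"
| "is_positive_gen (Neg i) = False"

definition writhe :: "braid_word \<Rightarrow> int" where
  "writhe w = (\<Sum>g\<leftarrow>w. if is_positive_gen g then 1 else - 1)"

text \<open>The end position of the strand of \<open>w\<close> that begins at position \<open>x\<close>.\<close>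

fun end_pos :: "braid_word \<Rightarrow> nat \<Rightarrow> nat" where
  "end_pos [] x = x"
| "end_pos (g # w) x = end_pos w (Transposition.transpose (gen_index g) (Suc (gen_index g)) x)"

text \<open>At the \<open>k\<close>-th crossing, the strand beginning at \<open>x\<close> passes over the one beginning at \<open>y\<close>.\<close>

definition crosses_over :: "braid_word \<Rightarrow> nat \<Rightarrow> nat \<Rightarrow> nat \<Rightarrow> bool" where
  "crosses_over w k x y \<longleftrightarrow>
     (case w ! k of
        Pos i \<Rightarrow> end_pos (take k w) x = i \<and> end_pos (take k w) y = Suc i
      | Neg i \<Rightarrow> end_pos (take k w) x = Suc i \<and> end_pos (take k w) y = i)"


section \<open>The Jones polynomial of a closed braid\<close>

text \<open>
  A Kauffman state of the closure of \<open>w\<close> is the set \<open>S\<close> of the crossings that receive the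
  A-smoothing.  With the orientation given by the braid direction, the smoothing into two vertical
  strands (the one that respects the orientation) is the A-smoothing of a positive crossing
  and the B-smoothing of a negative one.
\<close>

definition smoothed_vertically :: "braid_word \<Rightarrow> nat set \<Rightarrow> nat \<Rightarrow> bool" where
  "smoothed_vertically w S k \<longleftrightarrow> (k \<in> S \<longleftrightarrow> is_positive_gen (w ! k))"

text \<open>
  The smoothed diagram as a graph: its vertices are the points \<open>(x, k)\<close> at position
  \<open>x\<close> on the horizontal line below the \<open>k\<close>-th letter (above the last letter for
  \<open>k = length w\<close>).  The edges are the vertical arcs, the caps and cups of the smoothed
  crossings, and the closing arcs of the braid.
\<close>

definition state_vertices :: "nat \<Rightarrow> braid_word \<Rightarrow> (nat \<times> nat) set" where
  "state_vertices n w = {1..n} \<times> {0..length w}"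

definition state_arcs :: "nat \<Rightarrow> braid_word \<Rightarrow> nat set \<Rightarrow> ((nat \<times> nat) \<times> (nat \<times> nat)) set" where
  "state_arcs n w S =
     {((x, k), (x, Suc k)) | x k. x \<in> {1..n} \<and> k < length w \<and>
        (smoothed_vertically w S k \<or> x \<notin> {gen_index (w ! k), Suc (gen_index (w ! k))})}
   \<union> {((i, k), (Suc i, k)) | i k. k < length w \<and> i = gen_index (w ! k) \<and>
        \<not> smoothed_vertically w S k}
   \<union> {((i, Suc k), (Suc i, Suc k)) | i k. k < length w \<and> i = gen_index (w ! k) \<and>
        \<not> smoothed_vertically w S k}
   \<union> {((x, length w), (x, 0)) | x. x \<in> {1..n}}"

definition state_circles :: "nat \<Rightarrow> braid_word \<Rightarrow> nat set \<Rightarrow> nat" where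
  "state_circles n w S =
     card (state_vertices n w // (state_arcs n w S \<union> (state_arcs n w S)\<inverse>)\<^sup>*)"

text \<open>The Kauffman bracket in the variable \<open>A\<close>, normalised to 1 on a single circle.\<close>

definition kauffman_bracket :: "nat \<Rightarrow> braid_word \<Rightarrow> laurent" where
  "kauffman_bracket n w =
     (\<Sum>S\<in>Pow {..<length w}.
        var_pow (int (card S) - int (card ({..<length w} - S))) *
        (- var_pow 2 - var_pow (- 2)) ^ (state_circles n w S - 1))"

text \<open>The bracket times \<open>(- A\<^sup>3)\<close> to the power minus the writhe, still in the variable \<open>A\<close>.\<close>

definition normalised_bracket :: "nat \<Rightarrow> braid_word \<Rightarrow> laurent" where
  "normalised_bracket n w =
     Poly_Mapping.single (- 3 * writhe w) (if even (writhe w) then 1 else - 1) *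
     kauffman_bracket n w"

text \<open>
  The Jones polynomial \<open>V(t)\<close> is obtained by putting \<open>t = A\<close> to the power \<open>- 4\<close>.
  It is a Laurent polynomial in the square root of \<open>t\<close>, and here the coefficient at \<open>j\<close> is that
  of \<open>t\<close> to the power \<open>j / 2\<close>, i.e. of \<open>A\<close> to the power \<open>- 2 * j\<close>; only even powers of
  \<open>A\<close> occur in the normalised bracket.
\<close>

definition jones_sqrt :: "nat \<Rightarrow> braid_word \<Rightarrow> laurent" where
  "jones_sqrt n w = Poly_Mapping.map_key (\<lambda>j. - 2 * j) (normalised_bracket n w)"

text \<open>
  The Jones polynomial as a Laurent polynomial in \<open>t\<close>, after multiplication by the square root of
  \<open>t\<close> when its exponents are not integers.  They are then all half-odd, which is
  the case of an even number of components.
\<close>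

definition jones :: "nat \<Rightarrow> braid_word \<Rightarrow> laurent" where
  "jones n w =
     (let V = jones_sqrt n w
      in Poly_Mapping.map_key (\<lambda>j. 2 * j)
           (if \<forall>j\<in>Poly_Mapping.keys V. even j then V else var_pow 1 * V))"


section \<open>Lorenz braids and T-braids\<close>

definition lorenz_vector :: "nat list \<Rightarrow> bool" where
  "lorenz_vector ds \<longleftrightarrow>
     length ds \<ge> 2 \<and> (\<forall>d\<in>set ds. 2 \<le> d) \<and> sorted ds \<and>
     ds ! (length ds - 2) = ds ! (length ds - 1)"

definition lorenz_strands :: "nat list \<Rightarrow> nat" where
  "lorenz_strands ds = length ds + last ds"

text \<open>
  The braid words that present the Lorenz braid with defining vector \<open>ds\<close>.  List indices start at
  0, whence \<open>ds ! (i - 1)\<close> for the \<open>i\<close>-th entry.  As \<open>end_pos w\<close> permutes the positions,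
  the undercrossing strands automatically fill the end positions left by the others.
\<close>

definition lorenz_braid :: "nat list \<Rightarrow> braid_word \<Rightarrow> bool" where
  "lorenz_braid ds w \<longleftrightarrow>
     (let p = length ds; n = lorenz_strands ds in
        braid_on n w \<and> (\<forall>g\<in>set w. is_positive_gen g) \<and>
        (\<forall>i\<in>{1..p}. end_pos w i = i + ds ! (i - 1)) \<and>
        strict_mono_on {p+1..n} (end_pos w) \<and>
        (\<forall>x\<in>{1..n}. \<forall>y\<in>{1..n}.
           card {k. k < length w \<and> (crosses_over w k x y \<or> crosses_over w k y x)} \<le> 1) \<and>
        (\<forall>k<length w. \<forall>x\<in>{1..n}. \<forall>y\<in>{1..n}.
           crosses_over w k x y \<longrightarrow> x \<in> {1..p} \<and> y \<in> {p+1..n}))"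

text \<open>A list of pairs \<open>(r, s)\<close> encodes the exponents of a vector and the parameters of a T-link.\<close>

definition run_expand :: "(nat \<times> nat) list \<Rightarrow> nat list" where
  "run_expand rss = concat (map (\<lambda>(r, s). replicate s r) rss)"

definition t_braid :: "(nat \<times> nat) list \<Rightarrow> braid_word" where
  "t_braid rss = concat (map (\<lambda>(r, s). concat (replicate s (map Pos [1..<r]))) rss)"

end

theory Submission
  imports Defs
begin

text \<open>
  The bracket of a closed braid is a trace in a representation of the Temperley-Lieb algebra, and
  in this algebra the full twist is annihilated by a polynomial whose roots are distinct
  monomials in the variable (\<open>full_twist_annihilated\<close>).  So the bracket of a braid in which a
  full twist is repeated \<open>q\<close> times satisfies a linear recurrence in \<open>q\<close>.  Solving it by
  interpolation needs a denominator \<open>D\<close>, a product of differences of the roots: \<open>D\<close> times the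
  bracket is a sum of boundedly many terms, each of them a monomial depending on \<open>q\<close> times a
  Laurent polynomial that does not (\<open>recurrence_solution\<close>).  Hence the sum of the absolute values of
  the coefficients of \<open>D\<close> times the bracket is bounded independently of \<open>q\<close>.  The same holds for
  several repeated twists, with the product of the denominators, and a T-braid on \<open>n\<close> strands is
  a product of powers of the \<open>n\<close> twists on the leftmost strands (\<open>tame_t_brackets\<close>).

  If \<open>D f\<close> is bounded by \<open>B\<close> on the unit circle then \<open>log |f| \<le> log B - log |D|\<close> there, and
  \<open>log |D|\<close> is integrable; this bounds the Mahler measure of \<open>f\<close> by a number depending on \<open>D\<close>
  and \<open>B\<close> only (\<open>mahler_measure_bounded\<close>).  The differences of exponents in \<open>D\<close> are multiples
  of 4.  Therefore \<open>D\<close> is, up to a monomial, a Laurent polynomial in the variable of the Jones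
  polynomial, and the bound for the bracket passes to the Jones polynomial
  (\<open>len_binomials_extract\<close>).

  The trace comes from colourings.  For an integer \<open>m \<ge> 1\<close> let \<open>A\<close> be a complex number with
  \<open>- A\<^sup>2 - A\<^sup>-\<^sup>2 = m\<close>.  The number \<open>m\<close> to the power of the number of circles of a state counts the
  colourings of the smoothed diagram by \<open>m\<close> colours that are constant along its arcs, and these are
  counted, line after line, by a product of matrices indexed by the colourings of \<open>n\<close> points
  (\<open>colour_trace_eq_bracket\<close>).  An identity between Laurent polynomials holds as soon as it
  holds at these infinitely many numbers \<open>A\<close> (\<open>laurent_eqI\<close>).

  It remains to reduce Lorenz braids, and T-braids with few factors, to T-braids on
  few strands.  Far commutations sort the letters of a Lorenz braid into rows, one for each
  overcrossing strand, and destabilising once for every row leaves the T-braid on \<open>d\<^sub>p\<close> strands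
  (\<open>bracket_lorenz_t_word\<close>).  Sorted by undercrossing strands instead, and read from right to left
  across the strands, the same letters form the Lorenz braid of the conjugate partition, in which
  \<open>p\<close> and \<open>d\<^sub>p\<close> are exchanged (\<open>bracket_lorenz_conjugate\<close>).
\<close>

section \<open>Laurent polynomials: evaluation and length\<close>

abbreviation monomial :: "int \<Rightarrow> int \<Rightarrow> laurent" where "monomial \<equiv> Poly_Mapping.single"

abbreviation supp :: "laurent \<Rightarrow> int set" where "supp \<equiv> Poly_Mapping.keys"

abbreviation cf :: "laurent \<Rightarrow> int \<Rightarrow> int" where "cf \<equiv> Poly_Mapping.lookup"

lemma cf_monomial_mult:
  fixes f :: laurent
  shows "cf (monomial k c * f) j = c * cf f (j - k)"
proof -
  have "Sum_any (\<lambda>q. cf f q when j = k + q) = cf f (j - k)"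
    proof -
    have "j = k + q \<longleftrightarrow> q = j - k" for q by auto
    then show ?thesis by (simp only: Sum_any_when_equal)
  qed
  then show ?thesis
    by (simp add: lookup_mult lookup_single when_mult)
qed

lemma laurent_sum_monomials: "f = (\<Sum>k\<in>supp f. monomial k (cf f k))"
  by (rule poly_mapping_eqI)
    (auto simp: lookup_sum lookup_single when_def in_keys_iff sum.delta)

lemma laurent_eval_superset:
  assumes "finite K" "supp f \<subseteq> K"
  shows "laurent_eval f z = (\<Sum>k\<in>K. of_int (cf f k) * z powi k)"
  unfolding laurent_eval_def using assms by (intro sum.mono_neutral_left) (auto simp: in_keys_iff)

lemma laurent_eval_0 [simp]: "laurent_eval 0 z = 0"
  by (simp add: laurent_eval_def)

lemma laurent_eval_single [simp]: "laurent_eval (monomial k c) z = of_int c * z powi k"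
  by (simp add: laurent_eval_def)

lemma laurent_eval_1 [simp]: "laurent_eval 1 z = 1"
  by (simp flip: single_one)

lemma laurent_eval_add: "laurent_eval (f + g) z = laurent_eval f z + laurent_eval g z"
proof -
  let ?K = "supp f \<union> supp g"
  have "supp (f + g) \<subseteq> ?K" by (rule keys_add)
  then show ?thesis
    by (simp add: laurent_eval_superset[of ?K] lookup_add distrib_right sum.distrib)
qed

lemma laurent_eval_uminus: "laurent_eval (- f) z = - laurent_eval f z"
  using laurent_eval_add[of f "- f" z] by (simp add: add_eq_0_iff)

lemma laurent_eval_diff: "laurent_eval (f - g) z = laurent_eval f z - laurent_eval g z"
  using laurent_eval_add[of f "- g" z] by (simp add: laurent_eval_uminus)

lemma laurent_eval_sum: "laurent_eval (\<Sum>i\<in>I. f i) z = (\<Sum>i\<in>I. laurent_eval (f i) z)"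
  by (induction I rule: infinite_finite_induct) (simp_all add: laurent_eval_add)

lemma keys_monomial_mult:
  fixes f :: laurent
  shows "supp (monomial k c * f) \<subseteq> (+) k ` supp f"
proof
  fix j assume "j \<in> supp (monomial k c * f)"
  then have "j - k \<in> supp f" by (simp add: in_keys_iff cf_monomial_mult)
  then show "j \<in> (+) k ` supp f" by force
qed

lemma laurent_eval_monomial_mult:
  assumes "z \<noteq> 0"
  shows "laurent_eval (monomial k c * f) z = of_int c * z powi k * laurent_eval f z"
proof -
  have "laurent_eval (monomial k c * f) z =
      (\<Sum>j\<in>supp f. of_int (c * cf f j) * z powi (k + j))"
    by (subst laurent_eval_superset[OF _ keys_monomial_mult])
      (simp_all add: sum.reindex cf_monomial_mult)
  then show ?thesis
    using assms by (simp add: laurent_eval_def sum_distrib_left power_int_add mult_ac)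
qed

lemma laurent_eval_mult:
  assumes "z \<noteq> 0"
  shows "laurent_eval (f * g) z = laurent_eval f z * laurent_eval g z"
proof -
  have "laurent_eval (f * g) z =
      laurent_eval (\<Sum>k\<in>supp f. monomial k (cf f k) * g) z"
    by (subst laurent_sum_monomials[of f]) (simp add: sum_distrib_right)
  also have "\<dots> = laurent_eval f z * laurent_eval g z"
    by (simp add: laurent_eval_sum laurent_eval_monomial_mult[OF assms] laurent_eval_def[of f]
        sum_distrib_right)
  finally show ?thesis .
qed

lemma laurent_eval_power: "z \<noteq> 0 \<Longrightarrow> laurent_eval (f ^ n) z = laurent_eval f z ^ n"
  by (induction n) (simp_all add: laurent_eval_mult)

text \<open>
  A power of the variable turns the Laurent polynomial into a polynomial with infinitely many roots.
\<close>

lemma laurent_eq_0I: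
  assumes "infinite Z" "0 \<notin> Z" "\<And>z. z \<in> Z \<Longrightarrow> laurent_eval f z = 0"
  shows "f = 0"
proof -
  \<comment> \<open>A shift that makes all exponents non-negative.\<close>
  define K where "K = (\<Sum>k\<in>supp f. \<bar>k\<bar>)"
  have K: "k + K \<ge> 0" if "k \<in> supp f" for k
    using member_le_sum[of k "supp f" "\<lambda>k. \<bar>k\<bar>"] that by (simp add: K_def)
  define p where "p = (\<Sum>k\<in>supp f. monom (of_int (cf f k) :: complex) (nat (k + K)))"
  have eval: "poly p z = z powi K * laurent_eval f z" if "z \<noteq> 0" for z
  proof -
    have "z ^ nat (k + K) = z powi K * z powi k" if "k \<in> supp f" for k
    proof -
      have "z ^ nat (k + K) = z powi (k + K)" using K[OF that] by (simp add: power_int_def)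
      then show ?thesis using \<open>z \<noteq> 0\<close> by (simp add: power_int_add)
    qed
    then show ?thesis
      by (simp add: p_def poly_sum poly_monom laurent_eval_def sum_distrib_left mult_ac)
  qed
  have "Z \<subseteq> {z. poly p z = 0}"
  proof
    fix z assume "z \<in> Z"
    moreover from this have "z \<noteq> 0" using assms(2) by metis
    ultimately show "z \<in> {z. poly p z = 0}" using eval assms(3) by simp
  qed
  then have "infinite {z. poly p z = 0}" using assms(1) infinite_super by blast
  then have "p = 0" using poly_roots_finite by blast
  have "cf f k = 0" for k
  proof (cases "k \<in> supp f")
    case True
    have "coeff p (nat (k + K)) =
        (\<Sum>j\<in>supp f. if j = k then of_int (cf f k) else 0)"
      unfolding p_def coeff_sum
    proof (rule sum.cong)
      fix j assume j: "j \<in> supp f"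
      have "nat (j + K) = nat (k + K) \<longleftrightarrow> j = k" using K[OF j] K[OF True] by linarith
      then show "coeff (monom (of_int (cf f j) :: complex) (nat (j + K))) (nat (k + K)) =
          (if j = k then of_int (cf f k) else 0)" by simp
    qed simp
    also have "\<dots> = of_int (cf f k)" using True by (simp only: sum.delta finite_keys if_True)
    finally show ?thesis using \<open>p = 0\<close> by simp
  qed (simp add: in_keys_iff)
  then show ?thesis by (intro poly_mapping_eqI) simp
qed

text \<open>
  The length of a Laurent polynomial, an upper bound for its modulus on the unit circle that is
  unchanged by multiplication with a power of the variable.
\<close>

definition len :: "laurent \<Rightarrow> real" where
  "len f = (\<Sum>k\<in>supp f. \<bar>of_int (cf f k)\<bar>)"

lemma len_superset:
  assumes "finite K" "supp f \<subseteq> K"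
  shows "len f = (\<Sum>k\<in>K. \<bar>of_int (cf f k)\<bar>)"
  unfolding len_def using assms by (intro sum.mono_neutral_left) (auto simp: in_keys_iff)

lemma len_nonneg [simp]: "0 \<le> len f"
  by (simp add: len_def sum_nonneg)

lemma len_add: "len (f + g) \<le> len f + len g"
proof -
  let ?K = "supp f \<union> supp g"
  have "supp (f + g) \<subseteq> ?K" by (rule keys_add)
  then show ?thesis
    by (simp add: len_superset[of ?K] lookup_add flip: sum.distrib)
      (intro sum_mono, simp add: abs_triangle_ineq)
qed

lemma len_uminus [simp]: "len (- f) = len f"
  by (simp add: len_def)

lemma len_diff: "len (f - g) \<le> len f + len g"
  using len_add[of f "- g"] by simp

lemma len_0 [simp]: "len 0 = 0"
  by (simp add: len_def)

lemma len_sum: "len (\<Sum>i\<in>I. f i) \<le> (\<Sum>i\<in>I. len (f i))"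
  by (induction I rule: infinite_finite_induct) (auto intro: order_trans[OF len_add])

lemma len_monomial_mult [simp]: "len (monomial k c * f) = \<bar>of_int c\<bar> * len f"
  by (subst len_superset[OF _ keys_monomial_mult])
    (simp_all add: sum.reindex cf_monomial_mult len_def sum_distrib_left abs_mult)

lemma norm_laurent_eval_le_len: "cmod z = 1 \<Longrightarrow> cmod (laurent_eval f z) \<le> len f"
  unfolding laurent_eval_def len_def
  by (rule order_trans[OF norm_sum]) (simp add: norm_mult norm_power_int)


section \<open>Bounding the Mahler measure through a multiple\<close>

lemma sin_lower_bound:
  fixes y :: real
  assumes "0 \<le> y" "y \<le> 1"
  shows "y * (1 - y) \<le> sin (pi * y)"
proof -
  have *: "y \<le> sin (pi * y)" if "0 \<le> y" "y \<le> 1/2" for y :: real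
  proof -
    let ?t = "pi * y"
    have "?t \<le> 4 * (1 / 2)"
      using that pi_less_4 by (intro mult_mono) auto
    then have t: "0 \<le> ?t" "?t \<le> 2" using that by auto
    have "\<bar>sin ?t - (\<Sum>m<3. sin_coeff m * ?t ^ m)\<bar> \<le> inverse (fact 3) * \<bar>?t\<bar> ^ 3"
      by (rule Maclaurin_sin_bound)
    moreover have "(\<Sum>m<3. sin_coeff m * ?t ^ m) = ?t"
      by (simp add: numeral_3_eq_3 sin_coeff_def)
    moreover have "inverse (fact 3) * \<bar>?t\<bar> ^ 3 \<le> 2 / 3 * ?t"
    proof -
      have "?t ^ 3 = ?t * ?t\<^sup>2" by (simp add: power3_eq_cube power2_eq_square)
      also have "\<dots> \<le> ?t * 2\<^sup>2" using t by (intro mult_left_mono power_mono) auto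
      finally show ?thesis using t by (simp add: fact_numeral)
    qed
    ultimately have "?t / 3 \<le> sin ?t" by (simp add: abs_le_iff)
    moreover have "y \<le> ?t / 3" using that pi_gt3 mult_right_mono[of 3 pi y] by simp
    ultimately show ?thesis by simp
  qed
  show ?thesis
  proof (cases "y \<le> 1/2")
    case True
    have "y * (1 - y) \<le> y * 1" using assms by (intro mult_left_mono) auto
    then show ?thesis using *[of y] True assms by simp
  next
    case False
    have "sin (pi * (1 - y)) = sin (pi * y)" by (simp add: algebra_simps)
    moreover have "y * (1 - y) \<le> 1 * (1 - y)" using assms by (intro mult_right_mono) auto
    ultimately show ?thesis using *[of "1 - y"] False assms by simp
  qed
qed

lemma ln_lower_bound:
  fixes x :: real
  assumes "0 \<le> x"
  shows "- ln x \<le> 2 * x powr (- (1/2))"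
proof (cases "x = 0")
  case False
  then have "- ln x = 2 * ln (x powr (- (1/2)))" using assms by (simp add: ln_powr)
  also have "ln (x powr (- (1/2))) \<le> x powr (- (1/2))"
    using assms False ln_less_self[of "x powr (- (1/2))"] by (simp add: less_imp_le)
  finally show ?thesis by simp
qed simp

text \<open>
  Near its two singularities the logarithm is dominated by inverse square roots of the distances to
  them.
\<close>

lemma integrable_ln_sin_unit: "(\<lambda>y. ln (2 * \<bar>sin (pi * y)\<bar>)) integrable_on {0..1::real}"
proof -
  let ?f = "\<lambda>y::real. ln (2 * \<bar>sin (pi * y)\<bar>)"
  let ?g = "\<lambda>y::real. ln 2 + (2 * y powr (- (1/2)) + 2 * (1 - y) powr (- (1/2)))"
  have 1: "(\<lambda>y::real. y powr (- (1/2))) integrable_on {0..1}"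
    by (rule integrable_on_powr_from_0) auto
  then have "(\<lambda>y::real. y powr (- (1/2))) integrable_on cbox 0 1" by simp
  from integrable_affinity[OF this, of "-1" 1]
  have 2: "(\<lambda>y::real. (1 - y) powr (- (1/2))) integrable_on {0..1}" by simp
  have g: "?g integrable_on {0..1}"
    using 1 2 by (intro integrable_add integrable_on_cmult_left) auto
  have "?f \<in> borel_measurable borel" by measurable
  then have f: "?f \<in> borel_measurable (lebesgue_on {0..1})"
    by (intro measurable_restrict_space1 measurable_completion) simp
  have "norm (?f y) \<le> ?g y" if "y \<in> {0..1}" for y
  proof (cases "y = 0 \<or> y = 1")
    case True
    then show ?thesis by auto
  next
    case False
    then have y: "0 < y" "y < 1" using that by auto
    then have "0 < pi * y" "pi * y < pi" by simp_all
    then have pos: "0 < sin (pi * y)" by (rule sin_gt_zero)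
    have "?f y \<le> ln 2" using pos by simp
    moreover have "ln (y * (1 - y)) \<le> ?f y"
      using sin_lower_bound[of y] y pos by (subst ln_le_cancel_iff) auto
    moreover have "ln (y * (1 - y)) = ln y + ln (1 - y)" using y by (simp add: ln_mult)
    moreover have "- ln y \<le> 2 * y powr (- (1/2))" "- ln (1 - y) \<le> 2 * (1 - y) powr (- (1/2))"
      using y by (auto intro!: ln_lower_bound simp del: minus_divide_left)
    moreover have "0 \<le> 2 * y powr (- (1/2))" "0 \<le> 2 * (1 - y) powr (- (1/2))" "0 \<le> ln (2::real)"
      by auto
    ultimately show ?thesis unfolding real_norm_def by linarith
  qed
  then have "?f absolutely_integrable_on {0..1}"
    by (intro measurable_bounded_by_integrable_imp_absolutely_integrable[OF f _ g]) auto
  then show ?thesis by (simp add: absolutely_integrable_on_def)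
qed

text \<open>
  The modulus of the sine has period \<open>pi\<close>, so the unit interval can be repeated \<open>d\<close> times and
  then shrunk.
\<close>

lemma integrable_ln_sin:
  assumes "0 < d"
  shows "(\<lambda>\<theta>. ln (2 * \<bar>sin (pi * (real d * \<theta>))\<bar>)) integrable_on {0..1::real}"
proof -
  let ?f = "\<lambda>y::real. ln (2 * \<bar>sin (pi * y)\<bar>)"
  have step: "?f integrable_on {real n..1 + real n}" for n
  proof -
    have f: "?f integrable_on cbox 0 1" using integrable_ln_sin_unit by simp
    have "(\<lambda>x. x + real n) ` {0..1} = {real n..1 + real n}"
      using image_add_atLeastAtMost[of "real n" 0 1] by (simp add: add.commute image_def)
    then have "(\<lambda>y. ?f (y - real n)) integrable_on {real n..1 + real n}"
      using integrable_affinity[OF f, of 1 "- real n"] by simp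
    moreover have "\<bar>sin (pi * (y - real n))\<bar> = \<bar>sin (pi * y)\<bar>" for y
      by (simp add: right_diff_distrib sin_diff abs_mult power_abs)
    ultimately show ?thesis by simp
  qed
  have f: "?f integrable_on {0..real n}" for n
  proof (induction n)
    case (Suc n)
    show ?case
      by (rule Henstock_Kurzweil_Integration.integrable_combine[of _ "real n"])
        (use Suc step[of n] in \<open>simp_all add: add.commute\<close>)
  next
    case 0
    show ?case using integrable_on_refl[of ?f 0] by simp
  qed
  have "(\<lambda>x. x / real d) ` {0..real d} = {0..1}"
    using assms by (subst image_divide_atLeastAtMost) auto
  with integrable_stretch_real[OF f[of d], of "real d"] assms show ?thesis by simp
qed

lemma norm_powi_cis_diff:
  "cmod (cis t powi a - cis t powi b) = 2 * \<bar>sin (of_int (a - b) * t / 2)\<bar>"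
proof -
  let ?s = "of_int (a - b) * t / 2"
  have "cis t powi a - cis t powi b = cis t powi b * (cis t powi (a - b) - 1)"
    by (simp add: algebra_simps flip: power_int_add)
  then have "cmod (cis t powi a - cis t powi b) = cmod (cis (2 * ?s) - 1)"
    by (simp add: norm_mult norm_power_int cis_power_int)
  also have "\<dots> = sqrt ((cos (2 * ?s) - 1)\<^sup>2 + (sin (2 * ?s))\<^sup>2)"
    by (simp add: cmod_def)
  also have "(cos (2 * ?s) - 1)\<^sup>2 + (sin (2 * ?s))\<^sup>2 = (2 * sin ?s)\<^sup>2"
    using sin_cos_squared_add[of "2 * ?s"] cos_double_sin[of ?s]
    by (simp add: power2_diff algebra_simps)
  finally show ?thesis by (simp only: real_sqrt_abs abs_mult abs_numeral)
qed

text \<open>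
  The denominators of the interpolation formulas are products of this kind.
\<close>

definition binomials :: "(int \<times> int) list \<Rightarrow> laurent" where
  "binomials ps = (\<Prod>(a, b)\<leftarrow>ps. var_pow a - var_pow b)"

lemma binomials_simps [simp]: "binomials [] = 1"
  "binomials ((a, b) # ps) = (var_pow a - var_pow b) * binomials ps"
  "binomials (ps @ qs) = binomials ps * binomials qs"
  by (simp_all add: binomials_def)

lemma finite_zeros_binomial:
  assumes "a \<noteq> b"
  shows "finite {\<theta>\<in>{0..1::real}. cis (2 * pi * \<theta>) powi a = cis (2 * pi * \<theta>) powi b}" (is "finite ?Z")
proof -
  let ?d = "a - b"
  have "?Z \<subseteq> (\<lambda>i. of_int i / of_int ?d) ` {- \<bar>?d\<bar>..\<bar>?d\<bar>}"
  proof
    fix \<theta> assume "\<theta> \<in> ?Z"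
    then have th: "0 \<le> \<theta>" "\<theta> \<le> 1" "sin (of_int ?d * (2 * pi * \<theta>) / 2) = 0"
      using norm_powi_cis_diff[of "2 * pi * \<theta>" a b] by auto
    then obtain i :: int where "of_int ?d * (2 * pi * \<theta>) / 2 = of_int i * pi"
      by (auto simp: sin_zero_iff_int2)
    then have "pi * of_int i = pi * (of_int ?d * \<theta>)" by argo
    then have i: "of_int i = of_int ?d * \<theta>" by simp
    then have "\<bar>of_int i\<bar> \<le> \<bar>of_int ?d :: real\<bar>"
      using th by (simp add: abs_mult mult_left_le)
    then have "\<bar>i\<bar> \<le> \<bar>?d\<bar>" by linarith
    moreover have "\<theta> = of_int i / of_int ?d" using i assms by simp
    ultimately show "\<theta> \<in> (\<lambda>i. of_int i / of_int ?d) ` {- \<bar>?d\<bar>..\<bar>?d\<bar>}"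
      by (intro image_eqI) auto
  qed
  then show ?thesis by (rule finite_subset) simp
qed

lemma integrable_ln_binomial:
  assumes "a \<noteq> b"
  shows "(\<lambda>\<theta>. ln (cmod (cis (2 * pi * \<theta>) powi a - cis (2 * pi * \<theta>) powi b))) integrable_on {0..1}"
proof -
  have "\<bar>sin (of_int (a - b) * (2 * pi * \<theta>) / 2)\<bar> = \<bar>sin (pi * (real (nat \<bar>a - b\<bar>) * \<theta>))\<bar>" for \<theta>
  proof -
    have "of_int (a - b) * (2 * pi * \<theta>) / 2 = pi * (of_int (a - b) * \<theta>)" by simp
    moreover have "real (nat \<bar>a - b\<bar>) = \<bar>of_int (a - b)\<bar>" by simp
    moreover have "\<bar>sin (pi * (\<bar>x\<bar> * \<theta>))\<bar> = \<bar>sin (pi * (x * \<theta>))\<bar>" for x :: real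
      by (cases "0 \<le> x") simp_all
    ultimately show ?thesis by metis
  qed
  then show ?thesis
    using integrable_ln_sin[of "nat \<bar>a - b\<bar>"] assms by (simp add: norm_powi_cis_diff)
qed

text \<open>
  Let \<open>D\<close> be the product of binomials.  Off the finitely many zeros of \<open>D\<close> on the circle,
  \<open>log |f|\<close> is at most \<open>log B - log |D|\<close>, and \<open>log |D|\<close> is integrable.  If \<open>log |f|\<close> were not
  integrable, its integral would have the default value 0 and the Mahler measure would be 1.
\<close>

lemma mahler_measure_bounded:
  assumes "\<forall>(a, b)\<in>set ps. a \<noteq> b"
  shows "\<exists>C. \<forall>f. len (binomials ps * f) \<le> B \<longrightarrow> mahler_measure f \<le> C"
proof -
  let ?z = "\<lambda>\<theta>. cis (2 * pi * \<theta>)"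
  define G where "G \<theta> = (\<Sum>(a, b)\<leftarrow>ps. ln (cmod (?z \<theta> powi a - ?z \<theta> powi b)))" for \<theta>
  define Z where "Z = (\<Union>(a, b)\<in>set ps. {\<theta>\<in>{0..1}. ?z \<theta> powi a = ?z \<theta> powi b})"
  have G: "G integrable_on {0..1}"
    unfolding G_def using assms
    by (induction ps) (auto intro!: integrable_add integrable_ln_binomial split: prod.splits)
  have Z: "finite Z"
    unfolding Z_def using assms finite_zeros_binomial by auto
  have ln_D: "0 < cmod (laurent_eval (binomials ps) (?z \<theta>)) \<and>
      ln (cmod (laurent_eval (binomials ps) (?z \<theta>))) = G \<theta>" if "\<theta> \<in> {0..1} - Z" for \<theta>
  proof -
    have "\<forall>(a, b)\<in>set ps. ?z \<theta> powi a \<noteq> ?z \<theta> powi b" using that by (auto simp: Z_def)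
    then show ?thesis unfolding G_def
      by (induction ps) (auto simp: laurent_eval_mult laurent_eval_diff norm_mult ln_mult)
  qed
  \<comment> \<open>Where \<open>f\<close> vanishes, the logarithm is 0 by convention; that \<open>B'\<close> also bounds \<open>D\<close> covers this case.\<close>
  define B' where "B' = max B (len (binomials ps))"
  have "mahler_measure f \<le> max 1 (exp (ln B' - integral {0..1} G))"
    if f: "len (binomials ps * f) \<le> B" for f
  proof (cases "(\<lambda>\<theta>. ln (cmod (laurent_eval f (?z \<theta>)))) integrable_on {0..1}")
    case False
    then show ?thesis by (simp add: mahler_measure_def not_integrable_integral)
  next
    case True
    let ?h = "\<lambda>\<theta>. if \<theta> \<in> Z then ln (cmod (laurent_eval f (?z \<theta>))) else ln B' - G \<theta>"
    have LG: "(\<lambda>\<theta>. ln B' - G \<theta>) integrable_on {0..1}"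
      using G by (intro integrable_diff) auto
    have "integral {0..1} ?h = integral {0..1} (\<lambda>\<theta>. ln B' - G \<theta>)"
      by (rule integral_spike[of Z]) (use Z in \<open>auto intro: negligible_finite\<close>)
    also have "\<dots> = ln B' - integral {0..1} G"
      using G by (subst integral_diff) auto
    finally have h: "integral {0..1} ?h = ln B' - integral {0..1} G" .
    have "?h integrable_on {0..1}"
      by (rule integrable_spike_finite[OF Z _ LG]) auto
    then have "integral {0..1} (\<lambda>\<theta>. ln (cmod (laurent_eval f (?z \<theta>)))) \<le> integral {0..1} ?h"
    proof (rule integral_le[OF True])
      fix \<theta> :: real assume th: "\<theta> \<in> {0..1}"
      show "ln (cmod (laurent_eval f (?z \<theta>))) \<le> ?h \<theta>"
      proof (cases "\<theta> \<in> Z")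
        case False
        let ?D = "cmod (laurent_eval (binomials ps) (?z \<theta>))" and ?f = "cmod (laurent_eval f (?z \<theta>))"
        have D: "0 < ?D" "ln ?D = G \<theta>" using ln_D[of \<theta>] th False by auto
        have DB: "?D \<le> B'"
          using norm_laurent_eval_le_len[of "?z \<theta>" "binomials ps"] by (simp add: B'_def)
        then have "ln ?D \<le> ln B'" using D(1) less_le_trans[OF D(1) DB] by (subst ln_le_cancel_iff) auto
        have "ln ?f \<le> ln B' - ln ?D"
        proof (cases "?f = 0")
          case True
          then show ?thesis using \<open>ln ?D \<le> ln B'\<close> by simp
        next
          case False
          have "?D * ?f = cmod (laurent_eval (binomials ps * f) (?z \<theta>))"
            by (simp add: laurent_eval_mult norm_mult)
          also have "\<dots> \<le> B'"
            using norm_laurent_eval_le_len[of "?z \<theta>" "binomials ps * f"] f by (simp add: B'_def)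
          finally have "ln (?D * ?f) \<le> ln B'"
            using D(1) False less_le_trans[OF D(1) DB] by (subst ln_le_cancel_iff) auto
          then show ?thesis using D False by (simp add: ln_mult)
        qed
        then show ?thesis using False D by simp
      qed simp
    qed
    then show ?thesis unfolding mahler_measure_def h by (simp add: le_max_iff_disj)
  qed
  then show ?thesis by blast
qed

section \<open>The full twist in a Temperley-Lieb algebra\<close>

text \<open>
  The eigenvalues of the full twist on \<open>l + 1\<close> strands, where \<open>a\<close> and \<open>b\<close> stand for \<open>A\<close> and
  its inverse.  On vectors killed by every cap each of the \<open>l (l + 1)\<close> crossings acts as \<open>a\<close>.  On
  vectors with a cup at the bottom the two joined strands can be pulled out of the twist, which costs
  two curls, each of them a factor \<open>- b\<^sup>3\<close>, and leaves the full twist on two strands fewer.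
  The first numerical argument only bounds the depth of this recursion.
\<close>

primrec twist_roots :: "'a::ring_1 \<Rightarrow> 'a \<Rightarrow> nat \<Rightarrow> nat \<Rightarrow> 'a list" where
  "twist_roots a b 0 l = [1]"
| "twist_roots a b (Suc d) l =
     (if l = 0 then [1] else a ^ (l * Suc l) # map ((*) (b ^ 6)) (twist_roots a b d (l - 2)))"

text \<open>
  The loop value is \<open>- a\<^sup>2 - b\<^sup>2\<close>.  There are infinitely many generators, so that the algebras for all
  numbers of strands, and their shifts along the strands, live in one ring.
\<close>

locale temperley_lieb =
  fixes e :: "nat \<Rightarrow> 'a::ring_1" and a b :: 'a
  assumes ab: "a * b = 1" and ba: "b * a = 1"
    and e_a: "e i * a = a * e i" and e_b: "e i * b = b * e i"
    and e_square: "e i * e i = - (a * a + b * b) * e i"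
    and e_up: "e i * e (Suc i) * e i = e i"
    and e_down: "e (Suc i) * e i * e (Suc i) = e (Suc i)"
    and e_far: "i + 2 \<le> j \<Longrightarrow> e i * e j = e j * e i"
begin

lemma a_b_cancel: "a * (b * x) = x" "b * (a * x) = x"
  by (simp_all add: ab ba flip: mult.assoc)

lemma e_a_left: "e i * (a * x) = a * (e i * x)" and e_b_left: "e i * (b * x) = b * (e i * x)"
  by (simp_all add: e_a e_b flip: mult.assoc)

lemma e_up': "e i * (e (Suc i) * e i) = e i" "e i * (e (Suc i) * (e i * x)) = e i * x"
  using e_up[of i] by (simp_all flip: mult.assoc)

lemma e_down': "e (Suc i) * (e i * e (Suc i)) = e (Suc i)"
    "e (Suc i) * (e i * (e (Suc i) * x)) = e (Suc i) * x"
  using e_down[of i] by (simp_all flip: mult.assoc)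

lemma e_square': "e i * e i = - (a * (a * e i) + b * (b * e i))"
    "e i * (e i * x) = - (a * (a * (e i * x)) + b * (b * (e i * x)))"
proof -
  show *: "e i * e i = - (a * (a * e i) + b * (b * e i))"
    by (simp add: e_square algebra_simps)
  have "e i * (e i * x) = (e i * e i) * x" by (simp add: mult.assoc)
  then show "e i * (e i * x) = - (a * (a * (e i * x)) + b * (b * (e i * x)))"
    unfolding * by (simp add: algebra_simps)
qed

lemmas tl_simps = distrib_left distrib_right left_diff_distrib right_diff_distrib mult.assoc ab ba a_b_cancel e_a e_b e_a_left e_b_left
  e_up' e_down' e_square'

text \<open>
  The Kauffman resolution of a positive crossing, and below of a negative one.
\<close>

definition s :: "nat \<Rightarrow> 'a" where "s i = a + b * e i"

definition t :: "nat \<Rightarrow> 'a" where "t i = b + a * e i"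

lemma s_t: "s i * t i = 1"
  by (simp add: s_def t_def tl_simps)

lemma s_e: "s i * e i = - (b ^ 3 * e i)"
  by (simp add: s_def tl_simps power3_eq_cube)

lemma s_s_e: "s i * (s (Suc i) * e i) = e (Suc i) * e i"
    "s (Suc i) * (s i * e (Suc i)) = e i * e (Suc i)"
  by (simp_all add: s_def tl_simps)

lemma e_s_s: "e (Suc i) * (s i * s (Suc i)) = e (Suc i) * e i"
  by (simp_all add: s_def tl_simps)

text \<open>
  Sliding a cup along a strand turns the crossing with that strand into the opposite crossing on the
  other side of the cup.
\<close>

lemma s_t_e: "s i * (e (Suc i) * e i) = t (Suc i) * e i"
  by (simp_all add: s_def t_def tl_simps)

lemma e_s_far: "i + 2 \<le> j \<or> j + 2 \<le> i \<Longrightarrow> e i * s j = s j * e i"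
proof -
  assume "i + 2 \<le> j \<or> j + 2 \<le> i"
  then have *: "e i * e j = e j * e i" using e_far[of i j] e_far[of j i] by auto
  show ?thesis by (simp add: s_def tl_simps *)
qed

lemma s_t_far: "i + 2 \<le> j \<or> j + 2 \<le> i \<Longrightarrow> s i * t j = t j * s i"
proof -
  assume "i + 2 \<le> j \<or> j + 2 \<le> i"
  then have "e i * e j = e j * e i" using e_far[of i j] e_far[of j i] by auto
  then show ?thesis by (simp add: s_def t_def tl_simps add_ac)
qed

lemma s_far: "i + 2 \<le> j \<or> j + 2 \<le> i \<Longrightarrow> s i * s j = s j * s i"
proof -
  assume "i + 2 \<le> j \<or> j + 2 \<le> i"
  then have "e i * e j = e j * e i" using e_far[of i j] e_far[of j i] by auto
  then show ?thesis by (simp add: s_def tl_simps add_ac)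
qed

lemma s_a: "s i * a = a * s i" and s_b: "s i * b = b * s i"
  by (simp_all add: s_def tl_simps)

definition word :: "nat list \<Rightarrow> 'a" where "word u = prod_list (map s u)"

lemma word_simps [simp]: "word [] = 1" "word (i # u) = s i * word u" "word (u @ v) = word u * word v"
  by (simp_all add: word_def)

lemma word_commutes:
  assumes "\<And>i. i \<in> set u \<Longrightarrow> x * s i = s i * x"
  shows "x * word u = word u * x"
  using assms
proof (induction u)
  case (Cons i u)
  have "x * word (i # u) = (x * s i) * word u" by (simp add: mult.assoc)
  also have "\<dots> = s i * (x * word u)" using Cons.prems[of i] by (simp add: mult.assoc)
  also have "\<dots> = word (i # u) * x" using Cons by (simp add: mult.assoc)
  finally show ?case .
qed simp

lemma word_e_far: "(\<And>j. j \<in> set u \<Longrightarrow> i + 2 \<le> j \<or> j + 2 \<le> i) \<Longrightarrow> e i * word u = word u * e i"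
  by (rule word_commutes) (use e_s_far in blast)

lemma word_invertible: "\<exists>v. word u * v = 1"
proof (induction u)
  case (Cons i u)
  then obtain v where v: "word u * v = 1" by blast
  have "word (i # u) * (v * t i) = s i * ((word u * v) * t i)" by (simp add: mult.assoc)
  also have "\<dots> = 1" by (simp add: v s_t)
  finally show ?case by blast
qed simp

definition twist :: "nat \<Rightarrow> nat \<Rightarrow> 'a" where "twist k l = word [k..<k + l]"

lemma twist_0 [simp]: "twist k 0 = 1"
  by (simp add: twist_def)

text \<open>
  A hook slides through the twist and moves up by one strand.
\<close>

lemma twist_e:
  assumes "k \<le> i" "Suc i < k + l"
  shows "twist k l * e i = e (Suc i) * twist k l"
proof -
  have split: "[k..<k + l] = [k..<i] @ [i, Suc i] @ [Suc (Suc i)..<k + l]"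
    using assms upt_add_eq_append[of k i "k + l - i"] by (simp add: upt_conv_Cons)
  let ?u = "word [k..<i]" and ?v = "word [Suc (Suc i)..<k + l]"
  have v: "?v * e i = e i * ?v" by (rule word_e_far[symmetric]) auto
  have u: "e (Suc i) * ?u = ?u * e (Suc i)" by (rule word_e_far) auto
  have "twist k l * e i = ?u * ((s i * (s (Suc i) * e i)) * ?v)"
    unfolding twist_def split by (simp add: mult.assoc v)
  also have "\<dots> = (?u * e (Suc i)) * (s i * s (Suc i)) * ?v"
    by (simp add: s_s_e mult.assoc flip: e_s_s)
  also have "\<dots> = e (Suc i) * twist k l"
    unfolding twist_def split by (simp add: mult.assoc flip: u)
  finally show ?thesis .
qed

lemma twist_power_e:
  assumes "k \<le> i" "i + j < k + l"
  shows "twist k l ^ j * e i = e (i + j) * twist k l ^ j"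
  using assms(2)
proof (induction j)
  case (Suc j)
  have "twist k l ^ Suc j * e i = twist k l * (twist k l ^ j * e i)" by (simp add: mult.assoc)
  also have "\<dots> = (twist k l * e (i + j)) * twist k l ^ j" using Suc by (simp add: mult.assoc)
  also have "\<dots> = e (i + Suc j) * twist k l ^ Suc j"
    using twist_e[of k "i + j" l] assms(1) Suc.prems by (simp add: mult.assoc)
  finally show ?case .
qed simp

text \<open>
  The first two crossings of the twist carry the lowest cup one position up; the others do not meet it.
\<close>

lemma twist_cup:
  assumes "2 \<le> l"
  shows "twist k l * e k = e (Suc k) * (e k * twist (k + 2) (l - 2))"
proof -
  have k: "k < k + l" "Suc k < k + l" using assms by auto
  have "[k..<k + l] = [k, Suc k] @ [Suc (Suc k)..<k + l]"
    unfolding upt_conv_Cons[OF k(1)] upt_conv_Cons[OF k(2)] by simp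
  moreover obtain q where "l = Suc (Suc q)"
    using assms by (metis add_2_eq_Suc le_Suc_ex)
  ultimately have split: "twist k l = s k * (s (Suc k) * twist (k + 2) (l - 2))"
    by (simp add: twist_def del: upt_Suc)
  have v: "twist (k + 2) (l - 2) * e k = e k * twist (k + 2) (l - 2)"
    unfolding twist_def by (rule word_e_far[symmetric]) auto
  have "twist k l * e k = (s k * (s (Suc k) * e k)) * twist (k + 2) (l - 2)"
    unfolding split by (simp only: mult.assoc v)
  then show ?thesis by (simp only: s_s_e mult.assoc)
qed

text \<open>
  The product \<open>e (k + j) \<dots> e (k + 1) e k\<close>, into which \<open>j\<close> twists turn the hook \<open>e k\<close>.
\<close>

primrec cascade :: "nat \<Rightarrow> nat \<Rightarrow> 'a" where
  "cascade k 0 = e k"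
| "cascade k (Suc j) = e (k + Suc j) * cascade k j"

text \<open>
  Each twist lifts the cup by one position and leaves behind one twist of the strands that are not
  joined by it.
\<close>

lemma twist_power_cup:
  assumes "j < l"
  shows "twist k l ^ j * e k = cascade k j * twist (k + 2) (l - 2) ^ j"
  using assms
proof (induction j)
  case (Suc j)
  let ?B = "twist k l" and ?C = "twist (k + 2) (l - 2)"
  have "?B ^ Suc j * e k = ?B ^ j * (?B * e k)" by (simp add: power_Suc2 mult.assoc del: power_Suc)
  also have "\<dots> = (?B ^ j * e (Suc k)) * (e k * ?C)"
    using twist_cup[of l k] Suc.prems by (simp add: mult.assoc)
  also have "\<dots> = e (Suc k + j) * (?B ^ j * e k) * ?C"
    using twist_power_e[of k "Suc k" j l] Suc.prems by (simp add: mult.assoc)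
  also have "\<dots> = cascade k (Suc j) * ?C ^ Suc j"
    using Suc by (simp add: mult.assoc power_Suc2 del: power_Suc)
  finally show ?case .
qed simp

lemma twist_snoc: "twist k (Suc l) = twist k l * s (k + l)"
  by (simp add: twist_def)

lemma twist_cascade: "twist k (Suc j) * cascade k (Suc j) = t (k + Suc j) * (twist k j * cascade k j)"
proof -
  have c: "cascade k j = e (k + j) * (if j = 0 then 1 else cascade k (j - 1))"
    by (cases j) auto
  have far: "t (k + Suc j) * twist k j = twist k j * t (k + Suc j)"
    unfolding twist_def by (rule word_commutes) (use s_t_far in auto)
  have "twist k (Suc j) * cascade k (Suc j) =
      twist k j * ((s (k + j) * (e (Suc (k + j)) * e (k + j))) * (if j = 0 then 1 else cascade k (j - 1)))"
    by (subst twist_snoc, subst cascade.simps, subst c) (simp add: mult.assoc)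
  also have "\<dots> = twist k j * t (k + Suc j) * cascade k j"
    by (subst c) (simp add: s_t_e mult.assoc)
  also have "\<dots> = t (k + Suc j) * (twist k j * cascade k j)"
    by (simp only: far[symmetric] mult.assoc)
  finally show ?thesis .
qed

text \<open>
  A twist turns the cascade into a product of inverse crossings in front of \<open>e k\<close>, and these cancel
  against the shifted twist.
\<close>

lemma untwist_cascade: "twist (Suc k) j * (twist k j * cascade k j) = e k"
proof (induction j)
  case (Suc j)
  have "twist (Suc k) (Suc j) * (twist k (Suc j) * cascade k (Suc j)) =
     twist (Suc k) j * ((s (k + Suc j) * t (k + Suc j)) * (twist k j * cascade k j))"
    by (subst twist_snoc, subst twist_cascade) (simp add: mult.assoc)
  then show ?case using Suc by (simp add: s_t)
qed simp

lemma b_commutes_word: "b ^ n * word u = word u * b ^ n"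
proof (rule word_commutes)
  show "b ^ n * s i = s i * b ^ n" for i
    using power_commuting_commutes[OF s_b[of i, symmetric]] by simp
qed

lemma b_twist: "b ^ n * twist k l = twist k l * b ^ n"
  by (simp add: twist_def b_commutes_word)

lemma a_commutes_word: "a ^ n * word u = word u * a ^ n"
proof (rule word_commutes)
  show "a ^ n * s i = s i * a ^ n" for i
    using power_commuting_commutes[OF s_a[of i, symmetric]] by simp
qed

text \<open>
  Of the \<open>l + 1\<close> twists in a full twist the last two straighten the cascade again.  Each of them
  contributes one curl, that is a factor \<open>- b\<^sup>3\<close>.
\<close>

lemma twist_twist_cascade: "twist k (Suc j) * (twist k (Suc j) * cascade k j) = b ^ 6 * e k"
proof -
  have c: "cascade k j = e (k + j) * (if j = 0 then 1 else cascade k (j - 1))"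
    by (cases j) auto
  have *: "s (k + j) * cascade k j = - (b ^ 3 * cascade k j)"
    by (subst (1 2) c) (simp add: s_e flip: mult.assoc)
  have "twist k (Suc j) * cascade k j = - (b ^ 3 * (twist k j * cascade k j))"
    unfolding twist_snoc mult.assoc * by (simp add: b_twist flip: mult.assoc)
  moreover have "twist k (Suc j) = s k * twist (Suc k) j"
    using upt_conv_Cons[of k "k + Suc j"] by (simp add: twist_def del: upt_Suc)
  ultimately have "twist k (Suc j) * (twist k (Suc j) * cascade k j) =
      - (s k * (b ^ 3 * (twist (Suc k) j * (twist k j * cascade k j))))"
    by (simp add: b_twist mult.assoc flip: mult.assoc[of "b ^ 3"])
  also have "\<dots> = - (b ^ 3 * (s k * e k))"
    unfolding untwist_cascade using b_commutes_word[of 3 "[k]"] by (simp flip: mult.assoc)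
  also have "\<dots> = b ^ 6 * e k"
    by (simp add: s_e flip: mult.assoc power_add)
  finally show ?thesis .
qed

definition full_twist :: "nat \<Rightarrow> nat \<Rightarrow> 'a" where
  "full_twist k l = twist k l ^ Suc l"

text \<open>
  Two strands joined by a cup can be pulled out of the full twist.
\<close>

lemma full_twist_cup:
  assumes "0 < l"
  shows "full_twist k l * e k = b ^ 6 * (e k * full_twist (k + 2) (l - 2))"
proof -
  obtain j where l: "l = Suc j" using assms by (cases l) auto
  have F': "full_twist (k + 2) (l - 2) = twist (k + 2) (l - 2) ^ j"
    unfolding full_twist_def l by (cases j) (simp_all add: Suc_diff_le)
  have "full_twist k l * e k = twist k l * (twist k l * (twist k l ^ j * e k))"
    by (simp add: full_twist_def l mult.assoc)
  also have "\<dots> = twist k l * (twist k l * cascade k j) * twist (k + 2) (l - 2) ^ j"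
    using twist_power_cup[of j l k] l by (simp add: mult.assoc)
  finally show ?thesis using twist_twist_cascade[of k j] F' l by (simp add: mult.assoc)
qed

lemma full_twist_word: "\<exists>u. full_twist k l = word u \<and> set u \<subseteq> {k..<k + l} \<and> length u = l * Suc l"
proof -
  have "\<exists>u. twist k l ^ n = word u \<and> set u \<subseteq> {k..<k + l} \<and> length u = l * n" for n
  proof (induction n)
    case (Suc n)
    then obtain u where "twist k l ^ n = word u" "set u \<subseteq> {k..<k + l}" "length u = l * n" by blast
    then show ?case by (intro exI[of _ "[k..<k + l] @ u"]) (auto simp: twist_def)
  qed (intro exI[of _ "[]"], auto)
  then show ?thesis unfolding full_twist_def by blast
qed

abbreviation annihilator :: "'a \<Rightarrow> 'a list \<Rightarrow> 'a" where
  "annihilator x cs \<equiv> prod_list (map (\<lambda>c. x - c) cs)"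

definition scalar :: "'a \<Rightarrow> bool" where
  "scalar c \<longleftrightarrow> c * a = a * c \<and> c * b = b * c \<and> (\<forall>i. c * e i = e i * c)"

lemma scalar_a: "scalar a" and scalar_b: "scalar b" and scalar_1: "scalar 1"
  by (simp_all add: scalar_def ab ba e_a e_b)

lemma scalar_mult: "scalar c \<Longrightarrow> scalar d \<Longrightarrow> scalar (c * d)"
  unfolding scalar_def by (metis mult.assoc)

lemma scalar_power: "scalar c \<Longrightarrow> scalar (c ^ n)"
  by (induction n) (simp_all add: scalar_1 scalar_mult)

lemma scalar_roots: "c \<in> set (twist_roots a b d l) \<Longrightarrow> scalar c"
  by (induction d arbitrary: l c)
    (auto simp: scalar_1 split: if_splits intro!: scalar_mult scalar_power scalar_a scalar_b
      simp del: power_Suc mult_Suc_right)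

lemma scalar_word: "scalar c \<Longrightarrow> c * word u = word u * c"
proof (rule word_commutes)
  fix i
  assume c: "scalar c"
  then have "c * (b * e i) = b * e i * c"
    unfolding scalar_def by (metis mult.assoc)
  then show "c * s i = s i * c" using c by (simp add: s_def scalar_def algebra_simps)
qed

lemma annihilator_commutes:
  assumes "x * y = y * x" "\<And>c. c \<in> set cs \<Longrightarrow> c * y = y * c"
  shows "annihilator x cs * y = y * annihilator x cs"
  using assms(2)
proof (induction cs)
  case (Cons c cs)
  have "annihilator x (c # cs) * y = (x - c) * (y * annihilator x cs)"
    using Cons by (simp add: mult.assoc)
  also have "\<dots> = y * annihilator x (c # cs)"
    using Cons.prems[of c] assms(1) by (simp add: left_diff_distrib right_diff_distrib flip: mult.assoc)
  finally show ?case .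
qed simp

text \<open>
  Every factor passes the cup and becomes a factor for the full twist on two strands fewer.
\<close>

lemma annihilator_cup:
  assumes "0 < l" "\<And>c. c \<in> set cs \<Longrightarrow> scalar c"
  shows "annihilator (full_twist k l) (map ((*) (b ^ 6)) cs) * e k =
    b ^ (6 * length cs) * (e k * annihilator (full_twist (k + 2) (l - 2)) cs)"
  using assms(2)
proof (induction cs)
  case (Cons c cs)
  let ?F = "full_twist k l" and ?F' = "full_twist (k + 2) (l - 2)" and ?p = "b ^ (6 * length cs)"
  let ?R = "annihilator ?F' cs"
  have c: "c * e k = e k * c" using Cons.prems[of c] by (simp add: scalar_def)
  have F: "(?F - b ^ 6 * c) * e k = b ^ 6 * (e k * (?F' - c))"
    using full_twist_cup[OF assms(1), of k] c
    by (simp add: left_diff_distrib right_diff_distrib mult.assoc)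
  have sb: "scalar (b ^ n)" for n by (rule scalar_power[OF scalar_b])
  have p: "(?F - b ^ 6 * c) * ?p = ?p * (?F - b ^ 6 * c)"
  proof -
    obtain u where "?F = word u" using full_twist_word by blast
    then have "?F * ?p = ?p * ?F" by (simp add: b_commutes_word)
    moreover have cb: "b * c = c * b" using Cons.prems[of c] by (simp add: scalar_def)
    have "c * ?p = ?p * c"
      using power_commuting_commutes[OF cb, of "6 * length cs"] by simp
    then have "b ^ 6 * c * ?p = ?p * (b ^ 6 * c)"
      by (simp add: mult.assoc) (simp flip: mult.assoc power_add add: add.commute)
    ultimately show ?thesis by (simp add: left_diff_distrib right_diff_distrib)
  qed
  have "annihilator ?F (map ((*) (b ^ 6)) (c # cs)) * e k = ((?F - b ^ 6 * c) * ?p) * (e k * ?R)"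
    using Cons by (simp add: mult.assoc)
  also have "\<dots> = ?p * (((?F - b ^ 6 * c) * e k) * ?R)"
    unfolding p by (simp add: mult.assoc)
  also have "\<dots> = b ^ (6 * length (c # cs)) * (e k * annihilator ?F' (c # cs))"
    unfolding F by (simp add: mult.assoc power_add) (simp flip: mult.assoc power_add add: add.commute)
  finally show ?case .
qed simp

text \<open>
  By induction the product of all factors but the first kills the generator \<open>e k\<close>.  It commutes with
  the twist, and conjugation with the twist runs through all the generators, so it kills every one of
  them.  Multiplied by this product every crossing acts as \<open>a\<close>, and the full twist as \<open>a\<close> to the power
  \<open>l (l + 1)\<close>; this is the root in the first factor.
\<close>

lemma full_twist_annihilated:
  "l < 2 * d \<Longrightarrow> annihilator (full_twist k l) (twist_roots a b d l) = 0"
proof (induction d arbitrary: k l)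
  case (Suc d)
  show ?case
  proof (cases "l = 0")
    case True
    then show ?thesis by (simp add: full_twist_def)
  next
    case False
    define cs where "cs = map ((*) (b ^ 6)) (twist_roots a b d (l - 2))"
    define P where "P = annihilator (full_twist k l) cs"
    obtain u where u: "full_twist k l = word u" "set u \<subseteq> {k..<k + l}" "length u = l * Suc l"
      using full_twist_word by blast
    have cs_scalar: "scalar c" if "c \<in> set cs" for c
      using that scalar_roots by (auto simp: cs_def intro!: scalar_mult scalar_power scalar_b)
    have "annihilator (full_twist (k + 2) (l - 2)) (twist_roots a b d (l - 2)) = 0"
    proof (cases "d = 0")
      case True
      then have "l = 1" using Suc.prems False by simp
      then show ?thesis using True by (simp add: full_twist_def)
    next
      case False
      then show ?thesis using Suc.prems by (intro Suc.IH) auto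
    qed
    then have P_e_k: "P * e k = 0"
      using annihilator_cup[of l "twist_roots a b d (l - 2)" k] False scalar_roots
      by (simp add: P_def cs_def)
    have P_twist: "P * twist k l = twist k l * P"
      unfolding P_def
    proof (rule annihilator_commutes)
      show "full_twist k l * twist k l = twist k l * full_twist k l"
        unfolding full_twist_def by (rule power_commutes)
    qed (use cs_scalar scalar_word in \<open>auto simp: twist_def\<close>)
    have P_e: "P * e (k + j) = 0" if "j < l" for j
      using that
    proof (induction j)
      case (Suc j)
      obtain v where v: "twist k l * v = 1" unfolding twist_def using word_invertible by blast
      have "P * e (k + Suc j) * twist k l = twist k l * (P * e (k + j))"
        using twist_e[of k "k + j" l] Suc.prems P_twist by (metis Suc_less_eq add_Suc_right le_add1
            mult.assoc nat_add_left_cancel_less)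
      then have "P * e (k + Suc j) * (twist k l * v) = 0"
        using Suc by (simp add: mult.assoc[symmetric])
      then show ?case by (simp add: v)
    qed (simp add: P_e_k)
    have scal: "a * P = P * a"
      unfolding P_def
    proof (rule annihilator_commutes[symmetric])
      show "full_twist k l * a = a * full_twist k l" using u(1) scalar_word[OF scalar_a] by simp
      show "c * a = a * c" if "c \<in> set cs" for c using cs_scalar[OF that] by (simp add: scalar_def)
    qed
    have "P * word v = a ^ length v * P" if "set v \<subseteq> {k..<k + l}" for v
      using that
    proof (induction v)
      case (Cons i v)
      have "P * e i = 0" using P_e[of "i - k"] Cons.prems by auto
      then have "P * s i = a * P"
        using scal by (simp add: s_def distrib_left flip: e_b mult.assoc)
      have "P * word (i # v) = (P * s i) * word v" by (simp add: mult.assoc)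
      also have "\<dots> = a * (P * word v)" using \<open>P * s i = a * P\<close> by (simp add: mult.assoc)
      finally show ?case using Cons by (simp add: mult.assoc)
    qed simp
    from this[OF u(2)] have "P * full_twist k l = a ^ (l * Suc l) * P"
      using u by simp
    moreover have "P * full_twist k l = full_twist k l * P"
      unfolding P_def by (rule annihilator_commutes) (use u(1) cs_scalar scalar_word in auto)
    ultimately have "(full_twist k l - a ^ (l * Suc l)) * P = 0"
      by (simp add: left_diff_distrib)
    then show ?thesis using False by (simp add: P_def cs_def)
  qed
qed simp

end

section \<open>The Temperley-Lieb algebra acting on colourings\<close>

text \<open>
  Linear operators on the complex functions of all assignments of colours to positions.  The
  colours are unbounded here, and the number \<open>m\<close> of colours is a parameter of the operators below, so
  that one type carries the representations for all \<open>m\<close>.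
\<close>

typedef lin_op = "{f :: ((nat \<Rightarrow> nat) \<Rightarrow> complex) \<Rightarrow> (nat \<Rightarrow> nat) \<Rightarrow> complex.
    (\<forall>u v. f (\<lambda>x. u x + v x) = (\<lambda>x. f u x + f v x)) \<and>
    (\<forall>c v. f (\<lambda>x. c * v x) = (\<lambda>x. c * f v x))}"
  morphisms app Lin_op
  by (intro exI[of _ "\<lambda>v. v"]) simp

setup_lifting type_definition_lin_op

instantiation lin_op :: ring_1
begin

lift_definition zero_lin_op :: lin_op is "\<lambda>v x. 0" by simp
lift_definition one_lin_op :: lin_op is "\<lambda>v. v" by simp
lift_definition plus_lin_op :: "lin_op \<Rightarrow> lin_op \<Rightarrow> lin_op" is "\<lambda>f g v x. f v x + g v x"
  by (simp add: algebra_simps)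
lift_definition minus_lin_op :: "lin_op \<Rightarrow> lin_op \<Rightarrow> lin_op" is "\<lambda>f g v x. f v x - g v x"
  by (simp add: algebra_simps)
lift_definition uminus_lin_op :: "lin_op \<Rightarrow> lin_op" is "\<lambda>f v x. - f v x"
  by (simp add: algebra_simps)
lift_definition times_lin_op :: "lin_op \<Rightarrow> lin_op \<Rightarrow> lin_op" is "\<lambda>f g v. f (g v)"
  by simp

instance
proof
  fix f g h :: lin_op
  show "(f + g) * h = f * h + g * h" by transfer simp
  show "f * (g + h) = f * g + f * h" by transfer auto
  show "(0::lin_op) \<noteq> 1"
  proof (transfer, rule notI)
    assume "(\<lambda>v x. 0) = (\<lambda>v :: (nat \<Rightarrow> nat) \<Rightarrow> complex. v)"
    from fun_cong[OF fun_cong[OF this, of "\<lambda>_. 1"]] show False by simp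
  qed
qed (transfer, auto simp: algebra_simps)+

end

lemma app_add: "app f (\<lambda>x. u x + v x) = (\<lambda>x. app f u x + app f v x)"
  and app_scale: "app f (\<lambda>x. c * v x) = (\<lambda>x. c * app f v x)"
  using app[of f] by blast+

lemma app_simps [simp]: "app 0 v x = 0" "app 1 v x = v x" "app (f + g) v x = app f v x + app g v x"
  "app (f - g) v x = app f v x - app g v x" "app (- f) v x = - app f v x"
  by (transfer, simp)+

lemma app_mult [simp]: "app (f * g) v = app f (app g v)"
  by transfer simp

lemma lin_op_eqI: "(\<And>v x. app f v x = app g v x) \<Longrightarrow> f = g"
  by (metis app_inject ext)

lemma app_zero: "app f (\<lambda>x. 0) = (\<lambda>x. 0)"
  using app_scale[of f 0 "\<lambda>_. 0"] by simp

lemma app_sum: "app f (\<lambda>x. \<Sum>i\<in>I. u i x) = (\<lambda>x. \<Sum>i\<in>I. app f (u i) x)"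
  by (induction I rule: infinite_finite_induct) (simp_all add: app_zero app_add)

lift_definition scal :: "complex \<Rightarrow> lin_op" is "\<lambda>c v x. c * v x"
  by (simp add: algebra_simps)

lemma app_scal [simp]: "app (scal c) v x = c * v x"
  by transfer simp

lemma scal_commutes: "scal c * f = f * scal c"
proof (rule lin_op_eqI)
  have "app (scal c) v = (\<lambda>x. c * v x)" for v by auto
  then show "app (scal c * f) v x = app (f * scal c) v x" for v x
    by (simp add: app_scale)
qed

lemma scal_simps: "scal 0 = 0" "scal 1 = 1" "scal (c + d) = scal c + scal d"
    "scal (c - d) = scal c - scal d" "scal (c * d) = scal c * scal d" "scal (- c) = - scal c"
  by (rule lin_op_eqI; simp add: algebra_simps)+

lemma scal_power: "scal (c ^ n) = scal c ^ n"
  by (induction n) (simp_all add: scal_simps)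

text \<open>
  The operator replaces two neighbouring colours, if equal, by each pair of equal colours in turn.  All
  colours are first reduced modulo \<open>m\<close>; in this way the Temperley-Lieb relations hold on assignments
  with arbitrary colours.
\<close>

lift_definition cupcap :: "nat \<Rightarrow> nat \<Rightarrow> lin_op" is
  "\<lambda>m i v x. if x i mod m = x (Suc i) mod m
     then (\<Sum>a<m. v ((\<lambda>j. x j mod m)(i := a, Suc i := a))) else 0"
  by (auto simp: sum.distrib sum_distrib_left)

lemma app_cupcap_mod: "app (cupcap m i) v x = app (cupcap m i) v (\<lambda>j. x j mod m)"
  by transfer simp

lemma app_cupcap:
  assumes "\<And>j :: nat. x j < m"
  shows "app (cupcap m i) v x = (if x i = x (Suc i) then \<Sum>a<m. v (x(i := a, Suc i := a)) else 0)"
proof -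
  have "(\<lambda>j. x j mod m) = x" using assms by auto
  with assms show ?thesis by transfer simp
qed

text \<open>
  Only assignments of colours below \<open>m\<close> matter, because the leftmost factor reduces the colours.
\<close>

lemma cupcap_eqI:
  assumes "\<And>v x. (\<And>j :: nat. x j < m) \<Longrightarrow> app (cupcap m i * f) v x = app (cupcap m j * g) v x" "0 < m"
  shows "cupcap m i * f = cupcap m j * g"
proof (rule lin_op_eqI)
  fix v and x :: "nat \<Rightarrow> nat"
  let ?x = "\<lambda>j. x j mod m"
  have "app (cupcap m i * f) v x = app (cupcap m i * f) v ?x"
    using app_cupcap_mod by (metis app_mult)
  also have "\<dots> = app (cupcap m j * g) v ?x" by (rule assms(1)) (use assms(2) in auto)
  also have "\<dots> = app (cupcap m j * g) v x"
    using app_cupcap_mod by (metis app_mult)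
  finally show "app (cupcap m i * f) v x = app (cupcap m j * g) v x" .
qed

lemma cupcap_square:
  assumes "0 < m"
  shows "cupcap m i * cupcap m i = cupcap m i * scal (of_nat m)"
proof (rule cupcap_eqI[OF _ assms])
  fix v :: "(nat \<Rightarrow> nat) \<Rightarrow> complex" and x :: "nat \<Rightarrow> nat" assume x: "\<And>j :: nat. x j < m"
  have "app (cupcap m i) v (x(i := a, Suc i := a)) = (\<Sum>b<m. v (x(i := b, Suc i := b)))"
    if "a < m" for a
    using x that by (subst app_cupcap) (auto simp: fun_upd_twist intro!: sum.cong arg_cong[of _ _ v])
  then show "app (cupcap m i * cupcap m i) v x = app (cupcap m i * scal (of_nat m)) v x"
    by (simp add: app_cupcap[OF x] sum_distrib_left)
qed

lemma cupcap_up: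
  assumes "0 < m"
  shows "cupcap m i * (cupcap m (Suc i) * cupcap m i) = cupcap m i * 1"
proof (rule cupcap_eqI[OF _ assms])
  fix v :: "(nat \<Rightarrow> nat) \<Rightarrow> complex" and x :: "nat \<Rightarrow> nat" assume x: "\<And>j :: nat. x j < m"
  have 1: "app (cupcap m i) v (x(i := a, Suc i := b, Suc (Suc i) := b)) =
      (if a = b then \<Sum>c<m. v (x(i := c, Suc i := c, Suc (Suc i) := b)) else 0)"
    if "a < m" "b < m" for a b
    using x that by (subst app_cupcap) (auto simp: fun_upd_twist intro!: sum.cong arg_cong[of _ _ v])
  have 2: "app (cupcap m (Suc i) * cupcap m i) v (x(i := a, Suc i := a)) =
      (if a = x (Suc (Suc i)) then \<Sum>c<m. v (x(i := c, Suc i := c)) else 0)" if "a < m" for a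
  proof -
    have "app (cupcap m (Suc i) * cupcap m i) v (x(i := a, Suc i := a)) =
      (if a = x (Suc (Suc i)) then
         \<Sum>b<m. app (cupcap m i) v (x(i := a, Suc i := b, Suc (Suc i) := b)) else 0)"
      using x that by (simp add: app_cupcap)
    also have "\<dots> = (if a = x (Suc (Suc i)) then
         \<Sum>b<m. if a = b then \<Sum>c<m. v (x(i := c, Suc i := c, Suc (Suc i) := b)) else 0 else 0)"
      using 1 that by (auto intro!: sum.cong)
    also have "\<dots> = (if a = x (Suc (Suc i)) then
         \<Sum>c<m. v (x(i := c, Suc i := c, Suc (Suc i) := a)) else 0)"
      using that by (simp add: sum.delta)
    also have "\<dots> = (if a = x (Suc (Suc i)) then \<Sum>c<m. v (x(i := c, Suc i := c)) else 0)"
      by (auto intro!: sum.cong arg_cong[of _ _ v])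
    finally show ?thesis .
  qed
  have "app (cupcap m i * (cupcap m (Suc i) * cupcap m i)) v x =
      (if x i = x (Suc i) then
         \<Sum>a<m. app (cupcap m (Suc i) * cupcap m i) v (x(i := a, Suc i := a)) else 0)"
    by (simp add: app_cupcap[OF x])
  also have "\<dots> = (if x i = x (Suc i) then \<Sum>c<m. v (x(i := c, Suc i := c)) else 0)"
    using 2 x[of "Suc (Suc i)"] by (simp add: sum.delta)
  finally show "app (cupcap m i * (cupcap m (Suc i) * cupcap m i)) v x = app (cupcap m i * 1) v x"
    by (simp add: app_cupcap[OF x])
qed

lemma cupcap_down:
  assumes "0 < m"
  shows "cupcap m (Suc i) * (cupcap m i * cupcap m (Suc i)) = cupcap m (Suc i) * 1"
proof (rule cupcap_eqI[OF _ assms])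
  fix v :: "(nat \<Rightarrow> nat) \<Rightarrow> complex" and x :: "nat \<Rightarrow> nat" assume x: "\<And>j :: nat. x j < m"
  let ?i = "Suc i" and ?j = "Suc (Suc i)"
  have 1: "app (cupcap m ?i) v (x(i := b, ?i := b, ?j := a)) =
      (if a = b then \<Sum>c<m. v (x(i := b, ?i := c, ?j := c)) else 0)"
    if "a < m" "b < m" for a b
    using x that by (subst app_cupcap) (auto simp: fun_upd_twist intro!: sum.cong arg_cong[of _ _ v])
  have 2: "app (cupcap m i * cupcap m ?i) v (x(?i := a, ?j := a)) =
      (if a = x i then \<Sum>c<m. v (x(?i := c, ?j := c)) else 0)" if "a < m" for a
  proof -
    have "app (cupcap m i * cupcap m ?i) v (x(?i := a, ?j := a)) =
      (if a = x i then \<Sum>b<m. app (cupcap m ?i) v (x(i := b, ?i := b, ?j := a)) else 0)"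
      using x that by (auto simp: app_cupcap fun_upd_twist intro!: sum.cong arg_cong[of _ _ "app (cupcap m ?i) v"])
    also have "\<dots> = (if a = x i then
         \<Sum>b<m. if a = b then \<Sum>c<m. v (x(i := b, ?i := c, ?j := c)) else 0 else 0)"
      using 1 that by (auto intro!: sum.cong)
    also have "\<dots> = (if a = x i then \<Sum>c<m. v (x(i := a, ?i := c, ?j := c)) else 0)"
      using that by (simp add: sum.delta)
    also have "\<dots> = (if a = x i then \<Sum>c<m. v (x(?i := c, ?j := c)) else 0)"
      by (auto intro!: sum.cong arg_cong[of _ _ v])
    finally show ?thesis .
  qed
  have "app (cupcap m ?i * (cupcap m i * cupcap m ?i)) v x =
      (if x ?i = x ?j then
         \<Sum>a<m. app (cupcap m i * cupcap m ?i) v (x(?i := a, ?j := a)) else 0)"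
    by (simp add: app_cupcap[OF x])
  also have "\<dots> = (if x ?i = x ?j then \<Sum>c<m. v (x(?i := c, ?j := c)) else 0)"
    using 2 x[of i] by (simp add: sum.delta)
  finally show "app (cupcap m ?i * (cupcap m i * cupcap m ?i)) v x = app (cupcap m ?i * 1) v x"
    by (simp add: app_cupcap[OF x])
qed

lemma cupcap_far:
  assumes "0 < m" "i + 2 \<le> j"
  shows "cupcap m i * cupcap m j = cupcap m j * cupcap m i"
proof (rule cupcap_eqI[OF _ assms(1)])
  fix v :: "(nat \<Rightarrow> nat) \<Rightarrow> complex" and x :: "nat \<Rightarrow> nat" assume x: "\<And>j :: nat. x j < m"
  have "x(i := a, Suc i := a, j := b, Suc j := b) = x(j := b, Suc j := b, i := a, Suc i := a)" for a b
    using assms(2) by (auto simp: fun_eq_iff)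
  then have "(\<Sum>a<m. \<Sum>b<m. v (x(i := a, Suc i := a, j := b, Suc j := b))) =
      (\<Sum>b<m. \<Sum>a<m. v (x(j := b, Suc j := b, i := a, Suc i := a)))"
    by (subst sum.swap) simp
  with assms(2) show "app (cupcap m i * cupcap m j) v x = app (cupcap m j * cupcap m i) v x"
    using x by (simp add: app_cupcap sum.neutral)
qed

lemma temperley_lieb_cupcap:
  assumes "0 < m" "A \<noteq> 0" "A ^ 2 + inverse A ^ 2 = - of_nat m"
  shows "temperley_lieb (cupcap m) (scal A) (scal (inverse A))"
proof
  fix i
  show "scal A * scal (inverse A) = 1" "scal (inverse A) * scal A = 1"
    using assms(2) by (simp_all flip: scal_simps)
  show "cupcap m i * scal A = scal A * cupcap m i"
    "cupcap m i * scal (inverse A) = scal (inverse A) * cupcap m i"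
    by (simp_all add: scal_commutes)
  have "of_nat m = - (A * A + inverse A * inverse A)"
    using assms(3) by (simp add: power2_eq_square)
  then have "scal (of_nat m) = - (scal A * scal A + scal (inverse A) * scal (inverse A))"
    by (simp add: scal_simps)
  then show "cupcap m i * cupcap m i =
      - (scal A * scal A + scal (inverse A) * scal (inverse A)) * cupcap m i"
    using cupcap_square[OF assms(1), of i] scal_commutes[of "of_nat m"] by simp
qed (use cupcap_up cupcap_down cupcap_far assms(1) in \<open>simp_all add: mult.assoc\<close>)

section \<open>Traces over colourings\<close>

text \<open>
  Colour 0 outside the \<open>n\<close> positions makes the set finite.
\<close>

definition colourings :: "nat \<Rightarrow> nat \<Rightarrow> (nat \<Rightarrow> nat) set" where
  "colourings m n = {x. \<forall>i. if i \<in> {1..n} then x i < m else x i = 0}"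

lemma finite_colourings [simp]: "finite (colourings m n)"
proof (rule finite_imageD)
  show "finite ((\<lambda>x. restrict x {1..n}) ` colourings m n)"
    by (rule finite_subset[of _ "{1..n} \<rightarrow>\<^sub>E {..<m}"])
      (auto simp: colourings_def restrict_def PiE_iff split: if_splits intro!: finite_PiE)
  show "inj_on (\<lambda>x. restrict x {1..n}) (colourings m n)"
    by (auto simp: inj_on_def colourings_def fun_eq_iff restrict_def) metis
qed

lemma colourings_less: "0 < m \<Longrightarrow> x \<in> colourings m n \<Longrightarrow> x j < m"
  unfolding colourings_def by (cases "j \<in> {1..n}") (metis (mono_tags, lifting) mem_Collect_eq)+

lemma colourings_update:
  "x \<in> colourings m n \<Longrightarrow> a < m \<Longrightarrow> i \<in> {1..n} \<Longrightarrow> x(i := a) \<in> colourings m n"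
  by (auto simp: colourings_def)

definition ent :: "lin_op \<Rightarrow> (nat \<Rightarrow> nat) \<Rightarrow> (nat \<Rightarrow> nat) \<Rightarrow> complex" where
  "ent f x y = app f (\<lambda>z. if z = y then 1 else 0) x"

definition colour_trace :: "nat \<Rightarrow> nat \<Rightarrow> lin_op \<Rightarrow> complex" where
  "colour_trace m n f = (\<Sum>x\<in>colourings m n. ent f x x)"

lemma ent_simps [simp]: "ent 0 x y = 0" "ent 1 x y = (if x = y then 1 else 0)"
  "ent (f + g) x y = ent f x y + ent g x y" "ent (f - g) x y = ent f x y - ent g x y"
  "ent (scal c * f) x y = c * ent f x y"
  by (simp_all add: ent_def)

lemma ent_sum: "ent (\<Sum>i\<in>I. f i) x y = (\<Sum>i\<in>I. ent (f i) x y)"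
  by (induction I rule: infinite_finite_induct) simp_all

lemma colour_trace_simps: "colour_trace m n 0 = 0" "colour_trace m n (f + g) = colour_trace m n f + colour_trace m n g"
  "colour_trace m n (f - g) = colour_trace m n f - colour_trace m n g" "colour_trace m n (scal c * f) = c * colour_trace m n f"
  by (simp_all add: colour_trace_def sum.distrib sum_subtractf sum_distrib_left)

lemma colour_trace_sum: "colour_trace m n (\<Sum>i\<in>I. f i) = (\<Sum>i\<in>I. colour_trace m n (f i))"
  unfolding colour_trace_def ent_sum by (rule sum.swap)

text \<open>
  On the colourings of \<open>n\<close> strands the image depends only on the values of the argument there.  The
  matrix entries of such operators multiply like matrices.
\<close>

definition local_op :: "nat \<Rightarrow> nat \<Rightarrow> lin_op \<Rightarrow> bool" where
  "local_op m n f \<longleftrightarrow> (\<forall>u v. (\<forall>x\<in>colourings m n. u x = v x) \<longrightarrow>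
     (\<forall>x\<in>colourings m n. app f u x = app f v x))"

lemma local_opD:
  "local_op m n f \<Longrightarrow> (\<And>x. x \<in> colourings m n \<Longrightarrow> u x = v x) \<Longrightarrow> x \<in> colourings m n \<Longrightarrow>
    app f u x = app f v x"
  by (simp add: local_op_def)

lemma local_op_simps:
  "local_op m n 1" "local_op m n (scal c)"
  "local_op m n f \<Longrightarrow> local_op m n g \<Longrightarrow> local_op m n (f + g)"
  "local_op m n f \<Longrightarrow> local_op m n g \<Longrightarrow> local_op m n (f * g)"
  unfolding local_op_def by auto metis+

lemma local_op_cupcap:
  assumes "0 < m" "1 \<le> i" "i < n"
  shows "local_op m n (cupcap m i)"
proof (unfold local_op_def, intro allI impI ballI)
  fix u v :: "(nat \<Rightarrow> nat) \<Rightarrow> complex" and x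
  assume "\<forall>x\<in>colourings m n. u x = v x" and x: "x \<in> colourings m n"
  moreover have "x(i := a, Suc i := a) \<in> colourings m n" if "a < m" for a
    using assms x that by (intro colourings_update) auto
  ultimately show "app (cupcap m i) u x = app (cupcap m i) v x"
    by (simp add: app_cupcap[OF colourings_less[OF assms(1) x]])
qed

lemma ent_mult:
  assumes "local_op m n f" "x \<in> colourings m n"
  shows "ent (f * g) x y = (\<Sum>z\<in>colourings m n. ent f x z * ent g z y)"
proof -
  let ?g = "app g (\<lambda>z. if z = y then 1 else 0)"
  have "?g w = (\<Sum>z\<in>colourings m n. ent g z y * (if w = z then 1 else 0))"
    if "w \<in> colourings m n" for w
  proof -
    have "(\<Sum>z\<in>colourings m n. ent g z y * (if w = z then 1 else 0)) =
        (\<Sum>z\<in>colourings m n. if w = z then ent g z y else 0)"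
      by (intro sum.cong) auto
    also have "\<dots> = ent g w y" using that by (simp add: sum.delta')
    finally show ?thesis by (simp add: ent_def)
  qed
  then have "app f ?g x = app f (\<lambda>w. \<Sum>z\<in>colourings m n. ent g z y * (if w = z then 1 else 0)) x"
    by (rule local_opD[OF assms(1) _ assms(2)])
  also have "\<dots> = (\<Sum>z\<in>colourings m n. ent f x z * ent g z y)"
    unfolding app_sum app_scale ent_def by (intro sum.cong refl mult.commute)
  finally show ?thesis by (simp add: ent_def)
qed

lemma colour_trace_cyclic:
  assumes "local_op m n f" "local_op m n g"
  shows "colour_trace m n (f * g) = colour_trace m n (g * f)"
proof -
  have "colour_trace m n (f * g) =
      (\<Sum>x\<in>colourings m n. \<Sum>y\<in>colourings m n. ent f x y * ent g y x)"
    by (simp add: colour_trace_def ent_mult[OF assms(1)])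
  also have "\<dots> = (\<Sum>y\<in>colourings m n. \<Sum>x\<in>colourings m n. ent g y x * ent f x y)"
    by (subst sum.swap) (simp add: mult.commute)
  also have "\<dots> = colour_trace m n (g * f)"
    by (simp add: colour_trace_def ent_mult[OF assms(2)])
  finally show ?thesis .
qed

text \<open>
  The condition for a non-zero matrix entry of a generator.
\<close>

definition compatible :: "nat \<Rightarrow> (nat \<Rightarrow> nat) \<Rightarrow> (nat \<Rightarrow> nat) \<Rightarrow> bool" where
  "compatible i x y \<longleftrightarrow> x i = x (Suc i) \<and> y i = y (Suc i) \<and> (\<forall>j. j \<noteq> i \<longrightarrow> j \<noteq> Suc i \<longrightarrow> x j = y j)"

lemma ent_cupcap:
  assumes "0 < m" "x \<in> colourings m n" "y \<in> colourings m n"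
  shows "ent (cupcap m i) x y = (if compatible i x y then 1 else 0)"
proof -
  have y: "y i < m" using colourings_less assms by blast
  let ?P = "y i = y (Suc i) \<and> (\<forall>j. j \<noteq> i \<longrightarrow> j \<noteq> Suc i \<longrightarrow> x j = y j)"
  have "x(i := a, Suc i := a) = y \<longleftrightarrow> a = y i \<and> ?P" for a
  proof
    assume "x(i := a, Suc i := a) = y"
    from this[symmetric] show "a = y i \<and> ?P" by simp
  next
    assume "a = y i \<and> ?P"
    then show "x(i := a, Suc i := a) = y" by (intro ext) simp
  qed
  then have "(\<Sum>a<m. if x(i := a, Suc i := a) = y then 1 else 0) =
      (\<Sum>a<m. if a = y i then if ?P then 1 else 0 else (0::complex))"
    by (intro sum.cong refl) simp
  also have "\<dots> = (if ?P then 1 else 0)"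
    using y by (simp only: sum.delta finite_lessThan lessThan_iff if_True)
  finally have sum: "(\<Sum>a<m. if x(i := a, Suc i := a) = y then 1 else 0) = (if ?P then 1 else (0::complex))" .
  show ?thesis
    unfolding ent_def app_cupcap[OF colourings_less[OF assms(1,2)]] sum compatible_def
    by (cases "x i = x (Suc i)"; cases ?P) simp_all
qed


section \<open>The bracket as a trace\<close>

text \<open>
  Functions that are constant along the arcs are functions on the classes.
\<close>

lemma card_invariant_functions:
  fixes arcs :: "('v \<times> 'v) set" and B :: "'b set"
  assumes "finite V" "arcs \<subseteq> V \<times> V"
  shows "card {\<phi> \<in> V \<rightarrow>\<^sub>E B. \<forall>(u, v)\<in>arcs. \<phi> u = \<phi> v} =
    card B ^ card (V // (arcs \<union> arcs\<inverse>)\<^sup>*)"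
proof -
  let ?R = "(arcs \<union> arcs\<inverse>)\<^sup>*"
  let ?F = "{\<phi> \<in> V \<rightarrow>\<^sub>E B. \<forall>(u, v)\<in>arcs. \<phi> u = \<phi> v}"
  have "sym ?R" by (intro sym_rtrancl) (simp add: sym_Un_converse)
  then have R: "equiv UNIV ?R" by (auto simp: equiv_def refl_rtrancl intro: trans_rtrancl)
  have inv: "\<phi> u = \<phi> v" if "(u, v) \<in> ?R" "\<phi> \<in> ?F" for \<phi> u v
    using that by (induction rule: rtrancl_induct) auto
  have V: "v \<in> V" if "(u, v) \<in> ?R" "u \<in> V" for u v
    using that assms(2) by (induction rule: rtrancl_induct) auto
  define h where "h \<psi> = (\<lambda>v\<in>V. \<psi> (?R `` {v}))" for \<psi> :: "'v set \<Rightarrow> 'b"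
  have "bij_betw h (V // ?R \<rightarrow>\<^sub>E B) ?F"
  proof (rule bij_betwI')
    fix \<psi> \<psi>' :: "'v set \<Rightarrow> 'b" assume \<psi>: "\<psi> \<in> V // ?R \<rightarrow>\<^sub>E B" "\<psi>' \<in> V // ?R \<rightarrow>\<^sub>E B"
    show "(h \<psi> = h \<psi>') = (\<psi> = \<psi>')"
    proof
      assume *: "h \<psi> = h \<psi>'"
      show "\<psi> = \<psi>'"
      proof (rule PiE_ext[OF \<psi>])
        fix c assume "c \<in> V // ?R"
        then obtain v where v: "c = ?R `` {v}" "v \<in> V" by (auto simp: quotient_def)
        then show "\<psi> c = \<psi>' c" using fun_cong[OF *, of v] by (simp add: h_def)
      qed
    qed simp
  next
    fix \<psi> assume \<psi>: "\<psi> \<in> V // ?R \<rightarrow>\<^sub>E B"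
    have "?R `` {u} = ?R `` {v}" if "(u, v) \<in> arcs" for u v
      using that by (intro equiv_class_eq[OF R]) auto
    with \<psi> assms(2) show "h \<psi> \<in> ?F"
      by (auto simp: h_def PiE_iff quotient_def)
  next
    fix \<phi> assume \<phi>: "\<phi> \<in> ?F"
    define \<psi> where "\<psi> = (\<lambda>c\<in>V // ?R. \<phi> (SOME v. v \<in> c))"
    have some: "\<phi> (SOME u. u \<in> ?R `` {v}) = \<phi> v \<and> (SOME u. u \<in> ?R `` {v}) \<in> V" if "v \<in> V" for v
    proof -
      have "v \<in> ?R `` {v}" by simp
      then have "(SOME u. u \<in> ?R `` {v}) \<in> ?R `` {v}" by (rule someI)
      then have "(v, SOME u. u \<in> ?R `` {v}) \<in> ?R" by blast
      then show ?thesis using inv[OF _ \<phi>] V that by metis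
    qed
    have "\<psi> \<in> V // ?R \<rightarrow>\<^sub>E B"
      using some \<phi> by (auto simp: \<psi>_def PiE_iff quotient_def)
    moreover have "h \<psi> = \<phi>"
      using some \<phi> by (auto simp: h_def \<psi>_def fun_eq_iff PiE_iff extensional_def quotientI)
    ultimately show "\<exists>\<psi>\<in>V // ?R \<rightarrow>\<^sub>E B. \<phi> = h \<psi>" by blast
  qed
  then have "card ?F = card (V // ?R \<rightarrow>\<^sub>E B)"
    by (rule bij_betw_same_card[symmetric])
  moreover have "finite (V // ?R)"
    using assms(1) by (simp add: quotient_def)
  ultimately show ?thesis by (simp add: card_PiE)
qed

lemma sum_Pow_insert:
  assumes "finite A" "a \<notin> A"
  shows "(\<Sum>S\<in>Pow (insert a A). f S) = (\<Sum>S\<in>Pow A. f S + f (insert a S))"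
proof -
  have "inj_on (insert a) (Pow A)" using assms(2) by (auto simp: inj_on_def)
  moreover have "Pow A \<inter> insert a ` Pow A = {}" using assms(2) by auto
  ultimately show ?thesis
    using assms(1) by (simp add: Pow_insert sum.union_disjoint sum.reindex sum.distrib)
qed

definition layer_ok :: "braid_word \<Rightarrow> nat set \<Rightarrow> nat \<Rightarrow> (nat \<Rightarrow> nat) \<Rightarrow> (nat \<Rightarrow> nat) \<Rightarrow> bool" where
  "layer_ok w S k x y \<longleftrightarrow> (if k \<in> S then x = y else compatible (gen_index (w ! k)) x y)"

text \<open>
  A colouring of the smoothed diagram, listed by its horizontal lines, before the closing arcs are
  added; \<open>x\<close> and \<open>y\<close> are its lowest and its highest line.
\<close>

definition histories ::
  "nat \<Rightarrow> nat \<Rightarrow> braid_word \<Rightarrow> nat set \<Rightarrow> (nat \<Rightarrow> nat) \<Rightarrow> (nat \<Rightarrow> nat) \<Rightarrow> (nat \<Rightarrow> nat \<Rightarrow> nat) set" where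
  "histories m n w S x y = {l \<in> {0..length w} \<rightarrow>\<^sub>E colourings m n.
     l 0 = x \<and> l (length w) = y \<and> (\<forall>k<length w. layer_ok w S k (l k) (l (Suc k)))}"

definition state_op :: "nat \<Rightarrow> braid_word \<Rightarrow> nat set \<Rightarrow> lin_op" where
  "state_op m w S = prod_list
     (map (\<lambda>k. if k \<in> S then 1 else cupcap m (gen_index (w ! k))) [0..<length w])"

lemma finite_histories [simp]: "finite (histories m n w S x y)"
proof (rule finite_subset)
  show "histories m n w S x y \<subseteq> {0..length w} \<rightarrow>\<^sub>E colourings m n" by (auto simp: histories_def)
  show "finite ({0..length w} \<rightarrow>\<^sub>E colourings m n)" by (intro finite_PiE) simp_all
qed

lemma histories_ends: "l \<in> histories m n w S x y \<Longrightarrow> l 0 = x \<and> l (length w) = y"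
  by (simp add: histories_def)

lemma state_op_snoc:
  "state_op m (w @ [g]) S = state_op m w S * (if length w \<in> S then 1 else cupcap m (gen_index g))"
proof -
  have *: "map (\<lambda>k. if k \<in> S then 1 else cupcap m (gen_index ((w @ [g]) ! k))) [0..<length w] =
      map (\<lambda>k. if k \<in> S then 1 else cupcap m (gen_index (w ! k))) [0..<length w]"
    by (simp add: nth_append)
  then show ?thesis
    unfolding state_op_def length_append_singleton upt_Suc_append[OF le0] map_append
      prod_list.append * by simp
qed

lemma local_state_op: "0 < m \<Longrightarrow> braid_on n w \<Longrightarrow> local_op m n (state_op m w S)"
proof (induction w rule: rev_induct)
  case (snoc g w)
  then show ?case
    by (auto simp: state_op_snoc braid_on_def intro!: local_op_simps local_op_cupcap)
qed (simp add: state_op_def local_op_simps)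

lemma card_histories_snoc:
  assumes "y \<in> colourings m n"
  shows "card (histories m n (w @ [g]) S x y) =
    (\<Sum>z\<in>colourings m n. if layer_ok (w @ [g]) S (length w) z y then card (histories m n w S x z) else 0)"
proof -
  let ?L = "length w"
  let ?Z = "{z \<in> colourings m n. layer_ok (w @ [g]) S ?L z y}"
  have ok: "layer_ok (w @ [g]) S k = layer_ok w S k" if "k < ?L" for k
    using that by (simp add: layer_ok_def nth_append fun_eq_iff)
  have "bij_betw (\<lambda>l. l(Suc ?L := y)) (\<Union>z\<in>?Z. histories m n w S x z) (histories m n (w @ [g]) S x y)"
  proof (rule bij_betw_byWitness[where f' = "\<lambda>l. restrict l {0..?L}"])
    show "\<forall>l\<in>\<Union>z\<in>?Z. histories m n w S x z. restrict (l(Suc ?L := y)) {0..?L} = l"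
      by (auto simp: histories_def PiE_iff extensional_def fun_eq_iff)
    show "\<forall>l\<in>histories m n (w @ [g]) S x y. (restrict l {0..?L})(Suc ?L := y) = l"
      by (auto simp: histories_def PiE_iff extensional_def fun_eq_iff)
    show "(\<lambda>l. l(Suc ?L := y)) ` (\<Union>z\<in>?Z. histories m n w S x z) \<subseteq> histories m n (w @ [g]) S x y"
      using assms ok by (auto simp: histories_def PiE_iff extensional_def less_Suc_eq)
    show "(\<lambda>l. restrict l {0..?L}) ` histories m n (w @ [g]) S x y \<subseteq> (\<Union>z\<in>?Z. histories m n w S x z)"
    proof
      fix l' assume "l' \<in> (\<lambda>l. restrict l {0..?L}) ` histories m n (w @ [g]) S x y"
      then obtain l where l: "l' = restrict l {0..?L}" "l \<in> histories m n (w @ [g]) S x y" by blast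
      then have "layer_ok w S k (l k) (l (Suc k))" if "k < ?L" for k
      proof -
        have "layer_ok (w @ [g]) S k (l k) (l (Suc k))"
          using l(2) that by (simp add: histories_def)
        then show ?thesis by (simp only: ok[OF that])
      qed
      then have "l' \<in> histories m n w S x (l ?L)" "l ?L \<in> ?Z"
        using l by (auto simp: histories_def PiE_iff)
      then show "l' \<in> (\<Union>z\<in>?Z. histories m n w S x z)" by blast
    qed
  qed
  then have "card (histories m n (w @ [g]) S x y) = card (\<Union>z\<in>?Z. histories m n w S x z)"
    by (rule bij_betw_same_card[symmetric])
  also have "\<dots> = (\<Sum>z\<in>?Z. card (histories m n w S x z))"
    by (rule card_UN_disjoint) (auto dest: histories_ends)
  finally show ?thesis by (simp add: sum.If_cases Int_def)
qed

lemma ent_state_op: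
  assumes "0 < m" "braid_on n w" "x \<in> colourings m n" "y \<in> colourings m n"
  shows "ent (state_op m w S) x y = of_nat (card (histories m n w S x y))"
  using assms(2,4)
proof (induction w arbitrary: y rule: rev_induct)
  case Nil
  have "histories m n [] S x y = (if x = y then {\<lambda>k\<in>{0}. x} else {})"
    using assms(3) by (auto simp: histories_def PiE_iff extensional_def fun_eq_iff)
  then show ?case by (simp add: state_op_def)
next
  case (snoc g w)
  have w: "braid_on n w" "local_op m n (state_op m w S)"
    using snoc.prems(1) assms(1) by (auto simp: braid_on_def intro!: local_state_op)
  have "ent (state_op m (w @ [g]) S) x y = (\<Sum>z\<in>colourings m n. of_nat (card (histories m n w S x z)) *
      ent (if length w \<in> S then 1 else cupcap m (gen_index g)) z y)"
    unfolding state_op_snoc using snoc.IH[OF w(1)] by (simp add: ent_mult[OF w(2) assms(3)])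
  also have "\<dots> = (\<Sum>z\<in>colourings m n. of_nat
      (if layer_ok (w @ [g]) S (length w) z y then card (histories m n w S x z) else 0))"
    using snoc.prems(2) assms(1) by (intro sum.cong) (auto simp: layer_ok_def ent_cupcap)
  finally show ?case by (simp only: card_histories_snoc[OF snoc.prems(2)] of_nat_sum)
qed

definition positive_word :: "braid_word \<Rightarrow> bool" where
  "positive_word w \<longleftrightarrow> (\<forall>g\<in>set w. is_positive_gen g)"

text \<open>
  The two descriptions of a colouring of the smoothed diagram: constant along its arcs, or compatible
  from each line to the next and equal on the two lines joined by the closing arcs.
\<close>

lemma arcs_iff_history:
  assumes "braid_on n w" "positive_word w" "\<And>k. k \<le> length w \<Longrightarrow> l k \<in> colourings m n"
    "\<And>x k. x \<in> {1..n} \<Longrightarrow> k \<le> length w \<Longrightarrow> \<phi> (x, k) = l k x"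
  shows "(\<forall>(u, v)\<in>state_arcs n w S. \<phi> u = \<phi> v) \<longleftrightarrow>
    l (length w) = l 0 \<and> (\<forall>k<length w. layer_ok w S k (l k) (l (Suc k)))"
proof -
  let ?L = "length w"
  let ?i = "\<lambda>k. gen_index (w ! k)"
  have i: "?i k \<in> {1..n}" "Suc (?i k) \<in> {1..n}" if "k < ?L" for k
    using assms(1) that by (auto simp: braid_on_def all_set_conv_all_nth)
  have S: "smoothed_vertically w S k \<longleftrightarrow> k \<in> S" if "k < ?L" for k
    using assms(2) that by (auto simp: smoothed_vertically_def positive_word_def all_set_conv_all_nth)
  have eq: "x = y \<longleftrightarrow> (\<forall>j\<in>{1..n}. x j = y j)" if "x \<in> colourings m n" "y \<in> colourings m n" for x y
    using that by (auto simp: colourings_def fun_eq_iff)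
  have off: "l k j = 0" if "k \<le> ?L" "j \<notin> {1..n}" for k j
    using assms(3)[OF that(1)] that(2) by (auto simp: colourings_def)
  have "(\<forall>(u, v)\<in>state_arcs n w S. \<phi> u = \<phi> v) \<longleftrightarrow> (\<forall>j\<in>{1..n}. \<phi> (j, ?L) = \<phi> (j, 0)) \<and>
      (\<forall>k<?L. (\<forall>j\<in>{1..n}. k \<in> S \<or> j \<notin> {?i k, Suc (?i k)} \<longrightarrow> \<phi> (j, k) = \<phi> (j, Suc k)) \<and>
        (k \<notin> S \<longrightarrow> \<phi> (?i k, k) = \<phi> (Suc (?i k), k) \<and> \<phi> (?i k, Suc k) = \<phi> (Suc (?i k), Suc k)))"
    (is "_ \<longleftrightarrow> ?A \<and> (\<forall>k<?L. ?B k)")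
    unfolding state_arcs_def using S by (simp add: ball_Un Ball_def) blast
  also have "?A \<longleftrightarrow> l ?L = l 0" using assms(3,4) by (subst eq) auto
  also have "(\<forall>k<?L. ?B k) \<longleftrightarrow> (\<forall>k<?L. layer_ok w S k (l k) (l (Suc k)))"
  proof (intro all_cong1 imp_cong refl)
    fix k assume k: "k < ?L"
    have "?B k \<longleftrightarrow> (\<forall>j\<in>{1..n}. k \<in> S \<or> j \<notin> {?i k, Suc (?i k)} \<longrightarrow> l k j = l (Suc k) j) \<and>
        (k \<notin> S \<longrightarrow> l k (?i k) = l k (Suc (?i k)) \<and> l (Suc k) (?i k) = l (Suc k) (Suc (?i k)))"
      using assms(4) i[OF k] k by auto
    also have "\<dots> \<longleftrightarrow> layer_ok w S k (l k) (l (Suc k))"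
    proof (cases "k \<in> S")
      case True
      then show ?thesis using eq[of "l k" "l (Suc k)"] assms(3) k by (auto simp: layer_ok_def)
    next
      case False
      have "(\<forall>j. j \<noteq> ?i k \<longrightarrow> j \<noteq> Suc (?i k) \<longrightarrow> l k j = l (Suc k) j) \<longleftrightarrow>
          (\<forall>j\<in>{1..n}. j \<notin> {?i k, Suc (?i k)} \<longrightarrow> l k j = l (Suc k) j)"
        using off[of k] off[of "Suc k"] k by (metis Suc_leI insert_iff less_imp_le singletonD)
      then show ?thesis using False by (auto simp: layer_ok_def compatible_def)
    qed
    finally show "?B k = layer_ok w S k (l k) (l (Suc k))" .
  qed
  finally show ?thesis .
qed

lemma state_arcs_subset:
  "braid_on n w \<Longrightarrow> state_arcs n w S \<subseteq> state_vertices n w \<times> state_vertices n w"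
  by (auto simp: state_arcs_def state_vertices_def braid_on_def all_set_conv_all_nth Suc_le_eq)

text \<open>
  Both sides count the colourings of the smoothed diagram.
\<close>

lemma colour_trace_state_op:
  assumes "0 < m" "braid_on n w" "positive_word w"
  shows "colour_trace m n (state_op m w S) = of_nat (m ^ state_circles n w S)"
proof -
  let ?L = "length w" and ?V = "state_vertices n w"
  let ?H = "{l \<in> {0..?L} \<rightarrow>\<^sub>E colourings m n.
    l ?L = l 0 \<and> (\<forall>k<?L. layer_ok w S k (l k) (l (Suc k)))}"
  let ?F = "{\<phi> \<in> ?V \<rightarrow>\<^sub>E {..<m}. \<forall>(u, v)\<in>state_arcs n w S. \<phi> u = \<phi> v}"
  define to where "to l = (\<lambda>(x, k)\<in>?V. l k x)" for l :: "nat \<Rightarrow> nat \<Rightarrow> nat"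
  define fro where "fro \<phi> = (\<lambda>k\<in>{0..?L}. \<lambda>x. if x \<in> {1..n} then \<phi> (x, k) else 0)"
    for \<phi> :: "nat \<times> nat \<Rightarrow> nat"
  have "bij_betw to ?H ?F"
  proof (rule bij_betw_byWitness[where f' = fro])
    show "\<forall>l\<in>?H. fro (to l) = l"
      by (auto simp: to_def fro_def fun_eq_iff PiE_iff extensional_def state_vertices_def
          colourings_def restrict_def split: if_splits)
    show "\<forall>\<phi>\<in>?F. to (fro \<phi>) = \<phi>"
      by (auto simp: to_def fro_def fun_eq_iff PiE_iff extensional_def state_vertices_def restrict_def)
    show "to ` ?H \<subseteq> ?F"
    proof
      fix \<phi> assume "\<phi> \<in> to ` ?H"
      then obtain l where l: "\<phi> = to l" "l \<in> ?H" by blast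
      then have lk: "l k \<in> colourings m n" if "k \<le> ?L" for k using that by (auto simp: PiE_iff)
      have "to l (x, k) = l k x" if "x \<in> {1..n}" "k \<le> ?L" for x k
        using that by (simp add: to_def state_vertices_def)
      from arcs_iff_history[OF assms(2,3) lk this] l(2)
      have "\<forall>(u, v)\<in>state_arcs n w S. to l u = to l v" by blast
      moreover have "to l \<in> ?V \<rightarrow>\<^sub>E {..<m}"
      proof -
        have "l k x < m" if "k \<le> ?L" for k x using colourings_less[OF assms(1) lk[OF that]] .
        then show ?thesis by (auto simp: to_def state_vertices_def)
      qed
      ultimately show "\<phi> \<in> ?F" using l by blast
    qed
    show "fro ` ?F \<subseteq> ?H"
    proof
      fix l assume "l \<in> fro ` ?F"
      then obtain \<phi> where \<phi>: "l = fro \<phi>" "\<phi> \<in> ?F" by blast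
      then have lk: "fro \<phi> k \<in> colourings m n" if "k \<le> ?L" for k
        using that by (auto simp: PiE_iff fro_def colourings_def state_vertices_def)
      have "\<phi> (x, k) = fro \<phi> k x" if "x \<in> {1..n}" "k \<le> ?L" for x k
        using that by (simp add: fro_def)
      from arcs_iff_history[OF assms(2,3) lk this] \<phi>(2)
      have "fro \<phi> ?L = fro \<phi> 0 \<and> (\<forall>k<?L. layer_ok w S k (fro \<phi> k) (fro \<phi> (Suc k)))" by blast
      moreover have "fro \<phi> \<in> {0..?L} \<rightarrow>\<^sub>E colourings m n"
        using lk by (auto simp: PiE_iff) (simp add: fro_def)
      ultimately show "l \<in> ?H" using \<phi> by blast
    qed
  qed
  then have "card ?H = card ?F" by (rule bij_betw_same_card)
  also have "\<dots> = m ^ state_circles n w S"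
    using card_invariant_functions[OF _ state_arcs_subset[OF assms(2)], of "{..<m}" S]
    by (simp add: state_circles_def state_vertices_def)
  finally have F: "card ?H = m ^ state_circles n w S" .
  have H: "?H = (\<Union>x\<in>colourings m n. histories m n w S x x)"
    by (auto simp: histories_def PiE_iff)
  have "card ?H = (\<Sum>x\<in>colourings m n. card (histories m n w S x x))"
    unfolding H by (rule card_UN_disjoint) (auto dest: histories_ends)
  then show ?thesis
    unfolding colour_trace_def using F
    by (simp add: ent_state_op[OF assms(1,2)] flip: of_nat_sum)
qed

lemma state_circles_pos:
  assumes "0 < n"
  shows "0 < state_circles n w S"
proof -
  have "(1, 0) \<in> state_vertices n w" using assms by (simp add: state_vertices_def)
  then have "state_vertices n w // (state_arcs n w S \<union> (state_arcs n w S)\<inverse>)\<^sup>* \<noteq> {}"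
    by (auto simp: quotient_def)
  moreover have "finite (state_vertices n w // (state_arcs n w S \<union> (state_arcs n w S)\<inverse>)\<^sup>*)"
    by (simp add: quotient_def state_vertices_def)
  ultimately show ?thesis by (simp add: state_circles_def card_gt_0_iff)
qed

text \<open>
  The values of the variable at which the loop value of the bracket is a number of colours.
\<close>

locale colouring_rep =
  fixes m :: nat and A :: complex
  assumes m_pos: "0 < m" and A_nonzero: "A \<noteq> 0" and loop_value: "A ^ 2 + inverse A ^ 2 = - of_nat m"
begin

sublocale temperley_lieb "cupcap m" "scal A" "scal (inverse A)"
  by (rule temperley_lieb_cupcap[OF m_pos A_nonzero loop_value])

lemma local_op_word: "(\<And>i. i \<in> set u \<Longrightarrow> 1 \<le> i \<and> i < n) \<Longrightarrow> local_op m n (word u)"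
  by (induction u) (auto simp: s_def intro!: local_op_simps local_op_cupcap m_pos)

text \<open>
  Expanding the product of the resolved crossings gives one summand for every Kauffman state.
\<close>

lemma word_state_expansion:
  "word (map gen_index w) =
    (\<Sum>S\<in>Pow {..<length w}. scal (A ^ card S * inverse A ^ card ({..<length w} - S)) * state_op m w S)"
proof (induction w rule: rev_induct)
  case Nil
  show ?case by (simp add: state_op_def scal_simps)
next
  case (snoc g w)
  let ?L = "length w" and ?E = "cupcap m (gen_index g)"
  let ?c = "\<lambda>S. A ^ card S * inverse A ^ card ({..<?L} - S)"
  have op: "state_op m (w @ [g]) (insert ?L S) = state_op m w S"
    "state_op m (w @ [g]) S = state_op m w S * ?E" if "S \<subseteq> {..<?L}" for S
  proof -
    have "state_op m w (insert ?L S) = state_op m w S"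
      unfolding state_op_def by (intro arg_cong[of _ _ prod_list] map_cong) auto
    then show "state_op m (w @ [g]) (insert ?L S) = state_op m w S" by (simp add: state_op_snoc)
    show "state_op m (w @ [g]) S = state_op m w S * ?E" using that by (auto simp: state_op_snoc)
  qed
  have cards: "card (insert ?L S) = Suc (card S)" "{..<Suc ?L} - insert ?L S = {..<?L} - S"
    "card ({..<Suc ?L} - S) = Suc (card ({..<?L} - S))" if "S \<subseteq> {..<?L}" for S
  proof -
    have "finite S" "?L \<notin> S" using that finite_subset by auto
    then show "card (insert ?L S) = Suc (card S)" by simp
    show "{..<Suc ?L} - insert ?L S = {..<?L} - S" using that by auto
    have "{..<Suc ?L} - S = insert ?L ({..<?L} - S)" using \<open>?L \<notin> S\<close> by auto
    then show "card ({..<Suc ?L} - S) = Suc (card ({..<?L} - S))" by simp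
  qed
  have "(\<Sum>S\<in>Pow {..<Suc ?L}. scal (A ^ card S * inverse A ^ card ({..<Suc ?L} - S)) * state_op m (w @ [g]) S)
     = (\<Sum>S\<in>Pow {..<?L}. scal (?c S * inverse A) * (state_op m w S * ?E) + scal (?c S * A) * state_op m w S)"
    unfolding lessThan_Suc[of ?L]
    by (subst sum_Pow_insert) (auto intro!: sum.cong simp: op cards mult_ac simp flip: lessThan_Suc)
  also have "\<dots> = (\<Sum>S\<in>Pow {..<?L}. scal (?c S) * state_op m w S * (scal A + scal (inverse A) * ?E))"
    by (intro sum.cong refl)
      (simp add: scal_simps distrib_left mult.assoc scal_commutes[of A] scal_commutes[of "inverse A"])
  also have "\<dots> = word (map gen_index (w @ [g]))"
    using snoc by (simp add: s_def sum_distrib_right)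
  finally show ?case by simp
qed

theorem colour_trace_eq_bracket:
  assumes "0 < n" "braid_on n w" "positive_word w"
  shows "colour_trace m n (word (map gen_index w)) = of_nat m * laurent_eval (kauffman_bracket n w) A"
proof -
  let ?L = "length w"
  have ev: "laurent_eval (- var_pow 2 - var_pow (- 2)) A = of_nat m"
  proof -
    have "A powi (- 2) = inverse A ^ 2" by (simp add: power_int_def)
    then have "laurent_eval (- var_pow 2 - var_pow (- 2)) A = - (A ^ 2 + inverse A ^ 2)"
      by (simp only: laurent_eval_diff laurent_eval_uminus laurent_eval_single) simp
    then show ?thesis by (simp only: loop_value minus_minus)
  qed
  have "of_nat m * laurent_eval (kauffman_bracket n w) A =
      (\<Sum>S\<in>Pow {..<?L}. A powi (int (card S) - int (card ({..<?L} - S))) *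
        (of_nat m * of_nat m ^ (state_circles n w S - 1)))"
    unfolding kauffman_bracket_def laurent_eval_sum sum_distrib_left
    by (intro sum.cong refl) (simp add: laurent_eval_mult laurent_eval_power A_nonzero ev mult_ac)
  also have "\<dots> = (\<Sum>S\<in>Pow {..<?L}. A ^ card S * inverse A ^ card ({..<?L} - S) *
      colour_trace m n (state_op m w S))"
  proof (intro sum.cong refl arg_cong2[of _ _ _ _ "(*)"])
    fix S
    show "A powi (int (card S) - int (card ({..<?L} - S))) = A ^ card S * inverse A ^ card ({..<?L} - S)"
      using A_nonzero by (simp add: power_int_diff field_simps)
    have "of_nat m * of_nat m ^ (state_circles n w S - 1) = (of_nat m ^ state_circles n w S :: complex)"
      using state_circles_pos[OF assms(1), of w S] by (metis Suc_diff_1 power_Suc)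
    then show "of_nat m * of_nat m ^ (state_circles n w S - 1) = colour_trace m n (state_op m w S)"
      using colour_trace_state_op[OF m_pos assms(2,3)] by simp
  qed
  also have "\<dots> = colour_trace m n (word (map gen_index w))"
    by (simp only: word_state_expansion colour_trace_sum colour_trace_simps)
  finally show ?thesis by simp
qed

end

lemma colouring_rep_exists:
  assumes "0 < m"
  shows "\<exists>A. colouring_rep m A"
proof -
  define y where "y = (- of_nat m + csqrt (of_nat m ^ 2 - 4)) / 2"
  define A where "A = csqrt y"
  have A2: "A ^ 2 = y" by (simp add: A_def)
  have "2 * y + of_nat m = csqrt (of_nat m ^ 2 - 4)" by (simp add: y_def field_simps)
  then have "(2 * y + of_nat m) ^ 2 = of_nat m ^ 2 - 4" by simp
  then have y: "y * y + of_nat m * y + 1 = 0"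
    by (simp add: power2_eq_square algebra_simps) algebra
  then have "y \<noteq> 0" by auto
  then have "y + inverse y = - of_nat m" using y by (simp add: field_simps) algebra
  then have "A ^ 2 + inverse A ^ 2 = - of_nat m" using A2 by (simp add: power_inverse)
  moreover have "A \<noteq> 0" using \<open>y \<noteq> 0\<close> A2 by auto
  ultimately show ?thesis using assms by (intro exI[of _ A]) (unfold_locales, auto)
qed

text \<open>
  The number \<open>m\<close> is determined by \<open>A\<close>, so there are infinitely many such \<open>A\<close>.
\<close>

lemma laurent_eqI:
  assumes "\<And>m A. colouring_rep m A \<Longrightarrow> laurent_eval f A = laurent_eval g A"
  shows "f = g"
proof -
  let ?Z = "{A. \<exists>m. colouring_rep m A}"
  have "(\<lambda>m. - of_nat (Suc m) :: complex) ` UNIV \<subseteq> (\<lambda>A. A ^ 2 + inverse A ^ 2) ` ?Z"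
  proof
    fix c :: complex assume "c \<in> (\<lambda>m. - of_nat (Suc m)) ` UNIV"
    then obtain m where c: "c = - of_nat (Suc m)" by blast
    obtain A where A: "colouring_rep (Suc m) A" using colouring_rep_exists by blast
    have "c = A ^ 2 + inverse A ^ 2" unfolding c by (rule colouring_rep.loop_value[OF A, symmetric])
    then show "c \<in> (\<lambda>A. A ^ 2 + inverse A ^ 2) ` ?Z" using A by blast
  qed
  moreover have "infinite ((\<lambda>m. - of_nat (Suc m) :: complex) ` UNIV)"
    by (subst finite_image_iff) (auto simp: inj_on_def)
  ultimately have "infinite ((\<lambda>A. A ^ 2 + inverse A ^ 2) ` ?Z)" by (rule infinite_super)
  then have "infinite ?Z" by (rule contrapos_nn) (rule finite_imageI)
  then have "f - g = 0"
    by (rule laurent_eq_0I) (use assms colouring_rep.A_nonzero in \<open>auto simp: laurent_eval_diff\<close>)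
  then show ?thesis by simp
qed

section \<open>Destabilisation and reflection of a closed braid\<close>

abbreviation valid_word :: "nat \<Rightarrow> nat list \<Rightarrow> bool" where
  "valid_word n u \<equiv> \<forall>i\<in>set u. 1 \<le> i \<and> i < n"

lemma colourings_inside: "x \<in> colourings m n \<Longrightarrow> 1 \<le> i \<Longrightarrow> i \<le> n \<Longrightarrow> x i < m"
  and colourings_outside: "x \<in> colourings m n \<Longrightarrow> i = 0 \<or> n < i \<Longrightarrow> x i = 0"
proof -
  assume "x \<in> colourings m n"
  then have *: "if i \<in> {1..n} then x i < m else x i = 0" for i
    unfolding colourings_def mem_Collect_eq by (rule spec)
  show "1 \<le> i \<Longrightarrow> i \<le> n \<Longrightarrow> x i < m" using *[of i] by simp
  show "i = 0 \<or> n < i \<Longrightarrow> x i = 0" using *[of i] by auto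
qed

lemma colouringsI:
  "(\<And>i. 1 \<le> i \<Longrightarrow> i \<le> n \<Longrightarrow> x i < m) \<Longrightarrow> (\<And>i. i = 0 \<or> n < i \<Longrightarrow> x i = 0) \<Longrightarrow> x \<in> colourings m n"
  unfolding colourings_def by (auto simp: not_le)

definition add_left :: "nat \<Rightarrow> (nat \<Rightarrow> nat) \<Rightarrow> nat \<Rightarrow> nat" where
  "add_left a x i = (if i = 0 then 0 else if i = 1 then a else x (i - 1))"

lemma add_left_mem: "a < m \<Longrightarrow> x \<in> colourings m n \<Longrightarrow> add_left a x \<in> colourings m (Suc n)"
  by (rule colouringsI) (auto simp: add_left_def colourings_inside colourings_outside)


lemma add_left_eq_iff:
  assumes "x \<in> colourings m n" "y \<in> colourings m n"
  shows "add_left a x = add_left b y \<longleftrightarrow> a = b \<and> x = y"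
proof
  assume eq: "add_left a x = add_left b y"
  have "x i = y i" for i
  proof (cases "i = 0")
    case True
    then show ?thesis using assms by (simp add: colourings_def)
  next
    case False
    then show ?thesis using fun_cong[OF eq, of "Suc i"] by (simp add: add_left_def)
  qed
  then show "a = b \<and> x = y" using fun_cong[OF eq, of 1] by (auto simp: add_left_def)
qed auto

lemma sum_colourings_Suc:
  "(\<Sum>z\<in>colourings m (Suc n). f z) = (\<Sum>a<m. \<Sum>x\<in>colourings m n. f (add_left a x))"
proof -
  have "bij_betw (\<lambda>(a, x). add_left a x) ({..<m} \<times> colourings m n) (colourings m (Suc n))"
  proof (rule bij_betwI')
    fix p q assume "p \<in> {..<m} \<times> colourings m n" "q \<in> {..<m} \<times> colourings m n"
    then show "((case p of (a, x) \<Rightarrow> add_left a x) = (case q of (a, x) \<Rightarrow> add_left a x)) = (p = q)"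
      using add_left_eq_iff by (cases p; cases q) auto
  next
    fix p assume "p \<in> {..<m} \<times> colourings m n"
    then show "(case p of (a, x) \<Rightarrow> add_left a x) \<in> colourings m (Suc n)"
      using add_left_mem by auto
  next
    fix z assume z: "z \<in> colourings m (Suc n)"
    let ?x = "\<lambda>i. if i = 0 then 0 else z (Suc i)"
    have zi: "if i \<in> {1..Suc n} then z i < m else z i = 0" for i
      using z unfolding colourings_def mem_Collect_eq by (rule spec)
    have "z = add_left (z 1) ?x"
      using zi[of 0] by (auto simp: add_left_def)
    moreover have "?x \<in> colourings m n"
      unfolding colourings_def using zi[of "Suc i" for i] by auto
    moreover have "z 1 < m" using zi[of 1] by simp
    ultimately show "\<exists>p\<in>{..<m} \<times> colourings m n. z = (case p of (a, x) \<Rightarrow> add_left a x)"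
      by (intro bexI[of _ "(z 1, ?x)"]) auto
  qed
  then have "(\<Sum>z\<in>colourings m (Suc n). f z) =
      (\<Sum>p\<in>{..<m} \<times> colourings m n. f (case p of (a, x) \<Rightarrow> add_left a x))"
    by (rule sum.reindex_bij_betw[symmetric])
  then show ?thesis by (simp add: sum.cartesian_product case_prod_unfold)
qed

lemma compatible_add_left:
  assumes "1 \<le> i" "x \<in> colourings m n" "y \<in> colourings m n"
  shows "compatible (Suc i) (add_left a x) (add_left b y) \<longleftrightarrow> a = b \<and> compatible i x y"
proof
  assume *: "compatible (Suc i) (add_left a x) (add_left b y)"
  then have "add_left a x 1 = add_left b y 1" using assms(1) by (simp add: compatible_def)
  then have "a = b" by (simp add: add_left_def)
  have "x j = y j" if "j \<noteq> i" "j \<noteq> Suc i" for j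
  proof (cases "j = 0")
    case True
    then show ?thesis using assms by (simp add: colourings_def)
  next
    case False
    have "add_left a x (Suc j) = add_left b y (Suc j)" using * that by (simp add: compatible_def)
    then show ?thesis using False by (simp add: add_left_def)
  qed
  then show "a = b \<and> compatible i x y"
    using * assms(1) \<open>a = b\<close> by (auto simp: compatible_def add_left_def)
next
  assume "a = b \<and> compatible i x y"
  then show "compatible (Suc i) (add_left a x) (add_left b y)"
    using assms(1) by (auto simp: compatible_def add_left_def)
qed

definition mirror :: "nat \<Rightarrow> (nat \<Rightarrow> nat) \<Rightarrow> nat \<Rightarrow> nat" where
  "mirror n x i = (if i \<in> {1..n} then x (Suc n - i) else 0)"

lemma mirror_mem: "x \<in> colourings m n \<Longrightarrow> mirror n x \<in> colourings m n"
  by (rule colouringsI) (auto simp: mirror_def colourings_inside)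

lemma mirror_mirror: "x \<in> colourings m n \<Longrightarrow> mirror n (mirror n x) = x"
  by (rule ext) (auto simp: mirror_def colourings_outside)

lemma bij_mirror: "bij_betw (mirror n) (colourings m n) (colourings m n)"
  by (rule bij_betw_byWitness[where f' = "mirror n"]) (auto simp: mirror_mem mirror_mirror)

lemma mirror_eq_iff:
  "x \<in> colourings m n \<Longrightarrow> y \<in> colourings m n \<Longrightarrow> mirror n x = mirror n y \<longleftrightarrow> x = y"
  by (metis mirror_mirror)

lemma compatible_mirror:
  assumes "1 \<le> i" "i < n" "x \<in> colourings m n" "y \<in> colourings m n" "compatible i x y"
  shows "compatible (n - i) (mirror n x) (mirror n y)"
  unfolding compatible_def
proof (intro conjI allI impI)
  have i: "Suc n - (n - i) = Suc i" "Suc n - Suc (n - i) = i" using assms(1,2) by auto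
  show "mirror n x (n - i) = mirror n x (Suc (n - i))" "mirror n y (n - i) = mirror n y (Suc (n - i))"
    using assms(1,2,5) i by (auto simp: mirror_def compatible_def)
  fix j assume j: "j \<noteq> n - i" "j \<noteq> Suc (n - i)"
  show "mirror n x j = mirror n y j"
  proof (cases "j \<in> {1..n}")
    case True
    then have "Suc n - j \<noteq> i" "Suc n - j \<noteq> Suc i" using j assms(1,2) by auto
    then show ?thesis using assms(5) by (simp add: mirror_def compatible_def)
  qed (auto simp: mirror_def)
qed

context colouring_rep
begin

lemma ent_s:
  assumes "x \<in> colourings m n" "y \<in> colourings m n"
  shows "ent (s i) x y = (if x = y then A else 0) + (if compatible i x y then inverse A else 0)"
proof -
  have "s i = scal A * 1 + scal (inverse A) * cupcap m i" by (simp add: s_def)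
  then show ?thesis by (simp only: ent_simps ent_cupcap[OF m_pos assms]) simp
qed

lemma ent_word_Cons:
  assumes "1 \<le> i" "i < n" "x \<in> colourings m n"
  shows "ent (word (i # u)) x y = (\<Sum>z\<in>colourings m n. ent (s i) x z * ent (word u) z y)"
proof -
  have "local_op m n (word [i])" by (rule local_op_word) (use assms in auto)
  then show ?thesis using ent_mult[OF _ assms(3), of "s i" "word u" y] by simp
qed

text \<open>
  A word that avoids the leftmost strand does not change its colour.
\<close>

lemma ent_shift:
  assumes "valid_word n u" "a < m" "b < m" "x \<in> colourings m n" "y \<in> colourings m n"
  shows "ent (word (map Suc u)) (add_left a x) (add_left b y) = (if a = b then ent (word u) x y else 0)"
  using assms(1,2,4)
proof (induction u arbitrary: a x)
  case Nil
  then show ?case using add_left_eq_iff[OF Nil(3) assms(5)] by simp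
next
  case (Cons i u)
  have i: "1 \<le> i" "i < n" "valid_word n u" using Cons.prems(1) by auto
  have s: "ent (s (Suc i)) (add_left a x) (add_left c z) = (if c = a then ent (s i) x z else 0)"
    if "c < m" "z \<in> colourings m n" for c z
    using that Cons.prems i(1)
    by (auto simp: ent_s[OF add_left_mem add_left_mem] ent_s compatible_add_left add_left_eq_iff)
  have "ent (word (map Suc (i # u))) (add_left a x) (add_left b y) =
      (\<Sum>c<m. \<Sum>z\<in>colourings m n. ent (s (Suc i)) (add_left a x) (add_left c z) *
        ent (word (map Suc u)) (add_left c z) (add_left b y))"
    using ent_word_Cons[of "Suc i" "Suc n" "add_left a x" "map Suc u"] i add_left_mem Cons.prems
    by (simp add: sum_colourings_Suc)
  also have "\<dots> = (\<Sum>c<m. if c = a then \<Sum>z\<in>colourings m n. ent (s i) x z *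
        ent (word (map Suc u)) (add_left c z) (add_left b y) else 0)"
    by (intro sum.cong refl) (auto simp: s)
  also have "\<dots> = (\<Sum>z\<in>colourings m n. ent (s i) x z *
        ent (word (map Suc u)) (add_left a z) (add_left b y))"
    using Cons.prems(2) by (simp only: sum.delta finite_lessThan lessThan_iff if_True)
  also have "\<dots> = (\<Sum>z\<in>colourings m n. ent (s i) x z * (if a = b then ent (word u) z y else 0))"
    using Cons.IH[OF i(3) Cons.prems(2)] by (intro sum.cong refl) simp
  also have "\<dots> = (if a = b then ent (word (i # u)) x y else 0)"
    using ent_word_Cons[OF i(1,2) Cons.prems(3), of u y] by simp
  finally show ?case .
qed

lemma colour_trace_shift:
  assumes "valid_word n u"
  shows "colour_trace m (Suc n) (word (map Suc u)) = of_nat m * colour_trace m n (word u)"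
  by (simp add: colour_trace_def sum_colourings_Suc ent_shift[OF assms])

text \<open>
  The hook forces the colour of the additional strand to be that of its neighbour.
\<close>

lemma colour_trace_hook:
  assumes "valid_word n u" "1 \<le> n"
  shows "colour_trace m (Suc n) (cupcap m 1 * word (map Suc u)) = colour_trace m n (word u)"
proof -
  have loc: "local_op m (Suc n) (cupcap m 1)" by (rule local_op_cupcap[OF m_pos]) (use assms in auto)
  have comp: "compatible 1 (add_left a x) (add_left a z) \<longleftrightarrow> a = x 1 \<and> x = z"
    if "x \<in> colourings m n" "z \<in> colourings m n" for a x z
  proof
    assume *: "compatible 1 (add_left a x) (add_left a z)"
    have "x j = z j" for j
    proof (cases "j \<le> 1")
      case True
      then consider "j = 0" | "j = 1" by linarith
      then show ?thesis using * that by cases (auto simp: compatible_def add_left_def colourings_def)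
    next
      case False
      then have "add_left a x (Suc j) = add_left a z (Suc j)" using * by (simp add: compatible_def)
      then show ?thesis using False by (simp add: add_left_def)
    qed
    then show "a = x 1 \<and> x = z" using * by (auto simp: compatible_def add_left_def)
  next
    assume "a = x 1 \<and> x = z"
    then show "compatible 1 (add_left a x) (add_left a z)"
      by (auto simp: compatible_def add_left_def)
  qed
  have "ent (cupcap m 1 * word (map Suc u)) (add_left a x) (add_left a x) =
      (if a = x 1 then ent (word u) x x else 0)" if "a < m" "x \<in> colourings m n" for a x
  proof -
    have "ent (cupcap m 1 * word (map Suc u)) (add_left a x) (add_left a x) =
      (\<Sum>c<m. \<Sum>z\<in>colourings m n. ent (cupcap m 1) (add_left a x) (add_left c z) *
        ent (word (map Suc u)) (add_left c z) (add_left a x))"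
      using ent_mult[OF loc add_left_mem[OF that]] by (simp only: sum_colourings_Suc)
    also have "\<dots> = (\<Sum>c<m. if c = a then \<Sum>z\<in>colourings m n.
        ent (cupcap m 1) (add_left a x) (add_left a z) * ent (word u) z x else 0)"
      by (intro sum.cong refl) (use that in \<open>auto simp: ent_shift[OF assms(1)] intro!: sum.neutral\<close>)
    also have "\<dots> = (\<Sum>z\<in>colourings m n.
        ent (cupcap m 1) (add_left a x) (add_left a z) * ent (word u) z x)"
      using that(1) by (simp only: sum.delta finite_lessThan lessThan_iff if_True)
    also have "\<dots> = (\<Sum>z\<in>colourings m n. if z = x then if a = x 1 then ent (word u) x x else 0 else 0)"
    proof (intro sum.cong refl)
      fix z assume z: "z \<in> colourings m n"
      show "ent (cupcap m 1) (add_left a x) (add_left a z) * ent (word u) z x =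
          (if z = x then if a = x 1 then ent (word u) x x else 0 else 0)"
        unfolding ent_cupcap[OF m_pos add_left_mem[OF that] add_left_mem[OF that(1) z]] comp[OF that(2) z]
        by auto
    qed
    also have "\<dots> = (if a = x 1 then ent (word u) x x else 0)"
      using that(2) by (simp only: sum.delta finite_colourings if_True)
    finally show ?thesis .
  qed
  then have "colour_trace m (Suc n) (cupcap m 1 * word (map Suc u)) =
      (\<Sum>x\<in>colourings m n. \<Sum>a<m. if a = x 1 then ent (word u) x x else 0)"
    unfolding colour_trace_def sum_colourings_Suc by (subst sum.swap) simp
  also have "\<dots> = colour_trace m n (word u)"
    unfolding colour_trace_def
    using colourings_less[OF m_pos] by (intro sum.cong refl) (simp only: sum.delta finite_lessThan lessThan_iff if_True)
  finally show ?thesis .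
qed

text \<open>
  The two resolutions of the single crossing on the leftmost strand contribute \<open>A m\<close> and the inverse
  of \<open>A\<close>, which add up to \<open>- A\<^sup>3\<close>.
\<close>

lemma colour_trace_destabilise:
  assumes "valid_word n u" "valid_word n v" "1 \<le> n"
  shows "colour_trace m (Suc n) (word (map Suc u @ 1 # map Suc v)) =
    - (A ^ 3) * colour_trace m n (word (u @ v))"
proof -
  have loc: "local_op m (Suc n) (word (map Suc u))" "local_op m (Suc n) (word (1 # map Suc v))"
    "local_op m n (word u)" "local_op m n (word v)"
    by (rule local_op_word; use assms in force)+
  have vu: "valid_word n (v @ u)" using assms by auto
  have coef: "A * of_nat m + inverse A = - (A ^ 3)"
  proof -
    have "of_nat m = - (A ^ 2 + inverse A ^ 2)" using loop_value by simp
    then show ?thesis using A_nonzero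
      by (simp only:) (simp add: field_simps power2_eq_square power3_eq_cube)
  qed
  have "colour_trace m (Suc n) (word (map Suc u @ 1 # map Suc v)) =
      colour_trace m (Suc n) (word (1 # map Suc v) * word (map Suc u))"
    unfolding word_simps(3)[of "map Suc u"] by (rule colour_trace_cyclic[OF loc(1,2)])
  also have "word (1 # map Suc v) * word (map Suc u) = scal A * word (map Suc (v @ u)) +
      scal (inverse A) * (cupcap m 1 * word (map Suc (v @ u)))"
    by (simp add: s_def distrib_right mult.assoc)
  also have "colour_trace m (Suc n) \<dots> = (A * of_nat m + inverse A) * colour_trace m n (word (v @ u))"
    unfolding colour_trace_simps colour_trace_shift[OF vu]
      colour_trace_hook[OF vu assms(3)] by (simp add: algebra_simps)
  also have "colour_trace m n (word (v @ u)) = colour_trace m n (word (u @ v))"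
    unfolding word_simps(3) by (rule colour_trace_cyclic[OF loc(4,3)])
  finally show ?thesis unfolding coef .
qed

text \<open>
  Renumbering the positions from right to left is a symmetry of the matrix entries.
\<close>

lemma ent_mirror_word:
  assumes "valid_word n u" "x \<in> colourings m n" "y \<in> colourings m n"
  shows "ent (word (map (\<lambda>i. n - i) u)) (mirror n x) (mirror n y) = ent (word u) x y"
  using assms(1,2)
proof (induction u arbitrary: x)
  case Nil
  then show ?case using mirror_eq_iff assms(3) by simp
next
  case (Cons i u)
  have i: "1 \<le> i" "i < n" "valid_word n u" "1 \<le> n - i" "n - i < n" "n - (n - i) = i"
    using Cons.prems(1) by auto
  have comp: "compatible (n - i) (mirror n x) (mirror n z) \<longleftrightarrow> compatible i x z"
    if "z \<in> colourings m n" for z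
    using compatible_mirror[OF i(1,2) Cons.prems(2) that]
      compatible_mirror[OF i(4,5) mirror_mem[OF Cons.prems(2)] mirror_mem[OF that]]
      mirror_mirror[OF Cons.prems(2)] mirror_mirror[OF that] i(6) by auto
  have "ent (word (map (\<lambda>i. n - i) (i # u))) (mirror n x) (mirror n y) =
      (\<Sum>z\<in>colourings m n. ent (s (n - i)) (mirror n x) z *
        ent (word (map (\<lambda>i. n - i) u)) z (mirror n y))"
    using ent_word_Cons[OF i(4,5) mirror_mem[OF Cons.prems(2)]] by simp
  also have "\<dots> = (\<Sum>z\<in>colourings m n. ent (s (n - i)) (mirror n x) (mirror n z) *
        ent (word (map (\<lambda>i. n - i) u)) (mirror n z) (mirror n y))"
    by (rule sum.reindex_bij_betw[OF bij_mirror, symmetric])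
  also have "\<dots> = (\<Sum>z\<in>colourings m n. ent (s i) x z * ent (word u) z y)"
  proof (intro sum.cong refl arg_cong2[of _ _ _ _ "(*)"])
    fix z assume z: "z \<in> colourings m n"
    show "ent (s (n - i)) (mirror n x) (mirror n z) = ent (s i) x z"
      unfolding ent_s[OF mirror_mem[OF Cons.prems(2)] mirror_mem[OF z]] ent_s[OF Cons.prems(2) z]
        comp[OF z] mirror_eq_iff[OF Cons.prems(2) z] ..
    show "ent (word (map (\<lambda>i. n - i) u)) (mirror n z) (mirror n y) = ent (word u) z y"
      by (rule Cons.IH[OF i(3) z])
  qed
  also have "\<dots> = ent (word (i # u)) x y"
    by (rule ent_word_Cons[OF i(1,2) Cons.prems(2), symmetric])
  finally show ?case .
qed

lemma colour_trace_mirror_word: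
  assumes "valid_word n u"
  shows "colour_trace m n (word (map (\<lambda>i. n - i) u)) = colour_trace m n (word u)"
proof -
  have "colour_trace m n (word (map (\<lambda>i. n - i) u)) =
      (\<Sum>x\<in>colourings m n. ent (word (map (\<lambda>i. n - i) u)) (mirror n x) (mirror n x))"
    unfolding colour_trace_def by (rule sum.reindex_bij_betw[OF bij_mirror, symmetric])
  then show ?thesis by (simp add: colour_trace_def ent_mirror_word[OF assms])
qed

end

definition bracket :: "nat \<Rightarrow> nat list \<Rightarrow> laurent" where
  "bracket n u = kauffman_bracket n (map Pos u)"

lemma (in colouring_rep) colour_trace_word:
  assumes "0 < n" "valid_word n u"
  shows "colour_trace m n (word u) = of_nat m * laurent_eval (bracket n u) A"
  using colour_trace_eq_bracket[of n "map Pos u"] assms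
  by (simp add: bracket_def braid_on_def positive_word_def comp_def)

lemma bracket_eqI:
  assumes "0 < n" "valid_word n u" "valid_word n v"
    "\<And>m A. colouring_rep m A \<Longrightarrow>
      colour_trace m n (temperley_lieb.word (cupcap m) (scal A) (scal (inverse A)) u) =
      colour_trace m n (temperley_lieb.word (cupcap m) (scal A) (scal (inverse A)) v)"
  shows "bracket n u = bracket n v"
proof (rule laurent_eqI)
  fix m A assume "colouring_rep m A"
  then interpret colouring_rep m A .
  show "laurent_eval (bracket n u) A = laurent_eval (bracket n v) A"
    using assms(4)[OF \<open>colouring_rep m A\<close>] m_pos colour_trace_word[OF assms(1,2)]
      colour_trace_word[OF assms(1,3)] by simp
qed

text \<open>
  Markov destabilisation at the leftmost strand; the factor is the framing change.
\<close>

lemma bracket_destabilise: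
  assumes "valid_word n u" "valid_word n v" "1 \<le> n"
  shows "bracket (Suc n) (map Suc u @ 1 # map Suc v) = - var_pow 3 * bracket n (u @ v)"
proof (rule laurent_eqI)
  fix m A assume "colouring_rep m A"
  then interpret colouring_rep m A .
  have "valid_word (Suc n) (map Suc u @ 1 # map Suc v)" "valid_word n (u @ v)" "0 < Suc n" "0 < n"
    using assms by auto
  then have "of_nat m * laurent_eval (bracket (Suc n) (map Suc u @ 1 # map Suc v)) A =
      of_nat m * (- (A ^ 3) * laurent_eval (bracket n (u @ v)) A)"
    using colour_trace_destabilise[OF assms]
      colour_trace_word[of "Suc n" "map Suc u @ 1 # map Suc v"] colour_trace_word[of n "u @ v"]
    by (simp only: mult.left_commute)
  then have "laurent_eval (bracket (Suc n) (map Suc u @ 1 # map Suc v)) A =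
      - (A ^ 3) * laurent_eval (bracket n (u @ v)) A"
    using m_pos by (subst (asm) mult_left_cancel) auto
  then show "laurent_eval (bracket (Suc n) (map Suc u @ 1 # map Suc v)) A =
      laurent_eval (- var_pow 3 * bracket n (u @ v)) A"
    by (simp add: laurent_eval_mult[OF A_nonzero] laurent_eval_uminus)
qed

lemma bracket_mirror:
  assumes "valid_word n u" "0 < n"
  shows "bracket n (map (\<lambda>i. n - i) u) = bracket n u"
proof (rule bracket_eqI[OF assms(2)])
  fix m A assume "colouring_rep m A"
  then interpret colouring_rep m A .
  show "colour_trace m n (word (map (\<lambda>i. n - i) u)) = colour_trace m n (word u)"
    by (rule colour_trace_mirror_word[OF assms(1)])
qed (use assms in auto)

section \<open>Lorenz braids, their T-braids and their duality\<close>

text \<open>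
  The Lorenz braid on strands \<open>k, k + 1, \<dots>\<close>, sorted into rows: the last overcrossing strand moves first,
  and each of them passes through all its crossings at once.
\<close>

primrec lorenz_word :: "nat \<Rightarrow> nat list \<Rightarrow> nat list" where
  "lorenz_word k [] = []"
| "lorenz_word k (d # ds) = lorenz_word (Suc k) ds @ [k..<k + d]"

definition t_word :: "nat list \<Rightarrow> nat list" where
  "t_word ds = concat (map (\<lambda>d. [1..<d]) ds)"

lemma t_word_simps [simp]: "t_word [] = []" "t_word (d # ds) = [1..<d] @ t_word ds"
  "t_word (xs @ ys) = t_word xs @ t_word ys"
  by (simp_all add: t_word_def)

text \<open>
  The rows of overcrossing strands with arbitrary beginnings \<open>fs\<close> and ends \<open>gs\<close>; such braids
  remain when letters of a Lorenz braid are removed at the bottom.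
\<close>

fun strand_rows :: "nat list \<Rightarrow> nat list \<Rightarrow> nat list" where
  "strand_rows (f # fs) (g # gs) = strand_rows fs gs @ [f..<g]"
| "strand_rows _ _ = []"

lemma strand_rows_lower_bound:
  "(\<And>f. f \<in> set fs \<Longrightarrow> c \<le> f) \<Longrightarrow> i \<in> set (strand_rows fs gs) \<Longrightarrow> c \<le> i"
  by (induction fs gs rule: strand_rows.induct) (auto intro: order_trans)

context temperley_lieb
begin

text \<open>
  The crossing of one strand commutes with the rows of all strands to the right of it, since these
  are at least two positions away, and it extends the row of its own strand.
\<close>

lemma s_strand_rows:
  assumes "sorted_wrt (<) fs" "length gs = length fs" "i \<in> set fs" "Suc i \<notin> set fs"
    "\<And>j. j < length fs \<Longrightarrow> Transposition.transpose i (Suc i) (fs ! j) \<le> gs ! j"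
  shows "s i * word (strand_rows (map (Transposition.transpose i (Suc i)) fs) gs) =
    word (strand_rows fs gs)"
  using assms
proof (induction fs gs rule: strand_rows.induct)
  case (1 f fs g gs)
  let ?\<tau> = "Transposition.transpose i (Suc i)"
  have less: "f < f'" if "f' \<in> set fs" for f' using 1 that by simp
  show ?case
  proof (cases "f = i")
    case True
    have far: "i + 2 \<le> f'" if "f' \<in> set fs" for f'
    proof -
      have "i < f'" "f' \<noteq> Suc i" using less[OF that] 1 that True by auto
      then show ?thesis by simp
    qed
    have "?\<tau> f' = f'" if "f' \<in> set fs" for f'
      using far[OF that] by (intro transpose_apply_other) auto
    then have \<tau>: "map ?\<tau> fs = fs" by (rule map_idI)
    have "s i * word (strand_rows fs gs) = word (strand_rows fs gs) * s i"
    proof (rule word_commutes)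
      fix j assume "j \<in> set (strand_rows fs gs)"
      then have "i + 2 \<le> j" using far strand_rows_lower_bound by blast
      then show "s i * s j = s j * s i" by (intro s_far) simp
    qed
    moreover have "word [i..<g] = s i * word [Suc i..<g]"
      using "1.prems"(5)[of 0] True by (simp add: upt_conv_Cons)
    ultimately have "s i * (word (strand_rows fs gs) * word [Suc i..<g]) =
        word (strand_rows fs gs) * word [i..<g]"
      by (metis mult.assoc)
    then show ?thesis using True \<tau> by simp
  next
    case False
    then have i: "i \<in> set fs" using 1 by auto
    have "f \<noteq> Suc i" using 1 by auto
    then have f: "?\<tau> f = f" using False by (intro transpose_apply_other) auto
    have "?\<tau> (fs ! j) \<le> gs ! j" if "j < length fs" for j
      using "1.prems"(5)[of "Suc j"] that by simp
    then have "s i * word (strand_rows (map ?\<tau> fs) gs) = word (strand_rows fs gs)"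
      using "1.IH" "1.prems" i by simp
    then show ?thesis using f by (simp flip: mult.assoc)
  qed
qed auto

text \<open>
  The strands in \<open>fs\<close> only move to the right, as each crossing takes one of them over a strand that is
  not among them, and they keep their order.  So the first letter can be put at the beginning of the row
  of its strand.
\<close>

lemma word_of_over_strands:
  assumes "braid_on n w" "positive_word w" "sorted_wrt (<) fs"
    "\<And>k x y. k < length w \<Longrightarrow> x \<in> {1..n} \<Longrightarrow> y \<in> {1..n} \<Longrightarrow> crosses_over w k x y \<Longrightarrow>
      x \<in> set fs \<and> y \<notin> set fs"
  shows "word (map gen_index w) = word (strand_rows fs (map (end_pos w) fs)) \<and>
    (\<forall>f\<in>set fs. f \<le> end_pos w f)"
  using assms
proof (induction w arbitrary: fs)
  case Nil
  have "strand_rows fs (map (end_pos []) fs) = []"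
    by (induction fs) auto
  then have "word (strand_rows fs (map (end_pos []) fs)) = 1" by (simp only: word_simps)
  then show ?case by (simp only: list.map word_simps) simp
next
  case (Cons g w)
  then obtain i where g: "g = Pos i" by (cases g) (auto simp: positive_word_def)
  let ?\<tau> = "Transposition.transpose i (Suc i)"
  have i: "i \<in> {1..n}" "Suc i \<in> {1..n}" using Cons.prems(1) g by (auto simp: braid_on_def)
  have "crosses_over (g # w) 0 i (Suc i)" by (simp add: crosses_over_def g)
  then have fs: "i \<in> set fs" "Suc i \<notin> set fs" using Cons.prems(4)[of 0 i "Suc i"] i by simp_all
  have \<tau>_n: "?\<tau> x \<in> {1..n}" if "x \<in> {1..n}" for x
    using that i by (auto simp: Transposition.transpose_def)
  have \<tau>_cases: "?\<tau> f = (if f = i then Suc i else f)" if "f \<in> set fs" for f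
    using that fs by (auto simp: Transposition.transpose_def)
  have sorted: "sorted_wrt (<) (map ?\<tau> fs)"
  proof -
    have "?\<tau> a < ?\<tau> b" if "a \<in> set fs" "b \<in> set fs" "a < b" for a b
      using that fs \<tau>_cases[OF that(1)] \<tau>_cases[OF that(2)] by (cases "b = Suc i") auto
    then show ?thesis
      using Cons.prems(3) by (auto simp: sorted_wrt_map elim!: sorted_wrt_mono_rel[rotated])
  qed
  have hyp: "x \<in> set (map ?\<tau> fs) \<and> y \<notin> set (map ?\<tau> fs)"
    if "k < length w" "x \<in> {1..n}" "y \<in> {1..n}" "crosses_over w k x y" for k x y
  proof -
    have "crosses_over (g # w) (Suc k) (?\<tau> x) (?\<tau> y)"
      using that(4) by (simp add: crosses_over_def g take_Suc_Cons cong: braid_gen.case_cong)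
    then have *: "?\<tau> x \<in> set fs \<and> ?\<tau> y \<notin> set fs"
      using Cons.prems(4)[of "Suc k" "?\<tau> x" "?\<tau> y"] that \<tau>_n by simp
    have "x \<in> ?\<tau> ` set fs" using imageI[of "?\<tau> x" "set fs" ?\<tau>] * by simp
    moreover have "y \<notin> ?\<tau> ` set fs" using * by auto
    ultimately show ?thesis by simp
  qed
  have "word (map gen_index w) = word (strand_rows (map ?\<tau> fs) (map (end_pos w) (map ?\<tau> fs))) \<and>
    (\<forall>f\<in>set (map ?\<tau> fs). f \<le> end_pos w f)"
    by (rule Cons.IH[OF _ _ sorted]) (use Cons.prems hyp in \<open>auto simp: braid_on_def positive_word_def\<close>)
  note P = this
  have ends: "map (end_pos w) (map ?\<tau> fs) = map (end_pos (g # w)) fs" by (simp add: g)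
  have IH: "word (map gen_index w) = word (strand_rows (map ?\<tau> fs) (map (end_pos (g # w)) fs))"
    using P unfolding ends by blast
  have IH_le: "?\<tau> f \<le> end_pos (g # w) f" if "f \<in> set fs" for f
    using P that by (simp add: g)
  have "word (map gen_index (g # w)) = s i * word (strand_rows (map ?\<tau> fs) (map (end_pos (g # w)) fs))"
    using IH g by simp
  also have "\<dots> = word (strand_rows fs (map (end_pos (g # w)) fs))"
    by (rule s_strand_rows[OF Cons.prems(3) _ fs]) (use IH_le in auto)
  finally have "word (map gen_index (g # w)) = word (strand_rows fs (map (end_pos (g # w)) fs))" .
  moreover have "f \<le> end_pos (g # w) f" if "f \<in> set fs" for f
    using IH_le[OF that] \<tau>_cases[OF that] by (auto split: if_splits)
  ultimately show ?case by blast
qed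

lemma strand_rows_lorenz:
  "strand_rows [k..<k + length ds] (map (\<lambda>i. i + ds ! (i - k)) [k..<k + length ds]) = lorenz_word k ds"
proof (induction ds arbitrary: k)
  case (Cons d ds)
  have "map (\<lambda>i. i + (d # ds) ! (i - k)) [Suc k..<Suc k + length ds] =
      map (\<lambda>i. i + ds ! (i - Suc k)) [Suc k..<Suc k + length ds]"
    by (intro map_cong refl) (auto simp: nth_Cons')
  moreover have "[k..<k + length (d # ds)] = k # [Suc k..<Suc k + length ds]"
    by (simp add: upt_conv_Cons del: upt_Suc)
  ultimately show ?case using Cons[of "Suc k"] by (simp only: list.map strand_rows.simps lorenz_word.simps) simp
qed simp

lemma word_lorenz_braid:
  assumes "lorenz_braid ds w"
  shows "word (map gen_index w) = word (lorenz_word 1 ds)"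
proof -
  let ?p = "length ds" and ?n = "lorenz_strands ds"
  note L = assms[unfolded lorenz_braid_def Let_def]
  have "word (map gen_index w) = word (strand_rows [1..<1 + ?p] (map (end_pos w) [1..<1 + ?p]))"
  proof (rule word_of_over_strands[where n = ?n, THEN conjunct1])
    show "braid_on ?n w" "positive_word w" using L by (auto simp: positive_word_def)
    show "sorted_wrt (<) [1..<1 + ?p]" by (rule sorted_wrt_upt)
    fix k x y assume "k < length w" "x \<in> {1..?n}" "y \<in> {1..?n}" "crosses_over w k x y"
    then have "x \<in> {1..?p} \<and> y \<in> {?p + 1..?n}" using L by blast
    then show "x \<in> set [1..<1 + ?p] \<and> y \<notin> set [1..<1 + ?p]" by auto
  qed
  also have "map (end_pos w) [1..<1 + ?p] = map (\<lambda>i. i + ds ! (i - 1)) [1..<1 + ?p]"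
    using L by (intro map_cong refl) auto
  finally show ?thesis by (simp only: strand_rows_lorenz)
qed

text \<open>
  The letters of \<open>x i\<close> commute with all later blocks \<open>c j\<close> and can be collected at the end.
\<close>

lemma word_interleaved:
  assumes "\<And>i j a b. i < j \<Longrightarrow> j < q \<Longrightarrow> a \<in> set (x i) \<Longrightarrow> b \<in> set (c j) \<Longrightarrow> a + 2 \<le> b"
  shows "word (concat (map (\<lambda>j. c j @ x j) [0..<q])) =
    word (concat (map c [0..<q])) * word (concat (map x [0..<q]))"
  using assms
proof (induction q)
  case (Suc q)
  let ?C = "word (concat (map c [0..<q]))" and ?X = "word (concat (map x [0..<q]))"
  have "word (c q) * ?X = ?X * word (c q)"
  proof (rule word_commutes)
    fix a assume "a \<in> set (concat (map x [0..<q]))"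
    then obtain i where "i < q" "a \<in> set (x i)" by auto
    then have "s a * s b = s b * s a" if "b \<in> set (c q)" for b
      using Suc.prems[of i q a b] that by (intro s_far) simp
    then have "s a * word (c q) = word (c q) * s a" by (rule word_commutes)
    then show "word (c q) * s a = s a * word (c q)" by simp
  qed
  note comm = this
  have "word (concat (map (\<lambda>j. c j @ x j) [0..<Suc q])) =
      word (concat (map (\<lambda>j. c j @ x j) [0..<q])) * (word (c q) * word (x q))"
    by simp
  also have "word (concat (map (\<lambda>j. c j @ x j) [0..<q])) = ?C * ?X"
    using Suc by simp
  also have "?C * ?X * (word (c q) * word (x q)) = ?C * (word (c q) * ?X) * word (x q)"
    by (simp only: comm mult.assoc)
  also have "\<dots> = word (concat (map c [0..<Suc q])) * word (concat (map x [0..<Suc q]))"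
    by (simp add: mult.assoc)
  finally show ?case .
qed simp

end

text \<open>
  The letters of the undercrossing strand number \<open>j\<close> (counted from 0), which crosses below every
  overcrossing strand with more than \<open>j\<close> crossings.
\<close>

primrec lorenz_column :: "nat \<Rightarrow> nat list \<Rightarrow> nat \<Rightarrow> nat list" where
  "lorenz_column k [] j = []"
| "lorenz_column k (d # ds) j = lorenz_column (Suc k) ds j @ (if j < d then [k + j] else [])"

lemma lorenz_column_lower_bound: "i \<in> set (lorenz_column k ds j) \<Longrightarrow> k + j \<le> i"
proof (induction ds arbitrary: k)
  case (Cons d ds)
  then show ?case using Cons.IH[of "Suc k"] by (auto split: if_splits)
qed simp

lemma lorenz_last_row:
  "concat (map (\<lambda>j. if j < d then [k + j] else []) [0..<q]) = [k..<k + min d q]"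
proof (induction q)
  case (Suc q)
  then show ?case by (cases "d \<le> q") auto
qed simp

text \<open>
  The row of the first overcrossing strand consists of the last letters of the columns that it meets.
\<close>

lemma (in temperley_lieb) word_lorenz_columns:
  "(\<And>d. d \<in> set ds \<Longrightarrow> d \<le> q) \<Longrightarrow>
    word (concat (map (lorenz_column k ds) [0..<q])) = word (lorenz_word k ds)"
proof (induction ds arbitrary: k)
  case Nil
  have "concat (map (lorenz_column k []) [0..<q]) = []" by simp
  then show ?case by (simp only: lorenz_word.simps)
next
  case (Cons d ds)
  have "word (concat (map (lorenz_column k (d # ds)) [0..<q])) =
    word (concat (map (lorenz_column (Suc k) ds) [0..<q])) *
    word (concat (map (\<lambda>j. if j < d then [k + j] else []) [0..<q]))"
    unfolding lorenz_column.simps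
    by (rule word_interleaved) (auto dest!: lorenz_column_lower_bound split: if_splits)
  also have "\<dots> = word (lorenz_word (Suc k) ds) * word [k..<k + d]"
    using Cons lorenz_last_row[of d k q] by (simp add: min_def)
  finally show ?case by (simp only: lorenz_word.simps word_simps)
qed

abbreviation conjugate_part :: "nat list \<Rightarrow> nat \<Rightarrow> nat" where
  "conjugate_part ds j \<equiv> length (filter (\<lambda>d. j < d) ds)"

text \<open>
  The conjugate partition, in increasing order.
\<close>

definition conjugate :: "nat list \<Rightarrow> nat list" where
  "conjugate ds = rev (map (conjugate_part ds) [0..<last ds])"

lemma lorenz_column_sorted:
  "sorted ds \<Longrightarrow> lorenz_column k ds j =
    rev [k + j + (length ds - conjugate_part ds j)..<k + j + length ds]"
proof (induction ds arbitrary: k)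
  case (Cons d ds)
  show ?case
  proof (cases "j < d")
    case True
    then have "filter (\<lambda>d. j < d) ds = ds" using Cons.prems by (intro filter_True) auto
    then have "lorenz_column k (d # ds) j = rev [Suc k + j..<Suc k + j + length ds] @ [k + j]"
      using Cons True by simp
    also have "\<dots> = rev ((k + j) # [Suc (k + j)..<k + j + Suc (length ds)])" by simp
    also have "\<dots> = rev [k + j..<k + j + Suc (length ds)]" by (subst upt_conv_Cons) auto
    finally show ?thesis using True \<open>filter (\<lambda>d. j < d) ds = ds\<close> by simp
  next
    case False
    have "k + j + (Suc (length ds) - conjugate_part ds j) =
        Suc k + j + (length ds - conjugate_part ds j)"
      using length_filter_le[of "\<lambda>d. j < d" ds] by arith
    moreover have "lorenz_column k (d # ds) j =
        rev [Suc k + j + (length ds - conjugate_part ds j)..<Suc k + j + length ds]"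
      using Cons.IH[of "Suc k"] Cons.prems False by (simp only: lorenz_column.simps sorted_simps if_False append_Nil2)
    moreover have "conjugate_part (d # ds) j = conjugate_part ds j" using False by simp
    ultimately show ?thesis by (simp only: list.size) simp
  qed
qed simp

lemma lorenz_word_rev:
  "lorenz_word k (rev (map c [0..<q])) =
    concat (map (\<lambda>j. [k + (q - 1 - j)..<k + (q - 1 - j) + c j]) [0..<q])"
proof (induction q arbitrary: k)
  case (Suc q)
  have "concat (map (\<lambda>j. [Suc k + (q - 1 - j)..<Suc k + (q - 1 - j) + c j]) [0..<q]) =
      concat (map (\<lambda>j. [k + (q - j)..<k + (q - j) + c j]) [0..<q])"
  proof (intro arg_cong[of _ _ concat] map_cong refl)
    fix j assume "j \<in> set [0..<q]"
    then have "Suc k + (q - 1 - j) = k + (q - j)" by auto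
    then show "[Suc k + (q - 1 - j)..<Suc k + (q - 1 - j) + c j] = [k + (q - j)..<k + (q - j) + c j]"
      by (simp only:)
  qed
  then show ?case using Suc[of "Suc k"] by simp
qed simp

lemma map_reflect_upt:
  assumes "c \<le> p" "p \<le> n"
  shows "map (\<lambda>i. n - i) (rev [p - c..<p]) = [Suc n - p..<Suc n - p + c]"
  by (rule nth_equalityI) (use assms in \<open>auto simp: rev_nth\<close>)

text \<open>
  Seen from behind, the undercrossing strands become the overcrossing ones.
\<close>

lemma mirror_lorenz_columns:
  assumes "sorted ds" "ds \<noteq> []"
  shows "map (\<lambda>i. length ds + last ds - i) (concat (map (lorenz_column 1 ds) [0..<last ds])) =
    lorenz_word 1 (conjugate ds)"
proof -
  let ?p = "length ds" and ?q = "last ds"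
  have "map (\<lambda>i. ?p + ?q - i) (lorenz_column 1 ds j) =
      [1 + (?q - 1 - j)..<1 + (?q - 1 - j) + conjugate_part ds j]" if "j < ?q" for j
  proof -
    have c: "conjugate_part ds j \<le> ?p" by simp
    then have "1 + j + (?p - conjugate_part ds j) = (1 + j + ?p) - conjugate_part ds j" by arith
    then have "map (\<lambda>i. ?p + ?q - i) (lorenz_column 1 ds j) =
        [Suc (?p + ?q) - (1 + j + ?p)..<Suc (?p + ?q) - (1 + j + ?p) + conjugate_part ds j]"
      unfolding lorenz_column_sorted[OF assms(1)]
      by (simp only:) (rule map_reflect_upt, use c that in auto)
    moreover have "Suc (?p + ?q) - (1 + j + ?p) = 1 + (?q - 1 - j)" using that by simp
    ultimately show ?thesis by (simp only:)
  qed
  then show ?thesis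
    unfolding conjugate_def lorenz_word_rev map_concat map_map
    by (intro arg_cong[of _ _ concat] map_cong) auto
qed

lemma lorenz_word_bounds:
  "(\<And>d. d \<in> set ds \<Longrightarrow> d \<le> q) \<Longrightarrow> i \<in> set (lorenz_word k ds) \<Longrightarrow> k \<le> i \<and> i + 1 < k + length ds + q"
proof (induction ds arbitrary: k)
  case (Cons d ds)
  then show ?case
  proof (cases "i \<in> set (lorenz_word (Suc k) ds)")
    case True
    then show ?thesis using Cons.IH[OF _ True] Cons.prems(1) by auto
  next
    case False
    then show ?thesis using Cons.prems by force
  qed
qed simp

lemma last_ge: "sorted ds \<Longrightarrow> d \<in> set ds \<Longrightarrow> d \<le> last ds"
  by (induction ds rule: rev_induct) (auto simp: sorted_append)

lemma bracket_lorenz_conjugate: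
  assumes "sorted ds" "ds \<noteq> []"
  shows "bracket (length ds + last ds) (lorenz_word 1 (conjugate ds)) =
    bracket (length ds + last ds) (lorenz_word 1 ds)"
proof -
  let ?n = "length ds + last ds"
  let ?c = "concat (map (lorenz_column 1 ds) [0..<last ds])"
  have n: "0 < ?n" using assms(2) by simp
  have row: "valid_word ?n (lorenz_word 1 ds)"
    using lorenz_word_bounds[of ds "last ds" _ 1] last_ge[OF assms(1)] by fastforce
  have "valid_word ?n ?c"
  proof
    fix i assume "i \<in> set ?c"
    then obtain j where j: "j < last ds" "i \<in> set (lorenz_column 1 ds j)" by auto
    then show "1 \<le> i \<and> i < ?n" by (auto simp: lorenz_column_sorted[OF assms(1)])
  qed
  then have "bracket ?n (lorenz_word 1 (conjugate ds)) = bracket ?n ?c"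
    using bracket_mirror[where n = ?n and u = ?c] n mirror_lorenz_columns[OF assms] by simp
  also have "\<dots> = bracket ?n (lorenz_word 1 ds)"
  proof (rule bracket_eqI[OF n \<open>valid_word ?n ?c\<close> row])
    fix m A assume "colouring_rep m A"
    then interpret colouring_rep m A .
    show "colour_trace m ?n (word ?c) = colour_trace m ?n (word (lorenz_word 1 ds))"
      using word_lorenz_columns[of ds "last ds" 1] last_ge[OF assms(1)] by simp
  qed
  finally show ?thesis .
qed

lemma map_Suc_lorenz_word: "map Suc (lorenz_word k ds) = lorenz_word (Suc k) ds"
  by (induction ds arbitrary: k) (auto simp: map_Suc_upt)

lemma t_word_bounds: "(\<And>d. d \<in> set ds \<Longrightarrow> d \<le> q) \<Longrightarrow> i \<in> set (t_word ds) \<Longrightarrow> 1 \<le> i \<and> i < q"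
  by (fastforce simp: t_word_def)

lemma (in temperley_lieb) twist_shift:
  "(\<And>i. i \<in> set u \<Longrightarrow> k \<le> i \<and> Suc i < k + l) \<Longrightarrow>
    word ([k..<k + l] @ u) = word (map Suc u @ [k..<k + l])"
proof (induction u)
  case (Cons i u)
  have "twist k l * s i = s (Suc i) * twist k l"
  proof -
    have "twist k l * e i = e (Suc i) * twist k l"
      using twist_e Cons.prems by simp
    moreover have "twist k l * a = a * twist k l" "twist k l * b = b * twist k l"
      using a_commutes_word[of 1] b_commutes_word[of 1] by (simp_all add: twist_def)
    moreover from this have "twist k l * (b * e i) = b * (e (Suc i) * twist k l)"
      by (metis calculation(1) mult.assoc)
    ultimately show ?thesis by (simp add: s_def distrib_left distrib_right mult.assoc)
  qed
  then have "twist k l * s i * word u = s (Suc i) * (twist k l * word u)" by (simp only: mult.assoc)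
  moreover have "twist k l * word u = word (map Suc u) * twist k l"
    using Cons by (simp add: twist_def)
  ultimately show ?case by (simp add: mult.assoc flip: twist_def)
qed simp

text \<open>
  The rows \<open>xs\<close> of the T-braid produced earlier slide through the row of the first overcrossing
  strand, which raises their letters by one; this is possible because \<open>xs\<close> and \<open>ds\<close> together are
  increasing.  Then that row contains the only letter 1, and destabilising there turns it into the next
  row of the T-braid.
\<close>

lemma bracket_lorenz_t_word:
  assumes "sorted (xs @ ds)" "\<forall>d\<in>set (xs @ ds). 1 \<le> d \<and> d \<le> n" "1 \<le> n"
  shows "bracket (n + length ds) (lorenz_word 1 ds @ t_word xs) =
    (- var_pow 3) ^ length ds * bracket n (t_word (xs @ ds))"
  using assms
proof (induction ds arbitrary: xs)
  case (Cons d ds)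
  let ?N = "n + length ds"
  have d: "1 \<le> d" "d \<le> n" using Cons.prems by auto
  have x: "i \<in> set (t_word xs) \<Longrightarrow> 1 \<le> i \<and> i < d" for i
    using t_word_bounds[of xs d i] Cons.prems(1) by (auto simp: sorted_append)
  have L: "i \<in> set (lorenz_word 1 ds) \<Longrightarrow> 1 \<le> i \<and> i < ?N" for i
    using lorenz_word_bounds[of ds n i 1] Cons.prems(2) by auto
  have L': "i \<in> set (lorenz_word 2 ds) \<Longrightarrow> 1 \<le> i \<and> i < Suc ?N" for i
    using lorenz_word_bounds[of ds n i 2] Cons.prems(2) by auto
  have up: "[1..<1 + d] = 1 # map Suc [1..<d]"
    using d(1) by (simp add: map_Suc_upt upt_conv_Cons del: upt_Suc)
  have "bracket (Suc ?N) (lorenz_word 1 (d # ds) @ t_word xs) =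
      bracket (Suc ?N) (map Suc (lorenz_word 1 ds @ t_word xs) @ 1 # map Suc [1..<d])"
  proof (rule bracket_eqI)
    show "valid_word (Suc ?N) (lorenz_word 1 (d # ds) @ t_word xs)"
    proof
      fix i assume "i \<in> set (lorenz_word 1 (d # ds) @ t_word xs)"
      then consider "i \<in> set (lorenz_word 2 ds)" | "1 \<le> i \<and> i < 1 + d" | "i \<in> set (t_word xs)"
        by (auto simp: numeral_2_eq_2)
      then show "1 \<le> i \<and> i < Suc ?N"
      proof cases
        case 1 then show ?thesis by (rule L')
      next
        case 2 then show ?thesis using d by simp
      next
        case 3 then show ?thesis using x[of i] d by simp
      qed
    qed
    show "valid_word (Suc ?N) (map Suc (lorenz_word 1 ds @ t_word xs) @ 1 # map Suc [1..<d])"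
    proof
      fix i assume "i \<in> set (map Suc (lorenz_word 1 ds @ t_word xs) @ 1 # map Suc [1..<d])"
      then consider j where "i = Suc j" "j \<in> set (lorenz_word 1 ds)" | j where "i = Suc j" "j \<in> set (t_word xs)"
        | "i = 1" | "1 \<le> i" "i < Suc d"
        by auto
      then show "1 \<le> i \<and> i < Suc ?N"
      proof cases
        case 1 then show ?thesis using L[of j] by simp
      next
        case 2 then show ?thesis using x[of j] d by simp
      qed (use d in auto)
    qed
    fix m A assume "colouring_rep m A"
    then interpret colouring_rep m A .
    have "word ([1..<1 + d] @ t_word xs) = word (map Suc (t_word xs) @ [1..<1 + d])"
    proof (rule twist_shift)
      show "1 \<le> i \<and> Suc i < 1 + d" if "i \<in> set (t_word xs)" for i using x[OF that] by simp
    qed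
    then have "word (lorenz_word 1 (d # ds) @ t_word xs) =
        word (map Suc (lorenz_word 1 ds @ t_word xs) @ 1 # map Suc [1..<d])"
      unfolding up[symmetric] by (simp add: map_Suc_lorenz_word mult.assoc del: upt_Suc)
    then show "colour_trace m (Suc ?N) (word (lorenz_word 1 (d # ds) @ t_word xs)) =
        colour_trace m (Suc ?N) (word (map Suc (lorenz_word 1 ds @ t_word xs) @ 1 # map Suc [1..<d]))"
      by simp
  qed simp
  also have "\<dots> = - var_pow 3 * bracket ?N ((lorenz_word 1 ds @ t_word xs) @ [1..<d])"
  proof (rule bracket_destabilise)
    show "valid_word ?N (lorenz_word 1 ds @ t_word xs)"
    proof
      fix i assume "i \<in> set (lorenz_word 1 ds @ t_word xs)"
      then show "1 \<le> i \<and> i < ?N" using L[of i] x[of i] d by auto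
    qed
    show "valid_word ?N [1..<d]" "1 \<le> ?N" using d by auto
  qed
  also have "bracket ?N ((lorenz_word 1 ds @ t_word xs) @ [1..<d]) =
      bracket ?N (lorenz_word 1 ds @ t_word (xs @ [d]))" by simp
  also have "\<dots> = (- var_pow 3) ^ length ds * bracket n (t_word ((xs @ [d]) @ ds))"
    using Cons.IH[of "xs @ [d]"] Cons.prems by simp
  finally show ?case by (simp add: mult.assoc)
qed simp

section \<open>Linear recurrences with monomial roots\<close>

lemma var_pow_add: "var_pow j * var_pow k = var_pow (j + k)"
  by (simp add: mult_single)

lemma var_pow_power: "var_pow k ^ q = var_pow (k * int q)"
  by (induction q) (simp_all add: mult_single algebra_simps)

lemma len_binomials_mult: "len (binomials ps * f) \<le> 2 ^ length ps * len f"
proof (induction ps)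
  case (Cons p ps)
  obtain a b where p: "p = (a, b)" by fastforce
  have "binomials (p # ps) * f = var_pow a * (binomials ps * f) - var_pow b * (binomials ps * f)"
    by (simp add: p algebra_simps)
  then have "len (binomials (p # ps) * f) \<le> len (binomials ps * f) + len (binomials ps * f)"
    using len_diff[of "var_pow a * (binomials ps * f)" "var_pow b * (binomials ps * f)"] by simp
  then show ?case using Cons by simp
qed simp

text \<open>
  The product of the operators \<open>S - c\<close> applied to a sequence, where \<open>S\<close> is the shift.
\<close>

primrec shift_prod :: "laurent list \<Rightarrow> (nat \<Rightarrow> laurent) \<Rightarrow> nat \<Rightarrow> laurent" where
  "shift_prod [] h = h"
| "shift_prod (c # cs) h = shift_prod cs (\<lambda>q. h (Suc q) - c * h q)"

lemma shift_prod_mult: "shift_prod cs (\<lambda>q. w * h q) q = w * shift_prod cs h q"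
proof (induction cs arbitrary: h)
  case (Cons c cs)
  have "(\<lambda>q. w * h (Suc q) - c * (w * h q)) = (\<lambda>q. w * (h (Suc q) - c * h q))"
    by (simp add: fun_eq_iff algebra_simps)
  then show ?case using Cons by simp
qed simp

lemma shift_prod_rescale:
  "shift_prod (map ((*) w) cs) (\<lambda>q. w ^ q * h q) q = w ^ (q + length cs) * shift_prod cs h q"
proof (induction cs arbitrary: h)
  case (Cons c cs)
  have "(\<lambda>q. w ^ Suc q * h (Suc q) - w * c * (w ^ q * h q)) =
      (\<lambda>q. w ^ q * (w * (h (Suc q) - c * h q)))"
    by (simp add: fun_eq_iff algebra_simps)
  then have "shift_prod (map ((*) w) (c # cs)) (\<lambda>q. w ^ q * h q) q =
      w ^ (q + length cs) * shift_prod cs (\<lambda>q. w * (h (Suc q) - c * h q)) q"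
    using Cons by simp
  then show ?case
    by (simp only: shift_prod_mult shift_prod.simps length_Cons add_Suc_right power_Suc mult.assoc
        mult.left_commute[of "w ^ (q + length cs)" w])
qed simp

text \<open>
  The sequence \<open>(S - var_pow e) h\<close> satisfies the shorter recurrence.  Given its solution, subtracting
  from \<open>h\<close> the corresponding combination of the other exponentials leaves a multiple of the
  exponential of \<open>e\<close>; the division by the differences of the roots is avoided by multiplying with
  all of them.
\<close>

lemma recurrence_solution:
  assumes "distinct es"
  shows "\<exists>ps C. (\<forall>(a, b)\<in>set ps. a \<in> set es \<and> b \<in> set es \<and> a \<noteq> b) \<and> 0 \<le> C \<and>
    (\<forall>h B. (\<forall>q. shift_prod (map var_pow es) h q = 0) \<and> (\<forall>k<length es. len (h k) \<le> B) \<longrightarrow>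
      (\<exists>\<gamma>. (\<forall>q. binomials ps * h q = (\<Sum>e\<in>set es. var_pow (e * int q) * \<gamma> e)) \<and>
           (\<forall>e\<in>set es. len (\<gamma> e) \<le> C * B)))"
  using assms
proof (induction es)
  case Nil
  show ?case by (intro exI[of _ "[]"] exI[of _ 0]) simp
next
  case (Cons e es)
  from Cons obtain ps C where ps: "\<forall>(a, b)\<in>set ps. a \<in> set es \<and> b \<in> set es \<and> a \<noteq> b"
    and C: "0 \<le> C"
    and sol: "\<And>h B. (\<forall>q. shift_prod (map var_pow es) h q = 0) \<Longrightarrow> (\<forall>k<length es. len (h k) \<le> B) \<Longrightarrow>
      \<exists>\<gamma>. (\<forall>q. binomials ps * h q = (\<Sum>e\<in>set es. var_pow (e * int q) * \<gamma> e)) \<and>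
           (\<forall>e\<in>set es. len (\<gamma> e) \<le> C * B)"
    by auto
  define prs where "prs xs = map (\<lambda>x. (x, e)) xs" for xs :: "int list"
  let ?E = "binomials (prs es)" and ?cof = "\<lambda>x. binomials (prs (remove1 x es))"
  have cof: "(var_pow x - var_pow e) * ?cof x = ?E" if "x \<in> set es" for x
    using that
  proof (induction es)
    case (Cons y es)
    then show ?case by (auto simp: prs_def mult_ac)
  qed simp
  let ?ps = "prs es @ ps"
  \<comment> \<open>Each binomial factor at most doubles the length; the initial values of the shorter recurrence
    are bounded by \<open>2 * B\<close>.\<close>
  let ?K = "2 ^ length es :: real"
  let ?C = "2 ^ length ?ps + real (length es) * (?K * (C * 2)) + ?K * (C * 2)"
  have C': "0 \<le> ?C" using C by simp
  have "\<exists>\<gamma>. (\<forall>q. binomials ?ps * h q = (\<Sum>x\<in>set (e # es). var_pow (x * int q) * \<gamma> x)) \<and>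
           (\<forall>x\<in>set (e # es). len (\<gamma> x) \<le> ?C * B)"
    if rec: "\<forall>q. shift_prod (map var_pow (e # es)) h q = 0" and B: "\<forall>k<length (e # es). len (h k) \<le> B"
    for h B
  proof -
    have B0: "len (h 0) \<le> B" using B by simp
    then have "0 \<le> B" using len_nonneg order_trans by blast
    let ?h = "\<lambda>q. h (Suc q) - var_pow e * h q"
    have "len (?h k) \<le> 2 * B" if "k < length es" for k
      using len_diff[of "h (Suc k)" "var_pow e * h k"] B that
      by (simp, metis (no_types, lifting) Suc_mono add_mono less_SucI mult_2 order_trans)
    then obtain \<gamma>' where \<gamma>': "\<And>q. binomials ps * ?h q = (\<Sum>x\<in>set es. var_pow (x * int q) * \<gamma>' x)"
      "\<And>x. x \<in> set es \<Longrightarrow> len (\<gamma>' x) \<le> C * (2 * B)"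
      using sol[of ?h "2 * B"] rec by auto
    \<comment> \<open>The part of the solution that belongs to the root \<open>var_pow e\<close>.\<close>
    define y where "y q = binomials ?ps * h q - (\<Sum>x\<in>set es. var_pow (x * int q) * (?cof x * \<gamma>' x))" for q
    have y_Suc: "y (Suc q) = var_pow e * y q" for q
    proof -
      have "?E * (binomials ps * ?h q) =
          (\<Sum>x\<in>set es. (var_pow x - var_pow e) * (var_pow (x * int q) * (?cof x * \<gamma>' x)))"
        unfolding \<gamma>'(1) sum_distrib_left
      proof (intro sum.cong refl)
        fix x assume "x \<in> set es"
        show "?E * (var_pow (x * int q) * \<gamma>' x) =
            (var_pow x - var_pow e) * (var_pow (x * int q) * (?cof x * \<gamma>' x))"
          unfolding cof[OF \<open>x \<in> set es\<close>, symmetric] by (simp only: mult_ac)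
      qed
      also have "\<dots> = (\<Sum>x\<in>set es. var_pow (x * int (Suc q)) * (?cof x * \<gamma>' x)) -
          var_pow e * (\<Sum>x\<in>set es. var_pow (x * int q) * (?cof x * \<gamma>' x))"
      proof -
        have "var_pow (x * int (Suc q)) = var_pow x * var_pow (x * int q)" for x
          by (simp add: mult_single algebra_simps)
        then show ?thesis
          by (simp only: sum_distrib_left sum_subtractf[symmetric] left_diff_distrib mult.assoc)
      qed
      finally show ?thesis by (simp add: y_def algebra_simps)
    qed
    have y: "y q = var_pow (e * int q) * y 0" for q
    proof (induction q)
      case (Suc q)
      have "y (Suc q) = (var_pow e * var_pow (e * int q)) * y 0"
        by (simp only: y_Suc Suc mult.assoc)
      then show ?case by (simp add: var_pow_add distrib_left)
    qed simp
    define \<gamma> where "\<gamma> x = (if x = e then y 0 else ?cof x * \<gamma>' x)" for x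
    have e: "e \<notin> set es" using Cons.prems by simp
    have "binomials ?ps * h q = (\<Sum>x\<in>set (e # es). var_pow (x * int q) * \<gamma> x)" for q
    proof -
      have "(\<Sum>x\<in>set es. var_pow (x * int q) * \<gamma> x) = (\<Sum>x\<in>set es. var_pow (x * int q) * (?cof x * \<gamma>' x))"
        using e by (intro sum.cong) (auto simp: \<gamma>_def)
      moreover have "var_pow (e * int q) * \<gamma> e = y q" by (simp add: \<gamma>_def flip: y)
      ultimately show ?thesis using e by (simp add: y_def)
    qed
    moreover have cof_len: "len (?cof x * \<gamma>' x) \<le> ?K * (C * 2) * B" if "x \<in> set es" for x
    proof -
      have "len (?cof x * \<gamma>' x) \<le> 2 ^ length (prs (remove1 x es)) * len (\<gamma>' x)"
        by (rule len_binomials_mult)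
      also have "\<dots> \<le> ?K * (C * (2 * B))"
        using \<gamma>'(2)[OF that] C \<open>0 \<le> B\<close>
        by (intro mult_mono power_increasing) (auto simp: prs_def length_remove1)
      finally show ?thesis by (simp add: mult_ac)
    qed
    have "len (\<gamma> x) \<le> ?C * B" if "x \<in> set (e # es)" for x
    proof (cases "x = e")
      case True
      have "len (y 0) \<le> len (binomials ?ps * h 0) + len (\<Sum>x\<in>set es. var_pow (x * int 0) * (?cof x * \<gamma>' x))"
        unfolding y_def by (rule len_diff)
      moreover have "len (binomials ?ps * h 0) \<le> 2 ^ length ?ps * B"
        by (rule order_trans[OF len_binomials_mult mult_left_mono[OF B0]]) simp
      moreover have "len (\<Sum>x\<in>set es. var_pow (x * int 0) * (?cof x * \<gamma>' x)) \<le>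
          (\<Sum>x\<in>set es. ?K * (C * 2) * B)"
        by (rule order_trans[OF len_sum sum_mono]) (use cof_len in simp)
      moreover have "(\<Sum>x\<in>set es. ?K * (C * 2) * B) = real (length es) * (?K * (C * 2)) * B"
        using Cons.prems by (simp add: distinct_card)
      ultimately have "len (y 0) \<le> 2 ^ length ?ps * B + real (length es) * (?K * (C * 2)) * B"
        by linarith
      also have "\<dots> \<le> ?C * B" using C \<open>0 \<le> B\<close> by (simp add: distrib_right)
      finally show ?thesis using True by (simp add: \<gamma>_def)
    next
      case False
      then have "len (\<gamma> x) \<le> ?K * (C * 2) * B" using cof_len[of x] that by (simp add: \<gamma>_def)
      also have "\<dots> \<le> ?C * B" using C \<open>0 \<le> B\<close> by (intro mult_right_mono) auto
      finally show ?thesis .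
    qed
    ultimately show ?thesis by blast
  qed
  moreover have "\<forall>(a, b)\<in>set ?ps. a \<in> set (e # es) \<and> b \<in> set (e # es) \<and> a \<noteq> b"
    using ps Cons.prems by (auto simp: prs_def)
  ultimately show ?case using C' by blast
qed

section \<open>Sets of Laurent polynomials bounded after multiplication\<close>

definition quadruple :: "(int \<times> int) list \<Rightarrow> (int \<times> int) list" where
  "quadruple = map (\<lambda>(a, b). (4 * a, 4 * b))"

lemma quadruple_append [simp]: "quadruple (ps @ qs) = quadruple ps @ quadruple qs"
  by (simp add: quadruple_def)

text \<open>
  One denominator and one bound for the whole set.  The exponents in the denominator are multiples of 4
  in order that it survives the substitution that turns the bracket into the Jones polynomial.
\<close>

definition tame :: "laurent set \<Rightarrow> bool" where
  "tame H \<longleftrightarrow> (\<exists>ps B. (\<forall>(a, b)\<in>set ps. a \<noteq> b) \<and> (\<forall>f\<in>H. len (binomials (quadruple ps) * f) \<le> B))"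

lemma tame_subset: "tame H \<Longrightarrow> G \<subseteq> H \<Longrightarrow> tame G"
  unfolding tame_def by blast

lemma tame_singleton: "tame {f}"
  unfolding tame_def by (intro exI[of _ "[]"] exI[of _ "len f"]) (simp add: quadruple_def)

text \<open>
  The denominators are multiplied, and the superfluous factors at most double the length.
\<close>

lemma tame_Un:
  assumes "tame G" "tame H"
  shows "tame (G \<union> H)"
proof -
  obtain ps B where ps: "\<forall>(a, b)\<in>set ps. a \<noteq> b" "\<And>f. f \<in> G \<Longrightarrow> len (binomials (quadruple ps) * f) \<le> B"
    using assms(1) unfolding tame_def by blast
  obtain qs C where qs: "\<forall>(a, b)\<in>set qs. a \<noteq> b" "\<And>f. f \<in> H \<Longrightarrow> len (binomials (quadruple qs) * f) \<le> C"
    using assms(2) unfolding tame_def by blast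
  let ?B = "max (2 ^ length (quadruple qs) * B) (2 ^ length (quadruple ps) * C)"
  have "len (binomials (quadruple (ps @ qs)) * f) \<le> ?B" if "f \<in> G \<union> H" for f
  proof (cases "f \<in> G")
    case True
    have "binomials (quadruple (ps @ qs)) * f = binomials (quadruple qs) * (binomials (quadruple ps) * f)"
      by (simp add: mult_ac)
    then have "len (binomials (quadruple (ps @ qs)) * f) \<le> 2 ^ length (quadruple qs) * len (binomials (quadruple ps) * f)"
      using len_binomials_mult by metis
    also have "\<dots> \<le> 2 ^ length (quadruple qs) * B" using ps(2)[OF True] by (intro mult_left_mono) auto
    finally show ?thesis by simp
  next
    case False
    then have "f \<in> H" using that by simp
    have "binomials (quadruple (ps @ qs)) * f = binomials (quadruple ps) * (binomials (quadruple qs) * f)"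
      by (simp add: mult_ac)
    then have "len (binomials (quadruple (ps @ qs)) * f) \<le> 2 ^ length (quadruple ps) * len (binomials (quadruple qs) * f)"
      using len_binomials_mult by metis
    also have "\<dots> \<le> 2 ^ length (quadruple ps) * C" using qs(2)[OF \<open>f \<in> H\<close>] by (intro mult_left_mono) auto
    finally show ?thesis by simp
  qed
  moreover have "\<forall>(a, b)\<in>set (ps @ qs). a \<noteq> b" using ps(1) qs(1) by auto
  ultimately show ?thesis unfolding tame_def by blast
qed

lemma tame_UN: "finite I \<Longrightarrow> (\<And>i. i \<in> I \<Longrightarrow> tame (H i)) \<Longrightarrow> tame (\<Union>i\<in>I. H i)"
proof (induction I rule: finite_induct)
  case empty
  show ?case by (rule tame_subset[OF tame_singleton[of 0]]) simp
qed (simp add: tame_Un)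

text \<open>
  The denominators for the initial values and those of the interpolation are multiplied.  A common
  monomial factor of the roots, \<open>c\<close> in the exponent, is removed first by rescaling the sequence; the
  remaining roots have exponents divisible by 4.
\<close>

lemma tame_recurrence:
  fixes h :: "'x \<Rightarrow> nat \<Rightarrow> laurent"
  assumes "distinct es"
    and rec: "\<And>x q. x \<in> X \<Longrightarrow> shift_prod (map (\<lambda>e. var_pow (c + 4 * e)) es) (h x) q = 0"
    and initial: "\<And>k. k < length es \<Longrightarrow> tame ((\<lambda>x. h x k) ` X)"
  shows "tame (\<Union>q. (\<lambda>x. h x q) ` X)"
proof -
  have "tame (\<Union>k\<in>{..<length es}. (\<lambda>x. h x k) ` X)"
    by (rule tame_UN) (use initial in auto)
  then obtain ps0 B where ps0: "\<forall>(a, b)\<in>set ps0. a \<noteq> b"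
    and B': "\<forall>f\<in>(\<Union>k\<in>{..<length es}. (\<lambda>x. h x k) ` X). len (binomials (quadruple ps0) * f) \<le> B"
    unfolding tame_def by blast
  have B: "len (binomials (quadruple ps0) * h x k) \<le> B" if "x \<in> X" "k < length es" for x k
    by (rule B'[rule_format]) (use that in blast)
  have "distinct (map ((*) 4) es)" using assms(1) by (simp add: distinct_map inj_on_def)
  from recurrence_solution[OF this] obtain ps C where
    ps: "\<forall>(a, b)\<in>set ps. a \<in> (*) 4 ` set es \<and> b \<in> (*) 4 ` set es \<and> a \<noteq> b" and C: "0 \<le> C"
    and sol: "\<And>h B. (\<forall>q. shift_prod (map var_pow (map ((*) 4) es)) h q = 0) \<Longrightarrow>
      (\<forall>k<length es. len (h k) \<le> B) \<Longrightarrow>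
      \<exists>\<gamma>. (\<forall>q. binomials ps * h q = (\<Sum>e\<in>(*) 4 ` set es. var_pow (e * int q) * \<gamma> e)) \<and>
           (\<forall>e\<in>(*) 4 ` set es. len (\<gamma> e) \<le> C * B)"
    by auto
  define qs where "qs = map (\<lambda>(a, b). (a div 4, b div 4)) ps"
  have qs: "quadruple qs = ps" "\<forall>(a, b)\<in>set qs. a \<noteq> b"
  proof -
    show "quadruple qs = ps" unfolding quadruple_def qs_def map_map
      by (rule map_idI) (use ps in force)
    show "\<forall>(a, b)\<in>set qs. a \<noteq> b" using ps by (force simp: qs_def)
  qed
  let ?w = "var_pow (- c)"
  have "len (binomials (quadruple (qs @ ps0)) * h x q) \<le> real (length es) * (C * B)"
    if x: "x \<in> X" for x q
  proof -
    let ?g = "\<lambda>q. ?w ^ q * (binomials (quadruple ps0) * h x q)"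
    have "map var_pow (map ((*) 4) es) = map ((*) ?w) (map (\<lambda>e. var_pow (c + 4 * e)) es)"
      by (simp add: mult_single)
    then have g0: "\<forall>q. shift_prod (map var_pow (map ((*) 4) es)) ?g q = 0"
      by (simp only: shift_prod_rescale shift_prod_mult rec[OF x] mult_zero_right) simp
    have gB: "\<forall>k<length es. len (?g k) \<le> B"
      using B[OF x] by (simp add: var_pow_power)
    obtain \<gamma> where
      \<gamma>0: "\<forall>q. binomials ps * ?g q = (\<Sum>e\<in>(*) 4 ` set es. var_pow (e * int q) * \<gamma> e)" and
      \<gamma>2: "\<forall>e\<in>(*) 4 ` set es. len (\<gamma> e) \<le> C * B"
      using sol[OF g0 gB] by blast
    note \<gamma>1 = \<gamma>0[rule_format]
    have "?w ^ q * (binomials (quadruple (qs @ ps0)) * h x q) = binomials ps * ?g q"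
      by (simp add: qs mult_ac)
    then have "len (binomials (quadruple (qs @ ps0)) * h x q) = len (binomials ps * ?g q)"
      by (metis len_monomial_mult abs_1 mult_1 of_int_1 var_pow_power)
    also have "\<dots> \<le> (\<Sum>e\<in>(*) 4 ` set es. len (var_pow (e * int q) * \<gamma> e))"
      unfolding \<gamma>1 by (rule len_sum)
    also have "\<dots> \<le> (\<Sum>e\<in>(*) 4 ` set es. C * B)"
      proof (rule sum_mono)
      fix e assume "e \<in> (*) 4 ` set es"
      then have "len (\<gamma> e) \<le> C * B" using \<gamma>2 by blast
      then show "len (var_pow (e * int q) * \<gamma> e) \<le> C * B" by simp
    qed
    also have "\<dots> = real (length es) * (C * B)"
      using assms(1) by (simp add: card_image inj_on_def distinct_card)
    finally show ?thesis .
  qed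
  moreover have "\<forall>(a, b)\<in>set (qs @ ps0). a \<noteq> b" using qs(2) ps0 by auto
  ultimately show ?thesis unfolding tame_def by blast
qed

section \<open>Brackets of braids with powers of a twist\<close>

text \<open>
  The roots of the full twist on \<open>l + 1\<close> strands are \<open>A\<close> to the powers \<open>l (l + 1) + 4 e\<close>.  Passing from
  \<open>l - 1\<close> strands to \<open>l + 1\<close> strands lowers \<open>e\<close> by \<open>l + 1\<close>, because
  \<open>(l - 2) (l - 1) - 6 = l (l + 1) - 4 (l + 1)\<close>.
\<close>

primrec twist_exponents :: "nat \<Rightarrow> nat \<Rightarrow> int list" where
  "twist_exponents 0 l = [0]"
| "twist_exponents (Suc d) l =
     (if l = 0 then [0] else 0 # map (\<lambda>e. e - int (Suc l)) (twist_exponents d (l - 2)))"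

lemma twist_exponents_nonpos: "e \<in> set (twist_exponents d l) \<Longrightarrow> e \<le> 0"
  by (induction d arbitrary: l e) (fastforce split: if_splits)+

lemma distinct_twist_exponents: "distinct (twist_exponents d l)"
proof (induction d arbitrary: l)
  case (Suc d)
  have "0 \<notin> (\<lambda>e. e - int (Suc l)) ` set (twist_exponents d (l - 2))"
    using twist_exponents_nonpos[of _ d "l - 2"] by force
  then show ?case using Suc by (auto simp: distinct_map inj_on_def)
qed simp

definition repeat_word :: "nat \<Rightarrow> nat list \<Rightarrow> nat list" where
  "repeat_word q u = concat (replicate q u)"

lemma repeat_word_add: "repeat_word (p + q) u = repeat_word p u @ repeat_word q u"
  by (simp add: repeat_word_def replicate_add)

lemma repeat_word_mult: "repeat_word (p * q) u = repeat_word p (repeat_word q u)"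
  by (induction p) (simp_all add: repeat_word_add, simp_all add: repeat_word_def)

lemma set_repeat_word: "set (repeat_word q u) \<subseteq> set u"
  by (auto simp: repeat_word_def)

lemma (in temperley_lieb) word_repeat: "word (repeat_word q u) = word u ^ q"
  by (induction q) (simp_all add: repeat_word_def)

context colouring_rep
begin

lemma twist_roots_monomials:
  "l < 2 * d \<Longrightarrow> twist_roots (scal A) (scal (inverse A)) d l =
    map (\<lambda>e. scal (A powi (int (l * Suc l) + 4 * e))) (twist_exponents d l)"
proof (induction d arbitrary: l)
  case (Suc d)
  show ?case
  proof (cases "l = 0")
    case True
    then show ?thesis by (simp add: scal_simps)
  next
    case False
    have "d = 0 \<longrightarrow> l = 1" using Suc.prems False by auto
    have IH: "twist_roots (scal A) (scal (inverse A)) d (l - 2) =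
      map (\<lambda>e. scal (A powi (int ((l - 2) * Suc (l - 2)) + 4 * e))) (twist_exponents d (l - 2))"
    proof (cases "d = 0")
      case True
      then have "l = 1" using Suc.prems False by simp
      then show ?thesis using True by (simp add: scal_simps)
    next
      case False
      then show ?thesis using Suc.prems by (intro Suc.IH) auto
    qed
    have exps: "int ((l - 2) * Suc (l - 2)) - 6 = int (l * Suc l) - 4 * int (Suc l)"
    proof (cases "l = 1")
      case False
      then have "2 \<le> l" using \<open>l \<noteq> 0\<close> by linarith
      then obtain j where "l = 2 + j" using le_Suc_ex by blast
      then show ?thesis by (simp add: algebra_simps)
    qed simp
    have root: "scal (inverse A) ^ 6 * scal (A powi (int ((l - 2) * Suc (l - 2)) + 4 * e)) =
        scal (A powi (int (l * Suc l) + 4 * (e - int (Suc l))))" for e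
    proof -
      have "inverse A ^ 6 = A powi (- 6)" by (simp add: power_int_def)
      then have "inverse A ^ 6 * A powi (int ((l - 2) * Suc (l - 2)) + 4 * e) =
          A powi (- 6 + (int ((l - 2) * Suc (l - 2)) + 4 * e))"
        using A_nonzero by (simp only: power_int_add[OF disjI1[OF A_nonzero]])
      also have "- 6 + (int ((l - 2) * Suc (l - 2)) + 4 * e) = int (l * Suc l) + 4 * (e - int (Suc l))"
        using exps by (simp only: right_diff_distrib)
      finally show ?thesis by (simp only: scal_power[symmetric] scal_simps(5)[symmetric])
    qed
    have "scal A ^ (l * Suc l) = scal (A powi (int (l * Suc l) + 4 * 0))"
      by (simp only: scal_power[symmetric] power_int_of_nat mult_zero_right add_0_right)
    then show ?thesis
      unfolding twist_roots.simps twist_exponents.simps IH if_not_P[OF False] list.map map_map comp_def root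
      by (simp only:)
  qed
qed simp

text \<open>
  A factor \<open>S - c\<close> acting on the brackets is a factor \<open>F - c\<close> inside the trace.
\<close>

lemma shift_prod_colour_trace:
  assumes "\<And>q. of_nat m * laurent_eval (h q) A = colour_trace m n (X * F ^ q * Y)"
  shows "of_nat m * laurent_eval (shift_prod (map var_pow ks) h q) A =
    colour_trace m n (X * (annihilator F (map (\<lambda>k. scal (A powi k)) ks) * F ^ q) * Y)"
  using assms
proof (induction ks arbitrary: h X)
  case Nil
  then show ?case by simp
next
  case (Cons k ks)
  let ?c = "scal (A powi k)"
  have "of_nat m * laurent_eval (h (Suc q) - var_pow k * h q) A = colour_trace m n (X * (F - ?c) * F ^ q * Y)" for q
  proof -
    have "X * ?c = ?c * X" by (rule scal_commutes[symmetric])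
    then have "X * (F - ?c) * F ^ q * Y = X * F ^ Suc q * Y - scal (A powi k) * (X * F ^ q * Y)"
      by (simp only: left_diff_distrib right_diff_distrib mult.assoc power_Suc)
    then have "colour_trace m n (X * (F - ?c) * F ^ q * Y) =
        of_nat m * laurent_eval (h (Suc q)) A - A powi k * (of_nat m * laurent_eval (h q) A)"
      by (simp only: colour_trace_simps Cons.prems)
    then show ?thesis
      by (simp add: laurent_eval_diff laurent_eval_mult[OF A_nonzero] algebra_simps)
  qed
  from Cons.IH[OF this] show ?case by (simp add: mult.assoc)
qed

end

lemma bracket_full_twist_recurrence:
  assumes "0 < n" "Suc l \<le> n" "valid_word n x" "valid_word n y"
  shows "shift_prod (map (\<lambda>e. var_pow (int (l * Suc l) + 4 * e)) (twist_exponents (Suc l) l))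
    (\<lambda>q. bracket n (x @ repeat_word q (repeat_word (Suc l) [1..<1 + l]) @ y)) q = 0"
    (is "shift_prod _ ?h q = 0")
proof (rule laurent_eqI)
  fix m A assume "colouring_rep m A"
  then interpret colouring_rep m A .
  let ?F = "full_twist 1 l" and ?u = "repeat_word (Suc l) [1..<1 + l]"
  have F: "word (repeat_word q ?u) = ?F ^ q" for q
    by (simp only: word_repeat full_twist_def twist_def)
  have h: "of_nat m * laurent_eval (?h q) A = colour_trace m n (word x * ?F ^ q * word y)" for q
  proof -
    have "set (repeat_word q ?u) \<subseteq> {1..<1 + l}"
      by (rule order_trans[OF set_repeat_word], rule order_trans[OF set_repeat_word])
        (simp only: set_upt order_refl)
    then have "valid_word n (x @ repeat_word q ?u @ y)" using assms by fastforce
    from colour_trace_word[OF assms(1) this] show ?thesis by (simp only: word_simps F mult.assoc)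
  qed
  have "annihilator ?F (twist_roots (scal A) (scal (inverse A)) (Suc l) l) = 0"
    by (rule full_twist_annihilated) simp
  moreover have "twist_roots (scal A) (scal (inverse A)) (Suc l) l =
      map (\<lambda>e. scal (A powi (int (l * Suc l) + 4 * e))) (twist_exponents (Suc l) l)"
    by (rule twist_roots_monomials) simp
  ultimately have "annihilator ?F (map (\<lambda>k. scal (A powi k))
      (map (\<lambda>e. int (l * Suc l) + 4 * e) (twist_exponents (Suc l) l))) = 0"
    by (simp only: map_map comp_def)
  then have "of_nat m * laurent_eval (shift_prod (map var_pow
      (map (\<lambda>e. int (l * Suc l) + 4 * e) (twist_exponents (Suc l) l))) ?h q) A = 0"
    using shift_prod_colour_trace[of ?h n "word x" ?F "word y", OF h]
    by (simp only: mult_zero_left mult_zero_right colour_trace_simps)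
  then show "laurent_eval (shift_prod (map (\<lambda>e. var_pow (int (l * Suc l) + 4 * e))
      (twist_exponents (Suc l) l)) ?h q) A = laurent_eval 0 A"
    using m_pos by (simp only: map_map comp_def) simp
qed

text \<open>
  The full twist is the power \<open>l + 1\<close> of the twist.  Along each residue class of exponents modulo
  \<open>l + 1\<close> the recurrence applies, with initial values that are tame by hypothesis.
\<close>

lemma tame_twist:
  assumes "0 < n" "Suc l \<le> n"
    and valid: "\<And>x y. (x, y) \<in> Q \<Longrightarrow> valid_word n x \<and> valid_word n y"
    and initial: "\<And>t. tame ((\<lambda>(x, y). bracket n (x @ repeat_word t [1..<1 + l] @ y)) ` Q)"
  shows "tame (\<Union>q. (\<lambda>(x, y). bracket n (x @ repeat_word q [1..<1 + l] @ y)) ` Q)"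
proof -
  let ?T = "[1..<1 + l]" and ?F = "repeat_word (Suc l) [1..<1 + l]"
  have residue: "tame (\<Union>q. (\<lambda>(x, y). bracket n (x @ repeat_word q ?F @ repeat_word t ?T @ y)) ` Q)"
    for t
  proof -
    have "tame (\<Union>q. (\<lambda>z. case z of (x, y) \<Rightarrow>
        bracket n (x @ repeat_word q ?F @ repeat_word t ?T @ y)) ` Q)"
    proof (rule tame_recurrence[OF distinct_twist_exponents[of "Suc l" l], where c = "int (l * Suc l)"])
      fix z q assume "z \<in> Q"
      moreover obtain x y where z: "z = (x, y)" by fastforce
      ultimately have "valid_word n x" "valid_word n (repeat_word t ?T @ y)"
        using valid[of x y] set_repeat_word[of t ?T] assms(2) by fastforce+
      from bracket_full_twist_recurrence[OF assms(1,2) this, of q]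
      show "shift_prod (map (\<lambda>e. var_pow (int (l * Suc l) + 4 * e)) (twist_exponents (Suc l) l))
        (\<lambda>q. case z of (x, y) \<Rightarrow>
          bracket n (x @ repeat_word q ?F @ repeat_word t ?T @ y)) q = 0"
        by (simp only: z case_prod_conv)
    next
      fix k
      have "x @ repeat_word k ?F @ repeat_word t ?T @ y =
          x @ repeat_word (k * Suc l + t) ?T @ y" for x y
        by (simp only: repeat_word_mult repeat_word_add append_assoc)
      then show "tame ((\<lambda>z. case z of (x, y) \<Rightarrow>
          bracket n (x @ repeat_word k ?F @ repeat_word t ?T @ y)) ` Q)"
        using initial[of "k * Suc l + t"] by (simp only:)
    qed
    then show ?thesis .
  qed
  have "tame (\<Union>t\<in>{..<Suc l}. \<Union>q. (\<lambda>(x, y).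
      bracket n (x @ repeat_word q ?F @ repeat_word t ?T @ y)) ` Q)"
    by (rule tame_UN) (use residue in auto)
  then show ?thesis
  proof (rule tame_subset)
    show "(\<Union>q. (\<lambda>(x, y). bracket n (x @ repeat_word q ?T @ y)) ` Q) \<subseteq>
      (\<Union>t\<in>{..<Suc l}. \<Union>q. (\<lambda>(x, y).
        bracket n (x @ repeat_word q ?F @ repeat_word t ?T @ y)) ` Q)"
    proof
      fix f assume "f \<in> (\<Union>q. (\<lambda>(x, y). bracket n (x @ repeat_word q ?T @ y)) ` Q)"
      then obtain q x y where f: "(x, y) \<in> Q" "f = bracket n (x @ repeat_word q ?T @ y)" by auto
      have "repeat_word q ?T = repeat_word (q div Suc l * Suc l + q mod Suc l) ?T"
        by (simp only: div_mult_mod_eq)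
      then have "repeat_word q ?T =
          repeat_word (q div Suc l) ?F @ repeat_word (q mod Suc l) ?T"
        by (simp only: repeat_word_mult repeat_word_add)
      then have "f = bracket n (x @ repeat_word (q div Suc l) ?F @
          repeat_word (q mod Suc l) ?T @ y)"
        using f(2) by (simp only: append_assoc)
      moreover have "q mod Suc l \<in> {..<Suc l}" by simp
      ultimately show "f \<in> (\<Union>t\<in>{..<Suc l}. \<Union>q. (\<lambda>(x, y).
          bracket n (x @ repeat_word q ?F @ repeat_word t ?T @ y)) ` Q)"
        using f(1) by (intro UN_I[of "q mod Suc l"] UN_I[of "q div Suc l"] image_eqI[of _ _ "(x, y)"])
          (simp_all only: case_prod_conv UNIV_I)
    qed
  qed
qed

section \<open>T-braids on a bounded number of strands\<close>

text \<open>
  Products of powers of the twists with \<open>l\<close> crossings, for \<open>l\<close> in a list; the exponents are arbitrary.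
\<close>

primrec twist_words :: "nat list \<Rightarrow> nat list set" where
  "twist_words [] = {[]}"
| "twist_words (l # ls) = {repeat_word q [1..<1 + l] @ y | q y. y \<in> twist_words ls}"

lemma twist_words_valid:
  "(\<And>l. l \<in> set ls \<Longrightarrow> l < n) \<Longrightarrow> y \<in> twist_words ls \<Longrightarrow> valid_word n y"
proof (induction ls arbitrary: y)
  case (Cons l ls)
  then obtain q z where y: "y = repeat_word q [1..<1 + l] @ z" and z: "z \<in> twist_words ls" by auto
  have "valid_word n z" using Cons.IH[OF _ z] Cons.prems(1) by simp
  moreover have "valid_word n (repeat_word q [1..<1 + l])"
  proof
    fix i assume "i \<in> set (repeat_word q [1..<1 + l])"
    then have "i \<in> set [1..<1 + l]" using set_repeat_word by blast
    then show "1 \<le> i \<and> i < n" using Cons.prems(1)[of l] by auto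
  qed
  ultimately show ?case unfolding y set_append ball_Un by (rule conjI[rotated])
qed simp

text \<open>
  The exponents are set free one after another from the left; those further to the right are free by
  induction, for every fixed prefix.
\<close>

lemma tame_twist_words:
  assumes "0 < n"
  shows "(\<And>l. l \<in> set ls \<Longrightarrow> l < n) \<Longrightarrow> valid_word n x \<Longrightarrow>
    tame ((\<lambda>y. bracket n (x @ y)) ` twist_words ls)"
proof (induction ls arbitrary: x)
  case Nil
  show ?case by (simp add: tame_singleton)
next
  case (Cons l ls)
  have l: "Suc l \<le> n" using Cons.prems(1)[of l] by simp
  let ?Q = "{x} \<times> twist_words ls"
  have "tame (\<Union>q. (\<lambda>(x, y). bracket n (x @ repeat_word q [1..<1 + l] @ y)) ` ?Q)"
  proof (rule tame_twist[OF assms l])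
    show "valid_word n x' \<and> valid_word n y" if "(x', y) \<in> ?Q" for x' y
      using that Cons.prems twist_words_valid[of ls n y] by auto
    fix t
    have "valid_word n (x @ repeat_word t [1..<1 + l])"
    proof
      fix i assume "i \<in> set (x @ repeat_word t [1..<1 + l])"
      then have "i \<in> set x \<or> i \<in> set [1..<1 + l]"
        using subsetD[OF set_repeat_word, of i t "[1..<1 + l]"] unfolding set_append Un_iff by blast
      then show "1 \<le> i \<and> i < n" using Cons.prems(2) l by auto
    qed
    from Cons.IH[OF _ this] Cons.prems(1)
    have "tame ((\<lambda>y. bracket n ((x @ repeat_word t [1..<1 + l]) @ y)) ` twist_words ls)" by simp
    moreover have "(\<lambda>(x, y). bracket n (x @ repeat_word t [1..<1 + l] @ y)) ` ?Q =
        (\<lambda>y. bracket n ((x @ repeat_word t [1..<1 + l]) @ y)) ` twist_words ls"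
      by (auto simp del: upt_Suc)
    ultimately show "tame ((\<lambda>(x, y). bracket n (x @ repeat_word t [1..<1 + l] @ y)) ` ?Q)"
      by (simp only:)
  qed
  moreover have "(\<lambda>y. bracket n (x @ y)) ` twist_words (l # ls) \<subseteq>
      (\<Union>q. (\<lambda>(x, y). bracket n (x @ repeat_word q [1..<1 + l] @ y)) ` ?Q)"
    by (auto simp del: upt_Suc)
  ultimately show ?case by (rule tame_subset)
qed

lemma twist_words_append: "y \<in> twist_words ls \<Longrightarrow> y \<in> twist_words (ks @ ls)"
proof (induction ks)
  case (Cons k ks)
  have "y = repeat_word 0 [1..<1 + k] @ y" by (simp add: repeat_word_def)
  then show ?case using Cons unfolding append_Cons twist_words.simps by blast
qed simp

text \<open>
  Equal entries of the increasing list are adjacent, so each twist occurs in a single power.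
\<close>

lemma t_word_mem_twist_words:
  "sorted ds \<Longrightarrow> (\<And>d. d \<in> set ds \<Longrightarrow> k < d \<and> d \<le> n) \<Longrightarrow> t_word ds \<in> twist_words [k..<n]"
proof (induction ds arbitrary: k)
  case Nil
  have "[] \<in> twist_words ls" for ls using twist_words_append[of "[]" "[]" ls] by simp
  then show ?case by simp
next
  case (Cons d ds)
  let ?l = "d - 1"
  have d: "k < d" "d \<le> n" using Cons.prems(2)[of d] by auto
  have "?l < d' \<and> d' \<le> n" if "d' \<in> set ds" for d'
    using Cons.prems that d by fastforce
  then have "t_word ds \<in> twist_words [?l..<n]" using Cons.IH[of ?l] Cons.prems(1) by simp
  moreover have l: "[?l..<n] = ?l # [d..<n]" using d by (simp add: upt_conv_Cons)
  ultimately obtain q y where y: "t_word ds = repeat_word q [1..<1 + ?l] @ y" "y \<in> twist_words [d..<n]"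
    by auto
  have "t_word (d # ds) = repeat_word (Suc q) [1..<1 + ?l] @ y"
    using y(1) d by (simp add: repeat_word_def)
  then have "t_word (d # ds) \<in> twist_words [?l..<n]" unfolding l twist_words.simps using y(2) by blast
  then have "t_word (d # ds) \<in> twist_words ([k..<?l] @ [?l..<n])" by (rule twist_words_append)
  moreover have "[k..<?l] @ [?l..<n] = [k..<n]"
    using d upt_add_eq_append[of k ?l "n - ?l"] by simp
  ultimately show ?case by (simp only:)
qed

definition t_brackets :: "nat \<Rightarrow> laurent set" where
  "t_brackets N = {bracket n (t_word ds) | n ds. 1 \<le> n \<and> n \<le> N \<and> sorted ds \<and> set ds \<subseteq> {1..n}}"

lemma tame_t_brackets: "tame (t_brackets N)"
proof -
  have "tame (\<Union>n\<in>{1..N}. (\<lambda>y. bracket n ([] @ y)) ` twist_words [0..<n])"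
  proof (rule tame_UN)
    fix n assume "n \<in> {1..N}"
    then show "tame ((\<lambda>y. bracket n ([] @ y)) ` twist_words [0..<n])"
      by (intro tame_twist_words) auto
  qed simp
  then show ?thesis
  proof (rule tame_subset)
    show "t_brackets N \<subseteq> (\<Union>n\<in>{1..N}. (\<lambda>y. bracket n ([] @ y)) ` twist_words [0..<n])"
    proof
      fix f assume "f \<in> t_brackets N"
      then obtain n ds where f: "f = bracket n (t_word ds)" "1 \<le> n" "n \<le> N" "sorted ds" "set ds \<subseteq> {1..n}"
        unfolding t_brackets_def by blast
      have "t_word ds \<in> twist_words [0..<n]"
        by (rule t_word_mem_twist_words[OF f(4)]) (use f(5) in force)
      then show "f \<in> (\<Union>n\<in>{1..N}. (\<lambda>y. bracket n ([] @ y)) ` twist_words [0..<n])"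
        using f by (intro UN_I[of n] image_eqI[of _ _ "t_word ds"]) auto
    qed
  qed
qed


section \<open>From the bracket to the Jones polynomial\<close>

text \<open>
  Equality up to the units of the ring, which preserve the length.
\<close>

definition associated :: "laurent \<Rightarrow> laurent \<Rightarrow> bool" where
  "associated f g \<longleftrightarrow> (\<exists>k c. \<bar>c\<bar> = 1 \<and> f = monomial k c * g)"

lemma associated_refl: "associated f f"
  unfolding associated_def by (intro exI[of _ 0] exI[of _ 1]) simp

lemma associated_sym: "associated f g \<Longrightarrow> associated g f"
proof -
  assume "associated f g"
  then obtain k c where kc: "\<bar>c\<bar> = 1" "f = monomial k c * g"
    unfolding associated_def by blast
  have "c * c = 1" using kc(1) by (metis abs_mult_self_eq mult_1)
  then have "monomial (- k) c * f = g"
    unfolding kc(2) by (simp add: mult_single flip: mult.assoc)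
  then show ?thesis unfolding associated_def using kc(1) by metis
qed

lemma associated_trans: "associated f g \<Longrightarrow> associated g h \<Longrightarrow> associated f h"
proof -
  assume "associated f g" "associated g h"
  then obtain k c j d where "\<bar>c\<bar> = 1" "f = monomial k c * g" "\<bar>d\<bar> = 1"
    "g = monomial j d * h"
    unfolding associated_def by blast
  then have "\<bar>c * d\<bar> = 1 \<and> f = monomial (k + j) (c * d) * h"
    by (simp add: abs_mult mult_single flip: mult.assoc)
  then show ?thesis unfolding associated_def by blast
qed

lemma associated_framing: "associated ((- var_pow 3) ^ n * f) f"
proof -
  have "(- var_pow 3) ^ n = monomial (3 * int n) ((- 1) ^ n)"
  proof (induction n)
    case (Suc n)
    have "- var_pow 3 = monomial 3 (- 1)" by (simp add: single_uminus)
    then show ?case using Suc by (simp add: mult_single algebra_simps)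
  qed simp
  moreover have "\<bar>(- 1) ^ n :: int\<bar> = 1" by (simp add: power_abs)
  ultimately show ?thesis unfolding associated_def by metis
qed

lemma len_binomials_associated:
  assumes "associated f g"
  shows "len (binomials ps * f) = len (binomials ps * g)"
proof -
  obtain k c where kc: "\<bar>c\<bar> = 1" "f = monomial k c * g"
    using assms unfolding associated_def by blast
  have *: "binomials ps * f = monomial k c * (binomials ps * g)"
    unfolding kc(2) by (rule mult.left_commute)
  have "\<bar>of_int c :: real\<bar> = 1" using kc(1) by (simp flip: of_int_abs)
  then show ?thesis unfolding * by simp
qed

definition negate_pairs :: "(int \<times> int) list \<Rightarrow> (int \<times> int) list" where
  "negate_pairs = map (\<lambda>(a, b). (- a, - b))"

text \<open>
  Taking every fourth coefficient commutes with multiplication by a binomial in the fourth power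
  of the variable, and it does not increase the length.  The signs change because the variable of the Jones
  polynomial is \<open>A\<close> to the power \<open>- 4\<close>.
\<close>

lemma len_binomials_extract:
  assumes "\<And>j. cf g j = cf f (r - 4 * j)"
  shows "len (binomials (negate_pairs ps) * g) \<le> len (binomials (quadruple ps) * f)"
  using assms
proof (induction ps arbitrary: f g)
  case Nil
  have "len g = (\<Sum>j\<in>supp g. \<bar>of_int (cf f (r - 4 * j))\<bar>)"
    by (simp add: len_def Nil)
  also have "\<dots> = (\<Sum>k\<in>(\<lambda>j. r - 4 * j) ` supp g. \<bar>of_int (cf f k)\<bar>)"
    by (subst sum.reindex) (auto simp: inj_on_def)
  also have "\<dots> \<le> len f"
    unfolding len_def by (rule sum_mono2) (use Nil in \<open>auto simp: in_keys_iff\<close>)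
  finally show ?case by (simp add: negate_pairs_def quadruple_def)
next
  case (Cons p ps)
  obtain a b where p: "p = (a, b)" by fastforce
  have "cf ((var_pow (- a) - var_pow (- b)) * g) j = cf ((var_pow (4 * a) - var_pow (4 * b)) * f) (r - 4 * j)" for j
    unfolding left_diff_distrib lookup_minus cf_monomial_mult Cons.prems
    by (simp add: right_diff_distrib distrib_left diff_diff_eq)
  from Cons.IH[OF this] show ?case
    by (simp add: negate_pairs_def quadruple_def p mult_ac)
qed

text \<open>
  The offset \<open>r\<close> is 0 or 2, depending on whether the exponents of the Jones polynomial are integers.
\<close>

lemma cf_jones: "\<exists>r. \<forall>j. cf (jones n w) j = cf (normalised_bracket n w) (r - 4 * j)"
proof -
  have 1: "cf (jones_sqrt n w) j = cf (normalised_bracket n w) (- 2 * j)" for j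
    unfolding jones_sqrt_def by (subst map_key.rep_eq) (auto simp: inj_def)
  have 2: "cf (Poly_Mapping.map_key (\<lambda>j. 2 * j) V) j = cf V (2 * j)" for V :: laurent and j
    by (subst map_key.rep_eq) (auto simp: inj_def)
  show ?thesis
  proof (cases "\<forall>j\<in>supp (jones_sqrt n w). even j")
    case True
    then have "cf (jones n w) j = cf (normalised_bracket n w) (0 - 4 * j)" for j
      by (simp add: jones_def Let_def 1 2)
    then show ?thesis by blast
  next
    case False
    then have "jones n w = Poly_Mapping.map_key (\<lambda>j. 2 * j) (var_pow 1 * jones_sqrt n w)"
      by (simp only: jones_def Let_def if_False)
    then have "cf (jones n w) j = cf (normalised_bracket n w) (2 - 4 * j)" for j
      by (simp add: 1 2 cf_monomial_mult right_diff_distrib)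
    then show ?thesis by blast
  qed
qed

lemma associated_normalised_bracket: "associated (normalised_bracket n w) (kauffman_bracket n w)"
  unfolding associated_def normalised_bracket_def
  by (intro exI[of _ "- 3 * writhe w"] exI[of _ "if even (writhe w) then 1 else - 1"]) simp

text \<open>
  The normalisation of the bracket is a unit and does not affect the bound.
\<close>

lemma mahler_measure_jones_bounded:
  assumes "tame H"
  shows "\<exists>C. \<forall>n w. (\<exists>f\<in>H. associated (kauffman_bracket n w) f) \<longrightarrow> mahler_measure (jones n w) \<le> C"
proof -
  obtain ps B where ps: "\<forall>(a, b)\<in>set ps. a \<noteq> b"
    and B: "\<And>f. f \<in> H \<Longrightarrow> len (binomials (quadruple ps) * f) \<le> B"
    using assms unfolding tame_def by blast
  have "\<forall>(a, b)\<in>set (negate_pairs ps). a \<noteq> b" using ps by (auto simp: negate_pairs_def)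
  then obtain C where C: "\<And>f. len (binomials (negate_pairs ps) * f) \<le> B \<Longrightarrow> mahler_measure f \<le> C"
    using mahler_measure_bounded[of "negate_pairs ps" B] by blast
  have "mahler_measure (jones n w) \<le> C" if f: "f \<in> H" "associated (kauffman_bracket n w) f" for n w f
  proof (rule C)
    obtain r where r: "\<And>j. cf (jones n w) j = cf (normalised_bracket n w) (r - 4 * j)"
      using cf_jones by blast
    have "associated (normalised_bracket n w) f"
      using associated_trans[OF associated_normalised_bracket f(2)] .
    then have "len (binomials (quadruple ps) * normalised_bracket n w) \<le> B"
      using B[OF f(1)] by (simp only: len_binomials_associated)
    then show "len (binomials (negate_pairs ps) * jones n w) \<le> B"
      using len_binomials_extract[OF r] by (rule order_trans[rotated])
  qed
  then show ?thesis by blast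
qed


section \<open>The two families of braid words\<close>

lemma conjugate_properties:
  assumes "sorted ds" "ds \<noteq> []" "\<forall>d\<in>set ds. 1 \<le> d"
  shows "sorted (conjugate ds)" "set (conjugate ds) \<subseteq> {1..length ds}" "length (conjugate ds) = last ds"
proof -
  have "conjugate_part ds j \<le> conjugate_part ds i" if "i \<le> j" for i j
    using that by (induction ds) auto
  then have "sorted (conjugate ds)"
    unfolding conjugate_def sorted_wrt_rev by (auto simp: sorted_wrt_iff_nth_less)
  then show "sorted (conjugate ds)" .
  show "length (conjugate ds) = last ds" by (simp add: conjugate_def)
  have "1 \<le> conjugate_part ds j" if "j < last ds" for j
  proof -
    have "last ds \<in> set (filter (\<lambda>d. j < d) ds)" using that assms(2) by simp
    then show ?thesis by (cases "filter (\<lambda>d. j < d) ds") auto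
  qed
  then show "set (conjugate ds) \<subseteq> {1..length ds}" by (auto simp: conjugate_def)
qed

text \<open>
  A Lorenz braid has two T-braids, by rows on \<open>last ds\<close> strands and by columns on \<open>length ds\<close>
  strands.
\<close>

lemma lorenz_associated_t_word:
  assumes "sorted ds" "ds \<noteq> []" "\<forall>d\<in>set ds. 1 \<le> d"
  shows "associated (bracket (length ds + last ds) (lorenz_word 1 ds)) (bracket (last ds) (t_word ds))"
    "associated (bracket (length ds + last ds) (lorenz_word 1 ds)) (bracket (length ds) (t_word (conjugate ds)))"
proof -
  let ?p = "length ds" and ?q = "last ds"
  have "1 \<le> ?q" using assms by simp
  then have "bracket (?q + ?p) (lorenz_word 1 ds) = (- var_pow 3) ^ ?p * bracket ?q (t_word ds)"
    using bracket_lorenz_t_word[of "[]" ds ?q] assms last_ge[OF assms(1)] by simp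
  then show "associated (bracket (?p + ?q) (lorenz_word 1 ds)) (bracket ?q (t_word ds))"
    using associated_framing by (simp add: add.commute)
  have *: "bracket (?p + ?q) (lorenz_word 1 (conjugate ds)) =
      (- var_pow 3) ^ ?q * bracket ?p (t_word (conjugate ds))"
  proof -
    have "\<forall>d\<in>set ([] @ conjugate ds). 1 \<le> d \<and> d \<le> ?p" "1 \<le> ?p" "sorted ([] @ conjugate ds)"
      using conjugate_properties(1,2)[OF assms] assms(2) by (auto simp: Suc_le_eq)
    from bracket_lorenz_t_word[OF this(3,1,2)] show ?thesis
      by (simp add: conjugate_properties(3)[OF assms])
  qed
  show "associated (bracket (?p + ?q) (lorenz_word 1 ds)) (bracket ?p (t_word (conjugate ds)))"
    unfolding bracket_lorenz_conjugate[OF assms(1,2), symmetric] * by (rule associated_framing)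
qed

lemma kauffman_bracket_lorenz_braid:
  assumes "lorenz_braid ds w" "sorted ds" "ds \<noteq> []"
  shows "kauffman_bracket (lorenz_strands ds) w = bracket (length ds + last ds) (lorenz_word 1 ds)"
proof -
  let ?n = "length ds + last ds"
  have n: "lorenz_strands ds = ?n" "0 < ?n" using assms(3) by (simp_all add: lorenz_strands_def)
  have w: "braid_on ?n w" "positive_word w"
    using assms(1) n(1) by (auto simp: lorenz_braid_def Let_def positive_word_def)
  have "map (Pos \<circ> gen_index) w = w"
  proof (rule map_idI)
    fix g assume "g \<in> set w"
    then have "is_positive_gen g" using w(2) by (simp add: positive_word_def)
    then show "(Pos \<circ> gen_index) g = g" by (cases g) simp_all
  qed
  then have "kauffman_bracket (lorenz_strands ds) w = bracket ?n (map gen_index w)"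
    by (simp add: bracket_def n(1))
  also have "\<dots> = bracket ?n (lorenz_word 1 ds)"
  proof (rule bracket_eqI[OF n(2)])
    show "valid_word ?n (map gen_index w)" using w(1) by (auto simp: braid_on_def)
    show "valid_word ?n (lorenz_word 1 ds)"
    proof
      fix i assume "i \<in> set (lorenz_word 1 ds)"
      from lorenz_word_bounds[OF _ this, of "last ds"] last_ge[OF assms(2)]
      show "1 \<le> i \<and> i < ?n" by auto
    qed
    fix m A assume "colouring_rep m A"
    then interpret colouring_rep m A .
    show "colour_trace m ?n (word (map gen_index w)) = colour_trace m ?n (word (lorenz_word 1 ds))"
      by (simp only: word_lorenz_braid[OF assms(1)])
  qed
  finally show ?thesis .
qed

lemma t_braid_eq: "t_braid rss = map Pos (t_word (run_expand rss))"
proof (induction rss)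
  case (Cons rs rss)
  obtain r s where rs: "rs = (r, s)" by fastforce
  have "concat (replicate s (map Pos [1..<r])) = map Pos (t_word (replicate s r))"
    by (induction s) simp_all
  then show ?case using Cons by (simp add: t_braid_def run_expand_def rs)
qed (simp add: t_braid_def run_expand_def)

lemma run_expand_last:
  assumes "rss \<noteq> []" "\<forall>(r, s)\<in>set rss. s \<ge> 1"
  shows "last (run_expand rss) = fst (last rss)"
  using assms(1)
proof (cases rss rule: rev_cases)
  case (snoc rss' rs)
  obtain r s where rs: "rs = (r, s)" by fastforce
  then obtain s' where "s = Suc s'" using assms(2) snoc by (cases s) auto
  then have "run_expand rss = run_expand rss' @ replicate s' r @ [r]"
    by (simp add: run_expand_def snoc rs replicate_append_same)
  then show ?thesis by (simp add: snoc rs)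
qed simp

lemma length_run_expand: "length (run_expand rss) = sum_list (map snd rss)"
  by (induction rss) (auto simp: run_expand_def)

theorem corollary6:
  "\<forall>N::nat. N > 0 \<longrightarrow>
     (\<exists>C::real. \<forall>(ds :: nat list) (rss :: (nat \<times> nat) list).
        lorenz_vector ds \<longrightarrow>
        ds = run_expand rss \<longrightarrow> sorted_wrt (<) (map fst rss) \<longrightarrow> (\<forall>(r, s)\<in>set rss. s \<ge> 1) \<longrightarrow>
          (length ds \<le> N \<or> last ds \<le> N \<longrightarrow>
             (\<forall>w. lorenz_braid ds w \<longrightarrow>
                mahler_measure (jones (lorenz_strands ds) w) \<le> C)) \<and>
          (fst (last rss) \<le> N \<or> sum_list (map snd rss) \<le> N \<longrightarrow>
             mahler_measure (jones (fst (last rss)) (t_braid rss)) \<le> C))"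
proof (intro allI impI)
  fix N :: nat
  obtain C where C: "\<And>n w f. f \<in> t_brackets N \<Longrightarrow> associated (kauffman_bracket n w) f \<Longrightarrow>
      mahler_measure (jones n w) \<le> C"
    using mahler_measure_jones_bounded[OF tame_t_brackets[of N]] by blast
  show "\<exists>C::real. \<forall>(ds :: nat list) (rss :: (nat \<times> nat) list).
        lorenz_vector ds \<longrightarrow>
        ds = run_expand rss \<longrightarrow> sorted_wrt (<) (map fst rss) \<longrightarrow> (\<forall>(r, s)\<in>set rss. s \<ge> 1) \<longrightarrow>
          (length ds \<le> N \<or> last ds \<le> N \<longrightarrow>
             (\<forall>w. lorenz_braid ds w \<longrightarrow>
                mahler_measure (jones (lorenz_strands ds) w) \<le> C)) \<and>
          (fst (last rss) \<le> N \<or> sum_list (map snd rss) \<le> N \<longrightarrow>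
             mahler_measure (jones (fst (last rss)) (t_braid rss)) \<le> C)"
  proof (intro exI[of _ C] allI impI)
    fix ds rss
    assume v: "lorenz_vector ds" and ds: "ds = run_expand rss" and s: "\<forall>(r, s)\<in>set rss. s \<ge> 1"
    let ?p = "length ds" and ?q = "last ds"
    have ds': "sorted ds" "ds \<noteq> []" "\<forall>d\<in>set ds. 1 \<le> d"
      using v by (auto simp: lorenz_vector_def)
    have "rss \<noteq> []" using ds ds'(2) by (auto simp: run_expand_def)
    then have rs: "fst (last rss) = ?q" "sum_list (map snd rss) = ?p"
      using run_expand_last[OF _ s] length_run_expand[of rss] ds by simp_all
    note assoc = lorenz_associated_t_word[OF ds']
    have bounded: "mahler_measure (jones n w) \<le> C"
      if "?p \<le> N \<or> ?q \<le> N" "associated (kauffman_bracket n w) (bracket (?p + ?q) (lorenz_word 1 ds))" for n w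
    proof (cases "?q \<le> N")
      case True
      have "bracket ?q (t_word ds) \<in> t_brackets N"
        unfolding t_brackets_def using True ds' last_ge[OF ds'(1)] by fastforce
      then show ?thesis using C associated_trans[OF that(2) assoc(1)] by blast
    next
      case False
      have "bracket ?p (t_word (conjugate ds)) \<in> t_brackets N"
        unfolding t_brackets_def using False that(1) ds'(2) conjugate_properties[OF ds'] 
        by (auto simp: Suc_le_eq)
      then show ?thesis using C associated_trans[OF that(2) assoc(2)] by blast
    qed
    show "(?p \<le> N \<or> ?q \<le> N \<longrightarrow>
             (\<forall>w. lorenz_braid ds w \<longrightarrow> mahler_measure (jones (lorenz_strands ds) w) \<le> C)) \<and>
          (fst (last rss) \<le> N \<or> sum_list (map snd rss) \<le> N \<longrightarrow>
             mahler_measure (jones (fst (last rss)) (t_braid rss)) \<le> C)"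
    proof (intro conjI impI allI)
      fix w assume "?p \<le> N \<or> ?q \<le> N" "lorenz_braid ds w"
      then show "mahler_measure (jones (lorenz_strands ds) w) \<le> C"
        using bounded kauffman_bracket_lorenz_braid[OF _ ds'(1,2)] associated_refl by metis
    next
      assume "fst (last rss) \<le> N \<or> sum_list (map snd rss) \<le> N"
      then have "?p \<le> N \<or> ?q \<le> N" using rs by auto
      moreover have "kauffman_bracket ?q (t_braid rss) = bracket ?q (t_word ds)"
        by (simp add: t_braid_eq bracket_def ds)
      ultimately show "mahler_measure (jones (fst (last rss)) (t_braid rss)) \<le> C"
        using bounded associated_sym[OF assoc(1)] rs(1) by metis
    qed
  qed
qed

end
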